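(* Assume the irregularity condition $\mathrm{Range}(B'P(t))\not\subseteq\mathrm{Range}(R)$, where $P(t)$ denotes the solution of the differential Riccati equation given in the context. Then there exists an optimal and stabilizing solution to Problem 2 if and only if the following conditions hold. 1. There exist solutions $P$ and $P_1$ to $$0=A'P+PA+Q-PBR^{\dagger}B'P\qquad\text{and}\qquad 0=P_1A_0+A_0'P_1+P_1D_0P_1,$$ respectively (where $A_0=A-BR^{\dagger}B'P$ and $D_0=-BR^{\dagger}B'$), that satisfy $P+P_1\ge 0$. 2. $P$ and $P_1$ satisfy $C_0+B_0'P_1=0$. 3. The system $(A_0+D_0P_1,B_0)$ is stabilizable, i.e., there exists a controller $u_1(t)$ such that the system $\dot x(t)=(A_0+D_0P_1)x(t)+B_0u_1(t)$ is stable. In this case, the optimal controller is given by $$u(t)=[-R^{\dagger}B'(P+P_1)+G_0K]x(t),$$ where $K$ must be chosen such that $A_0+D_0P_1+B_0K$ is stable, and the optimal cost is $$J^*=x_0'(P+P_1)x_0 .$$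
   Context: $'$ denotes transpose and $M^{\dagger}$ the Moore--Penrose inverse of $M$; for a symmetric matrix, $M\ge 0$ means positive semidefinite. $A$ ($n\times n$) and $B$ ($n\times m$) are constant matrices; $Q\ge0$ ($n\times n$), $R\ge 0$ ($m\times m$) and $H\ge 0$ ($n\times n$) are symmetric. The system is $\dot x(t)=Ax(t)+Bu(t)$, with $x\in\mathbb{R}^n$, $u\in\mathbb{R}^m$ and initial value $x(0)=x_0$, and the infinite-horizon cost is $$J(x_0;u)=\int_0^\infty[x'(t)Qx(t)+u'(t)Ru(t)]\,dt .$$ The admissible set $\mathcal{U}$ consists of the controls $u(t)$, $t\ge 0$, with $\int_0^\infty\|u(t)\|^2dt<\infty$ that are stabilizing controls. Problem 2: find a control $u(t)\in\mathcal{U}$ which minimizes the cost function $J(x_0;u)$ and stabilizes the system. Irregularity condition: $P(t)$ is the solution (assumed throughout to exist) of the differential Riccati equation $0=\dot P(t)+A'P(t)+P(t)A+Q-P(t)BR^{\dagger}B'P(t)$ with terminal condition $P(T)=H$, where $T$ and $H$ are the terminal time and the terminal weight in the associated finite-horizon cost $\int_{t_0}^T[x'Qx+u'Ru]\,dt+x'(T)Hx(T)$. The case $\mathrm{Range}(B'P(t))\not\subseteq\mathrm{Range}(R)$ is called irregular. (In conditions 1--3, $P$ without argument is instead a solution of the algebraic Riccati equation.) Let $m_0=\mathrm{rank}(R)<m$. $T_0$ is an (invertible) elementary row transformation matrix such that $T_0(I-R^{\dagger}R)=\begin{bmatrix}0\\ \Upsilon_{T_0}\end{bmatrix}$ with $\Upsilon_{T_0}\in\mathbb{R}^{(m-m_0)\times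 m}$ of full row rank. The matrices $G_0$, $B_0$, $C_0'$ are the last $m-m_0$ columns of the indicated matrices: $[\,\ast\ \ G_0\,]=T_0^{-1}$, $[\,\ast\ \ B_0\,]=B(I-R^{\dagger}R)T_0^{-1}$, $[\,\ast\ \ C_0'\,]=PB(I-R^{\dagger}R)T_0^{-1}$, where in the last one $P$ is the solution of the algebraic Riccati equation in condition 1. *)

theory Defs
  imports "HOL-Analysis.Analysis"
begin

section \<open>Matrices\<close>

definition pos_semidef :: "real^'n^'n \<Rightarrow> bool" where
  "pos_semidef M \<longleftrightarrow> transpose M = M \<and> (\<forall>x. 0 \<le> x \<bullet> (M *v x))"

definition is_moore_penrose :: "real^'n^'m \<Rightarrow> real^'m^'n \<Rightarrow> bool" where
  "is_moore_penrose M X \<longleftrightarrow>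
     M ** X ** M = M \<and> X ** M ** X = X \<and>
     transpose (M ** X) = M ** X \<and> transpose (X ** M) = X ** M"

definition pinv :: "real^'n^'m \<Rightarrow> real^'m^'n" where
  "pinv M = (THE X. is_moore_penrose M X)"

definition stable_matrix :: "real^'n^'n \<Rightarrow> bool" where
  "stable_matrix M \<longleftrightarrow>
     (\<forall>c v. v \<noteq> 0 \<and> map_matrix complex_of_real M *v v = c *s v \<longrightarrow> Re c < 0)"

text \<open>The order-preserving enumeration of the last \<open>CARD('k)\<close> elements of the index type \<open>'m\<close>;
  it is only meaningful when \<open>CARD('k) \<le> CARD('m)\<close>.\<close>

definition last_index :: "'k::{finite,linorder} \<Rightarrow> 'm::{finite,linorder}" where
  "last_index j = sorted_list_of_set UNIV ! (CARD('m) - CARD('k) + card {i. i < j})"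

definition last_cols ::
  "real^('m::{finite,linorder})^'n \<Rightarrow> real^('k::{finite,linorder})^'n" where
  "last_cols M = (\<chi> i j. M $ i $ last_index j)"

text \<open>The block matrix with zero rows on top and \<open>Y\<close> in the last rows.\<close>

definition is_zero_above ::
  "real^'n^('m::{finite,linorder}) \<Rightarrow> real^'n^('k::{finite,linorder}) \<Rightarrow> bool" where
  "is_zero_above M Y \<longleftrightarrow>
     (\<forall>j. M $ last_index j = Y $ j) \<and>
     (\<forall>i. i \<notin> range (last_index :: 'k \<Rightarrow> 'm) \<longrightarrow> M $ i = 0)"

section \<open>Linear control systems and the infinite-horizon problem\<close>

text \<open>\<open>x\<close> is the state of \<open>x' = A x + B u\<close>, \<open>x 0 = x0\<close> on \<open>[0,\<infinity>)\<close>, in the integrated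
  (Caratheodory) sense appropriate for controls that are only locally integrable. The values of
  \<open>x\<close> and \<open>u\<close> at negative times are irrelevant.\<close>

definition is_state ::
  "real^'n^'n \<Rightarrow> real^'m^'n \<Rightarrow> real^'n \<Rightarrow> (real \<Rightarrow> real^'m) \<Rightarrow> (real \<Rightarrow> real^'n) \<Rightarrow> bool" where
  "is_state A B x0 u x \<longleftrightarrow>
     (\<forall>t\<ge>0. u absolutely_integrable_on {0..t}) \<and>
     (\<forall>t\<ge>0. ((\<lambda>s. A *v x s + B *v u s) has_integral (x t - x0)) {0..t})"

definition stabilizable :: "real^'n^'n \<Rightarrow> real^'m^'n \<Rightarrow> bool" where
  "stabilizable A B \<longleftrightarrow> (\<forall>x0. \<exists>u x. is_state A B x0 u x \<and> (x \<longlongrightarrow> 0) at_top)"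

text \<open>Membership of \<open>u\<close> in the admissible set, with \<open>x\<close> the corresponding state.\<close>

definition admissible ::
  "real^'n^'n \<Rightarrow> real^'m^'n \<Rightarrow> real^'n \<Rightarrow> (real \<Rightarrow> real^'m) \<Rightarrow> (real \<Rightarrow> real^'n) \<Rightarrow> bool" where
  "admissible A B x0 u x \<longleftrightarrow>
     is_state A B x0 u x \<and>
     (\<lambda>t. (norm (u t))\<^sup>2) absolutely_integrable_on {0..} \<and>
     (x \<longlongrightarrow> 0) at_top"

text \<open>For positive semidefinite \<open>Q\<close>, \<open>R\<close> the integrand is nonnegative, so the cost lives in
  \<open>[0,\<infinity>]\<close>; it may be infinite even for admissible controls.\<close>

definition lq_cost ::
  "real^'n^'n \<Rightarrow> real^'m^'m \<Rightarrow> (real \<Rightarrow> real^'m) \<Rightarrow> (real \<Rightarrow> real^'n) \<Rightarrow> ennreal" where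
  "lq_cost Q R u x =
     (\<integral>\<^sup>+t\<in>{0..}. ennreal (x t \<bullet> (Q *v x t) + u t \<bullet> (R *v u t)) \<partial>lebesgue)"

definition lq_optimal ::
  "real^'n^'n \<Rightarrow> real^'m^'n \<Rightarrow> real^'n^'n \<Rightarrow> real^'m^'m \<Rightarrow> real^'n \<Rightarrow>
     (real \<Rightarrow> real^'m) \<Rightarrow> (real \<Rightarrow> real^'n) \<Rightarrow> bool" where
  "lq_optimal A B Q R x0 u x \<longleftrightarrow>
     admissible A B x0 u x \<and>
     (\<forall>v y. admissible A B x0 v y \<longrightarrow> lq_cost Q R u x \<le> lq_cost Q R v y)"

definition lq_value ::
  "real^'n^'n \<Rightarrow> real^'m^'n \<Rightarrow> real^'n^'n \<Rightarrow> real^'m^'m \<Rightarrow> real^'n \<Rightarrow> ennreal" where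
  "lq_value A B Q R x0 = (INF (u, x) \<in> {(u, x). admissible A B x0 u x}. lq_cost Q R u x)"

section \<open>Riccati equations\<close>

definition riccati_ode_solution ::
  "real^'n^'n \<Rightarrow> real^'m^'n \<Rightarrow> real^'n^'n \<Rightarrow> real^'m^'m \<Rightarrow> real^'n^'n \<Rightarrow>
     real \<Rightarrow> real \<Rightarrow> (real \<Rightarrow> real^'n^'n) \<Rightarrow> bool" where
  "riccati_ode_solution A B Q R H t0 T P \<longleftrightarrow>
     (\<exists>P'. \<forall>t\<in>{t0..T}.
        (P has_vector_derivative P' t) (at t within {t0..T}) \<and>
        0 = P' t + transpose A ** P t + P t ** A + Q
              - P t ** B ** pinv R ** transpose B ** P t) \<and>
     P T = H"

text \<open>The negation of the regular case, in which the range inclusion holds on all of \<open>[t0,T]\<close>.\<close>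

definition irregular ::
  "real^'m^'n \<Rightarrow> real^'m^'m \<Rightarrow> real \<Rightarrow> real \<Rightarrow> (real \<Rightarrow> real^'n^'n) \<Rightarrow> bool" where
  "irregular B R t0 T P \<longleftrightarrow>
     (\<exists>t\<in>{t0..T}. \<not> range ((*v) (transpose B ** P t)) \<subseteq> range ((*v) R))"

definition lq_A0 :: "real^'n^'n \<Rightarrow> real^'m^'n \<Rightarrow> real^'m^'m \<Rightarrow> real^'n^'n \<Rightarrow> real^'n^'n" where
  "lq_A0 A B R P = A - B ** pinv R ** transpose B ** P"

definition lq_D0 :: "real^'m^'n \<Rightarrow> real^'m^'m \<Rightarrow> real^'n^'n" where
  "lq_D0 B R = - (B ** pinv R ** transpose B)"

definition lq_G0 ::
  "real^('m::{finite,linorder})^('m::{finite,linorder}) \<Rightarrow> real^('k::{finite,linorder})^('m::{finite,linorder})" where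
  "lq_G0 T0 = last_cols (matrix_inv T0)"

definition lq_B0 ::
  "real^('m::{finite,linorder})^'n \<Rightarrow> real^('m::{finite,linorder})^('m::{finite,linorder}) \<Rightarrow> real^('m::{finite,linorder})^('m::{finite,linorder}) \<Rightarrow>
     real^('k::{finite,linorder})^'n" where
  "lq_B0 B R T0 = last_cols (B ** (mat 1 - pinv R ** R) ** matrix_inv T0)"

definition lq_C0 ::
  "real^('m::{finite,linorder})^'n \<Rightarrow> real^('m::{finite,linorder})^('m::{finite,linorder}) \<Rightarrow> real^('m::{finite,linorder})^('m::{finite,linorder}) \<Rightarrow> real^'n^'n \<Rightarrow>
     real^'n^('k::{finite,linorder})" where
  "lq_C0 B R T0 P = transpose (last_cols (P ** B ** (mat 1 - pinv R ** R) ** matrix_inv T0))"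

text \<open>The three solvability conditions for a pair \<open>P\<close>, \<open>P1\<close>. Solutions of the algebraic Riccati
  equations are understood to be symmetric. The argument \<open>B0\<close> also determines the number \<open>'k\<close>
  of columns selected in \<^const>\<open>lq_C0\<close>.\<close>

definition solvability_conditions ::
  "real^'n^'n \<Rightarrow> real^('m::{finite,linorder})^'n \<Rightarrow> real^'n^'n \<Rightarrow> real^('m::{finite,linorder})^('m::{finite,linorder}) \<Rightarrow> real^('m::{finite,linorder})^('m::{finite,linorder}) \<Rightarrow>
     real^('k::{finite,linorder})^'n \<Rightarrow> real^'n^'n \<Rightarrow> real^'n^'n \<Rightarrow> bool" where
  "solvability_conditions A B Q R T0 B0 P P1 \<longleftrightarrow>
     transpose P = P \<and> transpose P1 = P1 \<and>
     0 = transpose A ** P + P ** A + Q - P ** B ** pinv R ** transpose B ** P \<and>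
     0 = P1 ** lq_A0 A B R P + transpose (lq_A0 A B R P) ** P1 + P1 ** lq_D0 B R ** P1 \<and>
     pos_semidef (P + P1) \<and>
     lq_C0 B R T0 P + transpose B0 ** P1 = 0 \<and>
     stabilizable (lq_A0 A B R P + lq_D0 B R ** P1) B0"

end

theory Submission
  imports Defs "HOL-Computational_Algebra.Fundamental_Theorem_Algebra"
begin

text \<open>
  Put \<open>X = P + P1\<close>. The two quadratic equations of the solvability conditions add up to the
  algebraic Riccati equation for \<open>X\<close>. The columns of \<open>G0\<close> span the kernel of \<open>R\<close> and
  \<open>B0 = B ** G0\<close>, so the condition \<open>C0 + B0' P1 = 0\<close> says that the range of \<open>B' X\<close> is orthogonal to
  the kernel of \<open>R\<close>, that is, contained in the range of \<open>R\<close>. Hence the conditions ask for a positive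
  semidefinite solution \<open>X\<close> of the Riccati equation that is regular in this sense and for which the
  closed-loop system \<open>A - B R\<^sup>\<dagger> B' X\<close> is stabilizable through the input matrix \<open>B0\<close>, that is, by
  controls in the kernel of \<open>R\<close>. Conversely such an \<open>X\<close> gives the pair \<open>P = X\<close>, \<open>P1 = 0\<close>.

  The conditions suffice by completing the square (\<open>completing_the_square\<close>): along every admissible
  trajectory the cost up to time \<open>t\<close> is \<open>x0' X x0 - x(t)' X x(t)\<close> plus the integral of
  \<open>(u + R\<^sup>\<dagger> B' X x)' R (u + R\<^sup>\<dagger> B' X x)\<close>. The last integrand vanishes exactly if \<open>u + R\<^sup>\<dagger> B' X x\<close> lies
  in the range of \<open>G0\<close>, which leaves the term \<open>G0 K x\<close> free for stabilization
  (\<open>stabilizing_solution_optimal\<close>).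

  For necessity, the trajectories of finite cost form a linear space on which the cost is a
  positive semidefinite quadratic form. Optimality is orthogonality to the trajectories that start
  in \<open>0\<close>, so optimal trajectories can be superposed and the value function is a quadratic form
  \<open>x0' X x0\<close> (\<open>value_matrix\<close>). Dynamic programming over short times shows that
  \<open>x' Q x + u' R u + 2 x' X (A x + B u)\<close> is nonnegative for all vectors \<open>x\<close> and \<open>u\<close>
  (\<open>dissipation_inequality\<close>). Taking \<open>u\<close> in the kernel of \<open>R\<close> gives regularity, and minimizing over
  \<open>u\<close> shows that the Riccati residual of \<open>X\<close> is positive semidefinite. Since the optimal trajectories
  have cost exactly \<open>x0' X x0\<close>, the completed square forces the residual to vanish and the optimal
  control to be \<open>- R\<^sup>\<dagger> B' X x\<close> up to an element of the kernel of \<open>R\<close> (\<open>optimal_synthesis\<close>); this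
  element is a control of the closed-loop system that drives its state to \<open>0\<close>.

  Both directions need that a system all of whose states can be steered to \<open>0\<close> asymptotically has
  a stabilizing linear feedback, and that spectral stability yields square integrable trajectories.
  Both rest on \<open>lmi_alternative\<close>, a separation argument in the space of matrices: if no Lyapunov
  function can be found, there is a nonzero positive semidefinite \<open>Z\<close> whose energy \<open>x' Z x\<close> cannot be
  decreased by any control. For a stabilizable system this is absurd, and for a system without
  input the range of \<open>Z\<close> contains an eigenvector with eigenvalue of nonnegative real part.
\<close>

section \<open>Quadratic forms and matrix algebra\<close>

lemma inner_matrix_sym:
  fixes X :: "real^'n^'n"
  assumes "transpose X = X"
  shows "x \<bullet> (X *v y) = (X *v x) \<bullet> y"
  by (metis assms dot_lmul_matrix transpose_matrix_vector)

lemma inner_matrix_adjoint: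
  fixes X :: "real^'n^'m"
  shows "x \<bullet> (X *v y) = (transpose X *v x) \<bullet> y"
  by (metis dot_lmul_matrix transpose_matrix_vector)

lemma linear_coefficient_zero:
  fixes a b :: real
  assumes "\<And>s. 0 \<le> s * a + s\<^sup>2 * b"
  shows "a = 0"
proof (rule ccontr)
  assume a: "a \<noteq> 0"
  define c where "c = \<bar>b\<bar> + 1"
  have c: "c > 0" "b < c" by (auto simp: c_def)
  have "0 \<le> (- a / c) * a + (- a / c)\<^sup>2 * b" by (rule assms)
  also have "\<dots> = a\<^sup>2 / c\<^sup>2 * (b - c)"
    using c by (simp add: field_simps power2_eq_square)
  also have "\<dots> < 0"
    using a c by (intro mult_pos_neg) auto
  finally show False by simp
qed

lemma linear_lower_bounded_zero:
  fixes a b :: real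
  assumes "\<And>s. 0 \<le> b + s * a"
  shows "a = 0"
proof (rule ccontr)
  assume "a \<noteq> 0"
  then show False using assms[of "- (b + 1) / a"] by simp
qed

lemma nonneg_of_perturbation:
  fixes a b :: real
  assumes "\<And>e. e > 0 \<Longrightarrow> 0 \<le> a + e * b"
  shows "0 \<le> a"
proof (rule ccontr)
  assume "\<not> 0 \<le> a"
  define e where "e = - a / (2 * (\<bar>b\<bar> + 1))"
  have e: "e > 0" unfolding e_def using \<open>\<not> 0 \<le> a\<close> by (intro divide_pos_pos) auto
  have "e * b \<le> e * (\<bar>b\<bar> + 1)" using e by (intro mult_left_mono) auto
  also have "\<dots> = - a / 2" by (simp add: e_def field_simps)
  finally show False using assms[OF e] \<open>\<not> 0 \<le> a\<close> by linarith
qed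

text \<open>The form cannot decrease to first order at a point where it attains its minimum \<open>0\<close>.\<close>

lemma psd_kernel:
  fixes Z :: "real^'n^'n"
  assumes "pos_semidef Z" "x \<bullet> (Z *v x) = 0"
  shows "Z *v x = 0"
proof -
  have sym: "transpose Z = Z" and psd: "\<And>x. 0 \<le> x \<bullet> (Z *v x)"
    using assms(1) by (auto simp: pos_semidef_def)
  have "2 * (y \<bullet> (Z *v x)) = 0" for y
  proof (rule linear_coefficient_zero)
    fix s :: real
    have "0 \<le> (x + s *\<^sub>R y) \<bullet> (Z *v (x + s *\<^sub>R y))" by (rule psd)
    also have "\<dots> = s * (2 * (y \<bullet> (Z *v x))) + s\<^sup>2 * (y \<bullet> (Z *v y))"
      using assms(2) inner_matrix_sym[OF sym, of x y]
      by (simp add: algebra_simps inner_simps matrix_vector_right_distrib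
          matrix_vector_mult_scaleR power2_eq_square inner_commute)
    finally show "0 \<le> \<dots>" .
  qed
  then show ?thesis by (metis inner_eq_zero_iff mult_eq_0_iff zero_neq_numeral)
qed

lemma symmetric_form_zero:
  fixes M :: "real^'n^'n"
  assumes sym: "transpose M = M" and zero: "\<And>x. x \<bullet> (M *v x) = 0"
  shows "M = 0"
proof -
  have "pos_semidef M" using assms by (simp add: pos_semidef_def)
  then have "M *v x = 0" for x using zero by (rule psd_kernel)
  then show ?thesis by (simp add: matrix_eq)
qed

lemma matrix_norm_bound:
  fixes M :: "real^'n^'m"
  obtains C where "C > 0" "\<And>x. norm (M *v x) \<le> C * norm x"
  using bounded_linear.pos_bounded[OF matrix_vector_mul_bounded_linear[of M]] that
  by (metis mult.commute)

lemma quadratic_form_bound: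
  fixes M :: "real^'n^'n"
  obtains C where "C > 0" "\<And>x. \<bar>x \<bullet> (M *v x)\<bar> \<le> C * (norm x)\<^sup>2"
proof -
  obtain C where C: "C > 0" "\<And>x. norm (M *v x) \<le> C * norm x"
    using matrix_norm_bound[of M] by blast
  have "\<bar>x \<bullet> (M *v x)\<bar> \<le> C * (norm x)\<^sup>2" for x
  proof -
    have "\<bar>x \<bullet> (M *v x)\<bar> \<le> norm x * norm (M *v x)" by (rule Cauchy_Schwarz_ineq2)
    also have "\<dots> \<le> norm x * (C * norm x)" using C by (intro mult_left_mono) auto
    finally show ?thesis by (simp add: power2_eq_square mult_ac)
  qed
  with C that show ?thesis by blast
qed

text \<open>The form attains its minimum on the unit sphere, and both sides are homogeneous of degree two.\<close>

lemma positive_form_lower_bound: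
  fixes M :: "real^'n^'n"
  assumes "\<And>x. x \<noteq> 0 \<Longrightarrow> 0 < x \<bullet> (M *v x)"
  obtains c where "c > 0" "\<And>x. c * (norm x)\<^sup>2 \<le> x \<bullet> (M *v x)"
proof -
  have cont: "continuous_on (sphere 0 1) (\<lambda>x. x \<bullet> (M *v x))"
    by (intro continuous_intros linear_continuous_on) auto
  have "sphere (0::real^'n) 1 \<noteq> {}" by (simp add: sphere_eq_empty)
  then obtain z where z: "z \<in> sphere 0 1" "\<And>y. y \<in> sphere 0 1 \<Longrightarrow> z \<bullet> (M *v z) \<le> y \<bullet> (M *v y)"
    using continuous_attains_inf[OF _ _ cont] by auto
  define c where "c = z \<bullet> (M *v z)"
  have "z \<noteq> 0" using z(1) by auto
  then have "c > 0" using assms unfolding c_def by blast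
  moreover have "c * (norm x)\<^sup>2 \<le> x \<bullet> (M *v x)" for x
  proof (cases "x = 0")
    case False
    define y where "y = x /\<^sub>R norm x"
    have "y \<in> sphere 0 1" using False by (simp add: y_def)
    then have "c \<le> y \<bullet> (M *v y)" using z(2) by (simp add: c_def)
    then have "c * (norm x)\<^sup>2 \<le> (y \<bullet> (M *v y)) * (norm x)\<^sup>2" by (intro mult_right_mono) auto
    also have "\<dots> = (norm x *\<^sub>R y) \<bullet> (M *v (norm x *\<^sub>R y))"
      by (simp add: matrix_vector_mult_scaleR power2_eq_square mult_ac)
    also have "norm x *\<^sub>R y = x" using False by (simp add: y_def)
    finally show ?thesis .
  qed simp
  ultimately show ?thesis using that by blast
qed

lemma matrix_mult_diff_right: "A ** (B - C) = A ** B - A ** (C :: real^'n^'m)"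
  by (simp add: matrix_eq matrix_vector_mult_diff_rdistrib matrix_vector_mult_diff_distrib
      flip: matrix_vector_mul_assoc)

lemma matrix_mult_diff_left: "(A - B) ** C = A ** C - B ** (C :: real^'n^'m)"
  by (simp add: matrix_eq matrix_vector_mult_diff_rdistrib matrix_vector_mult_diff_distrib
      flip: matrix_vector_mul_assoc)

lemma matrix_vector_mult_minus_left: "(- A) *v x = - (A *v (x :: real^'n))"
  by (simp add: matrix_vector_mult_def vec_eq_iff sum_negf)

lemma matrix_vector_mult_minus_right: "A *v (- x) = - (A *v (x :: real^'n))"
  by (simp add: matrix_vector_mult_def vec_eq_iff sum_negf)

lemma transpose_zero [simp]: "transpose 0 = 0"
  by (simp add: transpose_def vec_eq_iff)

lemma transpose_add: "transpose (A + B) = transpose A + transpose B"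
  by (simp add: transpose_def vec_eq_iff)

lemma transpose_diff: "transpose (A - B) = transpose A - transpose B"
  by (simp add: transpose_def vec_eq_iff)

lemma matrix_inv_mult_left:
  assumes "invertible A"
  shows "matrix_inv A ** A = mat 1"
  using someI_ex[of "\<lambda>A'. A ** A' = mat 1 \<and> A' ** A = mat 1"] assms
  unfolding invertible_def matrix_inv_def by blast

section \<open>The Moore--Penrose inverse of a symmetric matrix\<close>

lemma is_moore_penrose_unique:
  assumes X: "is_moore_penrose M X" and Y: "is_moore_penrose M Y"
  shows "X = Y"
proof -
  have a: "M ** X ** M = M" "X ** M ** X = X" "transpose (M ** X) = M ** X" "transpose (X ** M) = X ** M"
    and b: "M ** Y ** M = M" "Y ** M ** Y = Y" "transpose (M ** Y) = M ** Y" "transpose (Y ** M) = Y ** M"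
    using X Y by (auto simp: is_moore_penrose_def)
  have "M ** X = M ** Y ** (M ** X)"
    using b(1) by (simp add: matrix_mul_assoc)
  then have "M ** X = M ** X ** (M ** Y)"
    by (metis a(3) b(3) matrix_transpose_mul)
  also have "\<dots> = M ** Y" by (simp add: a(1) matrix_mul_assoc)
  finally have 1: "M ** X = M ** Y" .
  have "X ** M = X ** M ** (Y ** M)"
    by (metis b(1) matrix_mul_assoc)
  then have "X ** M = Y ** M ** (X ** M)"
    by (metis a(4) b(4) matrix_transpose_mul)
  also have "\<dots> = Y ** M" by (metis a(1) matrix_mul_assoc)
  finally have 2: "X ** M = Y ** M" .
  show ?thesis by (metis 1 2 a(2) b(2) matrix_mul_assoc)
qed

text \<open>For symmetric \<open>R\<close>, the kernel and the range of \<open>R\<close> meet only in \<open>0\<close>.\<close>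

lemma symmetric_cancel:
  fixes R :: "real^'m^'m"
  assumes sym: "transpose R = R" and "R ** (R ** W) = 0"
  shows "R ** W = 0"
proof -
  have "R *v (W *v x) = 0" for x
  proof -
    have "R *v (R *v (W *v x)) = 0"
      using assms(2) by (metis matrix_vector_mul_assoc matrix_vector_mult_0)
    then have "(R *v (W *v x)) \<bullet> (R *v (W *v x)) = 0"
      by (metis inner_matrix_sym[OF sym] inner_zero_right)
    then show ?thesis by simp
  qed
  then show ?thesis by (simp add: matrix_eq flip: matrix_vector_mul_assoc)
qed

lemma generalized_inverse_exists:
  fixes M :: "real^'n^'m"
  shows "\<exists>G. M ** G ** M = M"
proof -
  obtain g where g: "linear g" "\<forall>v\<in>range ((*v) M). M *v g v = v"
    using linear_exists_right_inverse_on[of "(*v) M" UNIV] by auto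
  have "M ** matrix g ** M = M"
    using g by (simp add: matrix_eq matrix_works flip: matrix_vector_mul_assoc)
  then show ?thesis ..
qed

text \<open>If \<open>G\<close> is any generalized inverse of \<open>R ** R ** R\<close>, then \<open>R ** G ** R\<close> is the
  Moore--Penrose inverse of the symmetric matrix \<open>R\<close>: all four identities follow from
  \<open>R\<^sup>3 G R\<^sup>3 = R\<^sup>3\<close> by cancelling factors \<open>R\<close> on either side.\<close>

lemma moore_penrose_exists_symmetric:
  fixes R :: "real^'m^'m"
  assumes sym: "transpose R = R"
  shows "\<exists>X. is_moore_penrose R X"
proof -
  let ?R3 = "R ** R ** R"
  obtain G where G: "?R3 ** G ** ?R3 = ?R3" using generalized_inverse_exists by blast
  note assoc = matrix_mul_assoc[symmetric]
  have R3sym: "transpose ?R3 = ?R3" by (simp add: matrix_transpose_mul sym assoc)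
  have key: "R ** H ** ?R3 = R" if H: "?R3 ** H ** ?R3 = ?R3" for H
  proof -
    define W where "W = H ** ?R3 - mat 1"
    have "R ** (R ** (R ** W)) = 0"
      using H by (simp add: W_def matrix_mult_diff_right assoc)
    then have "R ** W = 0" using symmetric_cancel[OF sym] by blast
    then show ?thesis by (simp add: W_def matrix_mult_diff_right assoc)
  qed
  have 1: "R ** G ** ?R3 = R" using key[OF G] .
  have "?R3 ** transpose G ** ?R3 = ?R3"
    using arg_cong[OF G, of transpose] by (simp add: matrix_transpose_mul sym assoc)
  \<comment> \<open>The transpose of \<open>G\<close> is a generalized inverse as well.\<close>
  from arg_cong[OF key[OF this], of transpose]
  have 2: "?R3 ** G ** R = R"
    by (simp add: matrix_transpose_mul sym assoc)
  define X where "X = R ** G ** R"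
  have RXR: "R ** X ** R = R"
  proof -
    define W where "W = transpose (R ** R ** G ** R - mat 1)"
    have t: "transpose W = R ** R ** G ** R - mat 1" by (simp add: W_def)
    have "transpose W ** R ** R = 0"
      unfolding t using 1 by (simp add: matrix_mult_diff_left assoc)
    from arg_cong[OF this, of transpose] have "R ** (R ** W) = 0"
      by (simp add: matrix_transpose_mul sym assoc)
    then have "R ** W = 0" using symmetric_cancel[OF sym] by blast
    from arg_cong[OF this, of transpose] have "transpose W ** R = 0"
      by (simp add: matrix_transpose_mul sym assoc)
    then show ?thesis unfolding t by (simp add: X_def matrix_mult_diff_left assoc)
  qed
  have XRX: "X ** R ** X = X"
    using arg_cong[OF 1, of "\<lambda>M. M ** G ** R"] by (simp add: X_def assoc)
  have sRX: "transpose (R ** X) = R ** X"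
  proof -
    have "transpose (R ** X) ** R = R"
      using arg_cong[OF 2, of transpose] by (simp add: X_def matrix_transpose_mul sym assoc)
    then have "transpose (R ** X) ** (R ** X) = R ** X" by (metis matrix_mul_assoc)
    then show ?thesis by (metis matrix_transpose_mul transpose_transpose)
  qed
  have sXR: "transpose (X ** R) = X ** R"
  proof -
    have "R ** transpose (X ** R) = R"
      using arg_cong[OF 1, of transpose] by (simp add: X_def matrix_transpose_mul sym assoc)
    then have "X ** R ** transpose (X ** R) = X ** R" by (metis matrix_mul_assoc)
    then show ?thesis by (metis matrix_transpose_mul transpose_transpose)
  qed
  show ?thesis
    using RXR XRX sRX sXR unfolding is_moore_penrose_def by blast
qed

text \<open>By uniqueness, the transpose of the pseudoinverse of a symmetric matrix is the pseudoinverse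
  itself, so that the projections onto range and corange coincide.\<close>

lemma pinv_symmetric:
  fixes R :: "real^'m^'m"
  assumes sym: "transpose R = R"
  shows "R ** pinv R ** R = R" "pinv R ** R ** pinv R = pinv R"
    "transpose (pinv R) = pinv R" "R ** pinv R = pinv R ** R"
proof -
  have mp: "is_moore_penrose R (pinv R)"
    unfolding pinv_def
    using theI'[of "is_moore_penrose R"] moore_penrose_exists_symmetric[OF sym]
      is_moore_penrose_unique by blast
  then show "R ** pinv R ** R = R" "pinv R ** R ** pinv R = pinv R"
    by (auto simp: is_moore_penrose_def)
  have e: "transpose (R ** pinv R) = R ** pinv R" "transpose (pinv R ** R) = pinv R ** R"
    using mp by (auto simp: is_moore_penrose_def)
  have "is_moore_penrose R (transpose (pinv R))"
    unfolding is_moore_penrose_def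
    using arg_cong[OF \<open>R ** pinv R ** R = R\<close>, of transpose] 
      arg_cong[OF \<open>pinv R ** R ** pinv R = pinv R\<close>, of transpose] e
    by (simp add: matrix_transpose_mul sym matrix_mul_assoc)
  then show "transpose (pinv R) = pinv R"
    using mp is_moore_penrose_unique by blast
  then show "R ** pinv R = pinv R ** R" using e by (simp add: matrix_transpose_mul sym)
qed

section \<open>Lyapunov functions and a theorem of the alternative\<close>

text \<open>Stability certified by the quadratic Lyapunov function \<open>x \<bullet> (Z *v x)\<close>, whose derivative along
  \<open>x' = M x\<close> is twice the second form below. It is equivalent to the spectral notion
  \<^const>\<open>stable_matrix\<close> and is the form in which stability is both produced and used here.\<close>

definition lyapunov_stable :: "real^'n^'n \<Rightarrow> bool" where
  "lyapunov_stable M \<longleftrightarrow> (\<exists>Z. transpose Z = Z \<and> (\<forall>x. x \<noteq> 0 \<longrightarrow> 0 < x \<bullet> (Z *v x)) \<and>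
     (\<forall>x. x \<noteq> 0 \<longrightarrow> x \<bullet> (Z *v (M *v x)) < 0))"

text \<open>The inverse of a Lyapunov matrix for the transpose is a Lyapunov matrix for \<open>M\<close>.\<close>

lemma lyapunov_stable_transpose:
  fixes M :: "real^'n^'n"
  assumes "lyapunov_stable (transpose M)"
  shows "lyapunov_stable M"
proof -
  obtain W where W: "transpose W = W" "\<And>x. x \<noteq> 0 \<Longrightarrow> 0 < x \<bullet> (W *v x)"
    "\<And>x. x \<noteq> 0 \<Longrightarrow> x \<bullet> (W *v (transpose M *v x)) < 0"
    using assms by (auto simp: lyapunov_stable_def)
  have "\<forall>x. W *v x = 0 \<longrightarrow> x = 0" using W(2) by (metis inner_zero_right less_irrefl)
  then obtain Z where ZW: "Z ** W = mat 1" using matrix_left_invertible_ker by blast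
  then have WZ: "W ** Z = mat 1" using matrix_left_right_inverse by blast
  have tZ: "transpose Z = Z"
    by (metis W(1) ZW WZ matrix_mul_assoc matrix_mul_lid matrix_mul_rid matrix_transpose_mul transpose_mat)
  have WZv: "W *v (Z *v x) = x" for x using WZ by (simp add: matrix_vector_mul_assoc)
  have "0 < x \<bullet> (Z *v x)" if "x \<noteq> 0" for x
  proof -
    have "Z *v x \<noteq> 0" using WZv[of x] that by auto
    then have "0 < (Z *v x) \<bullet> (W *v (Z *v x))" by (rule W(2))
    then show ?thesis by (simp add: WZv inner_commute)
  qed
  moreover have "x \<bullet> (Z *v (M *v x)) < 0" if "x \<noteq> 0" for x
  proof -
    have "Z *v x \<noteq> 0" using WZv[of x] that by auto
    then have "(Z *v x) \<bullet> (W *v (transpose M *v (Z *v x))) < 0" by (rule W(3))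
    also have "(Z *v x) \<bullet> (W *v (transpose M *v (Z *v x))) = x \<bullet> (transpose M *v (Z *v x))"
      by (simp add: inner_matrix_sym[OF W(1)] WZv)
    also have "\<dots> = x \<bullet> (Z *v (M *v x))"
      by (metis inner_commute inner_matrix_adjoint inner_matrix_sym[OF tZ] transpose_transpose)
    finally show ?thesis .
  qed
  ultimately show ?thesis using tZ unfolding lyapunov_stable_def by blast
qed

definition outer :: "real^'m \<Rightarrow> real^'n \<Rightarrow> real^'n^'m" where
  "outer a b = (\<chi> i j. a $ i * b $ j)"

lemma outer_vector: "outer a b *v x = (b \<bullet> x) *\<^sub>R a"
  by (simp add: outer_def vec_eq_iff matrix_vector_mult_def inner_vec_def sum_distrib_left mult_ac)

lemma matrix_mult_outer: "A ** outer a b = outer (A *v a) b"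
  by (simp add: matrix_eq outer_vector matrix_vector_mult_scaleR flip: matrix_vector_mul_assoc)

text \<open>The Frobenius inner product with a rank-one matrix recovers the bilinear form of \<open>Z\<close>; this turns
  a separating functional on matrices into a quadratic form.\<close>

lemma inner_outer: "Z \<bullet> outer a b = a \<bullet> (Z *v b)"
  by (simp add: outer_def inner_vec_def matrix_vector_mult_def sum_distrib_left mult_ac)

text \<open>A theorem of the alternative for linear matrix inequalities. The matrices \<open>A ** W + B ** Y\<close> with
  \<open>W\<close> positive definite form a convex cone \<open>C\<close>, those with negative definite form a convex cone
  \<open>D\<close>. If the cones were disjoint, a separating functional \<open>Z\<close> would be symmetric (because \<open>D\<close>
  contains all skew matrices up to an arbitrarily small multiple of the identity), positive
  semidefinite, and, tested on rank-one elements of \<open>C\<close>, a nonzero dual certificate of the excluded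
  kind.\<close>

lemma lmi_alternative:
  fixes A :: "real^'n^'n" and B :: "real^'m^'n"
  assumes no_dual: "\<And>Z. \<lbrakk>pos_semidef Z; \<And>x. 0 \<le> (A *v x) \<bullet> (Z *v x); \<And>v x. (B *v v) \<bullet> (Z *v x) = 0\<rbrakk> \<Longrightarrow> Z = 0"
  obtains W Y where "transpose W = W" "\<And>x. x \<noteq> 0 \<Longrightarrow> 0 < x \<bullet> (W *v x)"
    "\<And>x. x \<noteq> 0 \<Longrightarrow> x \<bullet> ((A ** W + B ** Y) *v x) < 0"
proof (rule ccontr)
  assume no: "\<not> thesis"
  define D :: "(real^'n^'n) set" where "D = {N. \<forall>x. x \<noteq> 0 \<longrightarrow> x \<bullet> (N *v x) < 0}"
  define PD :: "(real^'n^'n) set" where "PD = {W. transpose W = W \<and> (\<forall>x. x \<noteq> 0 \<longrightarrow> 0 < x \<bullet> (W *v x))}"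
  define C where "C = {A ** W + B ** Y | W Y. W \<in> PD}"
  have PDI: "outer x x + e *\<^sub>R mat 1 \<in> PD" if "e > 0" for e and x :: "real^'n"
  proof -
    have "transpose (outer x x + e *\<^sub>R mat 1) = outer x x + e *\<^sub>R mat 1"
      by (simp add: outer_def transpose_def vec_eq_iff mat_def mult.commute)
    moreover have "0 < y \<bullet> ((outer x x + e *\<^sub>R mat 1) *v y)" if "y \<noteq> 0" for y
    proof -
      have "y \<bullet> ((outer x x + e *\<^sub>R mat 1) *v y) = (x \<bullet> y)\<^sup>2 + e * (y \<bullet> y)"
        by (simp add: matrix_vector_mult_add_rdistrib outer_vector inner_add_right power2_eq_square
            scaleR_matrix_vector_assoc[symmetric] inner_commute)
      also have "\<dots> > 0" using \<open>e > 0\<close> that by (intro add_nonneg_pos) auto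
      finally show ?thesis .
    qed
    ultimately show ?thesis by (simp add: PD_def)
  qed
  have coneC: "s *\<^sub>R c \<in> C" if cC: "c \<in> C" and s: "s > 0" for s c
  proof -
    obtain W Y where c: "c = A ** W + B ** Y" "W \<in> PD" using cC by (auto simp: C_def)
    have "s *\<^sub>R c = A ** (s *\<^sub>R W) + B ** (s *\<^sub>R Y)"
      by (simp add: c matrix_eq matrix_vector_mult_add_rdistrib scaleR_right_distrib
          scaleR_matrix_vector_assoc[symmetric] matrix_vector_mult_scaleR flip: matrix_vector_mul_assoc)
    moreover have "s *\<^sub>R W \<in> PD" using c(2) s
      by (auto simp: PD_def transpose_scalar scaleR_matrix_vector_assoc[symmetric])
    ultimately show ?thesis by (auto simp: C_def)
  qed
  have addC: "c + d \<in> C" if cd: "c \<in> C" "d \<in> C" for c d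
  proof -
    obtain W Y where c: "c = A ** W + B ** Y" "W \<in> PD" using cd(1) by (auto simp: C_def)
    obtain V X where d: "d = A ** V + B ** X" "V \<in> PD" using cd(2) by (auto simp: C_def)
    have "c + d = A ** (W + V) + B ** (Y + X)"
      by (simp add: c d matrix_add_ldistrib)
    moreover have "W + V \<in> PD" using c(2) d(2)
      by (simp add: PD_def transpose_add matrix_vector_mult_add_rdistrib inner_add_right add_pos_pos)
    ultimately show ?thesis by (auto simp: C_def)
  qed
  have "convex C"
    unfolding convex_def
  proof (intro ballI allI impI)
    fix x y and u v :: real assume h: "x \<in> C" "y \<in> C" "0 \<le> u" "0 \<le> v" "u + v = 1"
    show "u *\<^sub>R x + v *\<^sub>R y \<in> C"
    proof (cases "u = 0 \<or> v = 0")
      case True then show ?thesis using h by auto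
    next
      case False then show ?thesis using h by (intro addC coneC) auto
    qed
  qed
  moreover have "convex D"
    unfolding convex_def
  proof (intro ballI allI impI)
    fix x y and u v :: real assume h: "x \<in> D" "y \<in> D" "0 \<le> u" "0 \<le> v" "u + v = 1"
    have "z \<bullet> ((u *\<^sub>R x + v *\<^sub>R y) *v z) < 0" if "z \<noteq> 0" for z
    proof -
      have "z \<bullet> ((u *\<^sub>R x + v *\<^sub>R y) *v z) = u * (z \<bullet> (x *v z)) + v * (z \<bullet> (y *v z))"
        by (simp add: matrix_vector_mult_add_rdistrib inner_add_right scaleR_matrix_vector_assoc[symmetric])
      also have "\<dots> < 0"
        using h that by (intro convex_bound_lt) (auto simp: D_def)
      finally show ?thesis .
    qed
    then show "u *\<^sub>R x + v *\<^sub>R y \<in> D" by (simp add: D_def)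
  qed
  moreover have "C \<noteq> {}" using PDI[of 1 0] by (auto simp: C_def)
  moreover have "D \<noteq> {}"
  proof -
    have "- mat 1 \<in> D" by (simp add: D_def matrix_vector_mult_minus_left)
    then show ?thesis by blast
  qed
  moreover have "D \<inter> C = {}"
  proof (rule ccontr)
    assume "D \<inter> C \<noteq> {}"
    then obtain W Y where "W \<in> PD" "A ** W + B ** Y \<in> D" by (auto simp: C_def)
    then show False using no that by (auto simp: PD_def D_def)
  qed
  ultimately obtain Z b where Z: "Z \<noteq> 0" "\<And>d. d \<in> D \<Longrightarrow> Z \<bullet> d \<le> b" "\<And>c. c \<in> C \<Longrightarrow> b \<le> Z \<bullet> c"
    using separating_hyperplane_sets[of D C] by metis
  \<comment> \<open>Both sets are cones, so the separating level can be taken to be zero.\<close>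
  have b0: "0 \<le> - b"
  proof -
    obtain c where c: "c \<in> C" using \<open>C \<noteq> {}\<close> by blast
    show ?thesis
      by (rule nonneg_of_perturbation[where b = "Z \<bullet> c"]) (use Z(3)[OF coneC[OF c]] in auto)
  qed
  have ZD: "Z \<bullet> d \<le> 0" if "d \<in> D" for d using Z(2)[OF that] b0 by linarith
  have ZC: "0 \<le> Z \<bullet> c" if "c \<in> C" for c
  proof (rule nonneg_of_perturbation[where b = "- b"])
    fix e :: real assume e: "e > 0"
    have "b \<le> Z \<bullet> ((1 / e) *\<^sub>R c)" using e by (intro Z(3) coneC that) auto
    then have "b * e \<le> (Z \<bullet> ((1 / e) *\<^sub>R c)) * e" using e by (intro mult_right_mono) auto
    then show "0 \<le> Z \<bullet> c + e * - b" using e by (simp add: mult_ac)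
  qed
  have "0 \<le> y \<bullet> (Z *v x) - x \<bullet> (Z *v y)" for x y
  proof (rule nonneg_of_perturbation[where b = "Z \<bullet> mat 1"])
    fix e :: real assume e: "e > 0"
    have "z \<bullet> ((outer x y - outer y x - e *\<^sub>R mat 1) *v z) = - e * (z \<bullet> z)" for z
      by (simp add: matrix_vector_mult_diff_rdistrib outer_vector inner_diff_right
            scaleR_matrix_vector_assoc[symmetric] inner_commute)
    then have "outer x y - outer y x - e *\<^sub>R mat 1 \<in> D" using e by (simp add: D_def)
    from ZD[OF this] show "0 \<le> y \<bullet> (Z *v x) - x \<bullet> (Z *v y) + e * (Z \<bullet> mat 1)"
      by (simp add: inner_diff_right inner_outer)
  qed
  then have "y \<bullet> (Z *v x) = x \<bullet> (Z *v y)" for x y by (simp add: antisym)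
  then have symZ: "transpose Z = Z"
    by (metis (no_types, lifting) inner_commute inner_matrix_adjoint matrix_eq vector_eq_ldot)
  have psdZ: "0 \<le> x \<bullet> (Z *v x)" for x
  proof (rule nonneg_of_perturbation[where b = "Z \<bullet> mat 1"])
    fix e :: real assume e: "e > 0"
    have "z \<bullet> ((- outer x x - e *\<^sub>R mat 1) *v z) = - (x \<bullet> z)\<^sup>2 - e * (z \<bullet> z)" for z
      by (simp add: matrix_vector_mult_diff_rdistrib outer_vector inner_diff_right matrix_vector_mult_minus_left
            scaleR_matrix_vector_assoc[symmetric] inner_commute power2_eq_square)
    moreover have "- (x \<bullet> z)\<^sup>2 - e * (z \<bullet> z) < 0" if "z \<noteq> 0" for z
    proof -
      have "0 < e * (z \<bullet> z)" using e that by simp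
      then show ?thesis using zero_le_power2[of "x \<bullet> z"] by linarith
    qed
    ultimately have "- outer x x - e *\<^sub>R mat 1 \<in> D" by (simp add: D_def)
    from ZD[OF this] show "0 \<le> x \<bullet> (Z *v x) + e * (Z \<bullet> mat 1)"
      by (simp add: inner_diff_right inner_outer)
  qed
  have main: "0 \<le> (A *v x) \<bullet> (Z *v x) + (B *v v) \<bullet> (Z *v x)" for v x
  proof (rule nonneg_of_perturbation[where b = "Z \<bullet> A"])
    fix e :: real assume "e > 0"
    then have "A ** (outer x x + e *\<^sub>R mat 1) + B ** outer v x \<in> C"
      using PDI by (auto simp: C_def)
    from ZC[OF this]
    show "0 \<le> (A *v x) \<bullet> (Z *v x) + (B *v v) \<bullet> (Z *v x) + e * (Z \<bullet> A)"
      by (simp add: matrix_add_ldistrib matrix_mult_outer inner_add_right inner_outer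
          matrix_scalar_ac)
  qed
  have "Z = 0"
  proof (rule no_dual)
    show "pos_semidef Z" using symZ psdZ by (simp add: pos_semidef_def)
    show "0 \<le> (A *v x) \<bullet> (Z *v x)" for x using main[of x 0] by simp
    show "(B *v v) \<bullet> (Z *v x) = 0" for v x
    proof -
      define q where "q = (A *v x) \<bullet> (Z *v x)"
      define r where "r = (B *v v) \<bullet> (Z *v x)"
      have *: "0 \<le> s * r + q" for s
        using main[of x "s *\<^sub>R v"] by (simp add: matrix_vector_mult_scaleR q_def r_def)
      have "r = 0" by (rule linear_lower_bounded_zero[of q]) (use * in \<open>simp add: add.commute\<close>)
      then show ?thesis by (simp add: r_def)
    qed
  qed
  with Z(1) show False by simp
qed

text \<open>The change of variables \<open>Y = K ** W\<close> makes the inequality for \<open>A + B ** K\<close> linear in \<open>(W, Y)\<close>.\<close>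

lemma lyapunov_stabilizing_feedback:
  fixes A :: "real^'n^'n" and B :: "real^'m^'n"
  assumes no_dual: "\<And>Z. \<lbrakk>pos_semidef Z; \<And>x. 0 \<le> (A *v x) \<bullet> (Z *v x); \<And>v x. (B *v v) \<bullet> (Z *v x) = 0\<rbrakk> \<Longrightarrow> Z = 0"
  shows "\<exists>K. lyapunov_stable (A + B ** K)"
proof -
  obtain W Y where W: "transpose W = W" "\<And>x. x \<noteq> 0 \<Longrightarrow> 0 < x \<bullet> (W *v x)"
    "\<And>x. x \<noteq> 0 \<Longrightarrow> x \<bullet> ((A ** W + B ** Y) *v x) < 0"
    using lmi_alternative[OF no_dual] by blast
  have "\<forall>x. W *v x = 0 \<longrightarrow> x = 0" using W(2) by (metis inner_zero_right less_irrefl)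
  then obtain V where VW: "V ** W = mat 1" using matrix_left_invertible_ker by blast
  define K where "K = Y ** V"
  have KW: "A ** W + B ** Y = (A + B ** K) ** W"
    by (simp add: K_def matrix_eq matrix_vector_mult_add_rdistrib flip: matrix_vector_mul_assoc)
      (simp add: VW matrix_vector_mul_assoc)
  have "x \<bullet> (W *v (transpose (A + B ** K) *v x)) < 0" if "x \<noteq> 0" for x
  proof -
    have "x \<bullet> (W *v (transpose (A + B ** K) *v x)) = x \<bullet> ((A + B ** K) *v (W *v x))"
      by (metis inner_commute inner_matrix_adjoint inner_matrix_sym[OF W(1)] transpose_transpose)
    then show ?thesis using W(3)[OF that] by (simp add: KW flip: matrix_vector_mul_assoc)
  qed
  then have "lyapunov_stable (transpose (A + B ** K))"
    unfolding lyapunov_stable_def using W by blast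
  then show ?thesis using lyapunov_stable_transpose by blast
qed

section \<open>Spectral stability and Lyapunov stability\<close>

text \<open>A complex vector given by its real and imaginary parts, so that statements about complex
  eigenvectors of a real matrix reduce to pairs of real vectors.\<close>

definition cvec :: "real^'n \<Rightarrow> real^'n \<Rightarrow> complex^'n" where
  "cvec a b = (\<chi> i. Complex (a $ i) (b $ i))"

lemma cvec_exhaust: obtains a b where "v = cvec a b"
proof
  show "v = cvec (\<chi> i. Re (v $ i)) (\<chi> i. Im (v $ i))" by (simp add: cvec_def vec_eq_iff)
qed

lemma cvec_eq_iff: "cvec a b = cvec c d \<longleftrightarrow> a = c \<and> b = d"
  by (auto simp: cvec_def vec_eq_iff)

lemma cvec_eq_0_iff: "cvec a b = 0 \<longleftrightarrow> a = 0 \<and> b = 0"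
  by (auto simp: cvec_def vec_eq_iff complex_eq_iff)

lemma cvec_diff: "cvec a b - cvec c d = cvec (a - c) (b - d)"
  by (simp add: cvec_def vec_eq_iff complex_eq_iff)

lemma cvec_scale: "c *s cvec a b = cvec (Re c *\<^sub>R a - Im c *\<^sub>R b) (Im c *\<^sub>R a + Re c *\<^sub>R b)"
  by (simp add: cvec_def vec_eq_iff complex_eq_iff)

lemma cvec_matrix: "map_matrix complex_of_real M *v cvec a b = cvec (M *v a) (M *v b)"
  by (simp add: cvec_def vec_eq_iff complex_eq_iff map_matrix_def matrix_vector_mult_def)

text \<open>For an eigenvector \<open>a + i b\<close> with eigenvalue \<open>c\<close>, summing the two forms over \<open>a\<close> and \<open>b\<close> cancels
  the imaginary part of \<open>c\<close> and shows that its real part times a positive number is negative.\<close>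

lemma stable_matrix_if_lyapunov_stable:
  assumes "lyapunov_stable M"
  shows "stable_matrix M"
  unfolding stable_matrix_def
proof (intro allI impI, elim conjE)
  fix c v assume v: "v \<noteq> 0" "map_matrix complex_of_real M *v v = c *s v"
  obtain a b where ab: "v = cvec a b" by (rule cvec_exhaust)
  obtain Z where Z: "transpose Z = Z" "\<And>x. x \<noteq> 0 \<Longrightarrow> 0 < x \<bullet> (Z *v x)"
    "\<And>x. x \<noteq> 0 \<Longrightarrow> x \<bullet> (Z *v (M *v x)) < 0"
    using assms by (auto simp: lyapunov_stable_def)
  have eq: "M *v a = Re c *\<^sub>R a - Im c *\<^sub>R b" "M *v b = Im c *\<^sub>R a + Re c *\<^sub>R b"
    using v(2) by (simp_all add: ab cvec_matrix cvec_scale cvec_eq_iff)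
  have "a \<noteq> 0 \<or> b \<noteq> 0" using v(1) by (auto simp: ab cvec_eq_0_iff)
  moreover have nonneg: "0 \<le> x \<bullet> (Z *v x)" "x \<bullet> (Z *v (M *v x)) \<le> 0" for x
    using Z(2,3)[of x] by (cases "x = 0"; force)+
  ultimately have neg: "a \<bullet> (Z *v (M *v a)) + b \<bullet> (Z *v (M *v b)) < 0"
    and pos: "0 < a \<bullet> (Z *v a) + b \<bullet> (Z *v b)"
    using Z(2,3) nonneg[of a] nonneg[of b] by (metis add_neg_nonpos add_nonpos_neg, metis add_nonneg_pos add_pos_nonneg)
  have "a \<bullet> (Z *v (M *v a)) + b \<bullet> (Z *v (M *v b)) = Re c * (a \<bullet> (Z *v a) + b \<bullet> (Z *v b))"
    using inner_matrix_sym[OF Z(1), of a b]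
    by (simp add: eq matrix_vector_right_distrib matrix_vector_mult_diff_distrib inner_simps
        matrix_vector_mult_scaleR algebra_simps inner_commute)
  then show "Re c < 0" using neg pos by (simp add: mult_less_0_iff)
qed

text \<open>The polynomial \<open>p\<close> in the matrix \<open>M\<close>, applied to the vector \<open>w\<close>, evaluated by Horner's scheme.\<close>

definition poly_act :: "complex^'n^'n \<Rightarrow> complex poly \<Rightarrow> complex^'n \<Rightarrow> complex^'n" where
  "poly_act M p w = fold_coeffs (\<lambda>a v. a *s w + M *v v) p 0"

lemma poly_act_0 [simp]: "poly_act M 0 w = 0"
  by (simp add: poly_act_def)

lemma poly_act_pCons: "poly_act M (pCons a p) w = a *s w + M *v poly_act M p w"
  by (cases "a = 0 \<and> p = 0") (auto simp: poly_act_def)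

lemma poly_act_add: "poly_act M (p + q) w = poly_act M p w + poly_act M q w"
  by (induction p q rule: poly_induct2)
    (simp_all add: poly_act_pCons matrix_vector_right_distrib vector_sadd_rdistrib)

lemma poly_act_smult: "poly_act M (smult c p) w = c *s poly_act M p w"
  by (induction p) (simp_all add: poly_act_pCons vector_add_ldistrib vector_scalar_commute)

lemma poly_act_mult: "poly_act M (p * q) w = poly_act M p (poly_act M q w)"
  by (induction p) (simp_all add: poly_act_pCons poly_act_add poly_act_smult)

lemma poly_act_linear_factor: "poly_act M [:- c, 1:] w = M *v w - c *s w"
  by (simp add: poly_act_pCons)

lemma poly_act_sum: "poly_act M (sum f A) w = (\<Sum>i\<in>A. poly_act M (f i) w)"
  by (induction A rule: infinite_finite_induct) (simp_all add: poly_act_add)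

text \<open>There are more vectors \<open>w, M w, M\<^sup>2 w, \<dots>\<close> than the dimension, so they are linearly dependent.\<close>

lemma annihilating_polynomial_exists:
  fixes M :: "complex^'n^'n"
  obtains p where "p \<noteq> 0" "poly_act M p w = 0"
proof -
  define d where "d = DIM(complex^'n)"
  define f where "f i = poly_act M (monom 1 i) w" for i
  show ?thesis
  proof (cases "inj_on f {..d}")
    case False
    then obtain i j where ij: "i \<noteq> j" "f i = f j" by (auto simp: inj_on_def)
    have "poly_act M (monom 1 i + smult (- 1) (monom 1 j)) w = f i - f j"
      unfolding poly_act_add poly_act_smult f_def by simp
    moreover have "coeff (monom 1 i + smult (- 1) (monom 1 j)) i \<noteq> (0::complex)"
      using ij(1) by simp
    ultimately show ?thesis using that ij(2) by (metis coeff_0 diff_self)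
  next
    case True
    then have "card (f ` {..d}) > DIM(complex^'n)" by (simp add: card_image d_def)
    then have "dependent (f ` {..d})" using dependent_biggerset[of "f ` {..d}"] by auto
    then obtain u where u: "\<exists>v\<in>f ` {..d}. u v \<noteq> 0" "(\<Sum>v\<in>f ` {..d}. u v *\<^sub>R v) = 0"
      using dependent_finite[of "f ` {..d}"] by auto
    define p where "p = (\<Sum>i\<le>d. smult (complex_of_real (u (f i))) (monom 1 i))"
    have "poly_act M p w = (\<Sum>i\<le>d. u (f i) *\<^sub>R f i)"
      by (simp add: p_def poly_act_sum poly_act_smult f_def[symmetric] vec_eq_iff
          scaleR_conv_of_real[where 'a = complex] del: smult_monom)
    also have "\<dots> = 0" using u(2) by (simp add: sum.reindex[OF True])
    finally have "poly_act M p w = 0" .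
    moreover have "p \<noteq> 0"
    proof -
      obtain i where i: "i \<le> d" "u (f i) \<noteq> 0" using u(1) by auto
      have "coeff p i = (\<Sum>j\<le>d. if j = i then complex_of_real (u (f j)) else 0)"
        unfolding p_def coeff_sum by (intro sum.cong) auto
      then have "coeff p i \<noteq> 0" using i by simp
      then show ?thesis by auto
    qed
    ultimately show ?thesis using that by blast
  qed
qed

text \<open>Apply the linear factors of an annihilating polynomial of \<open>w\<close> to \<open>w\<close> one after the other. The last
  nonzero vector that arises is an eigenvector, and it has not left the invariant subspace.\<close>

lemma eigenvector_in_invariant_set:
  fixes M :: "complex^'n^'n"
  assumes inv: "\<And>v. v \<in> S \<Longrightarrow> M *v v \<in> S" and diff: "\<And>v w. v \<in> S \<Longrightarrow> w \<in> S \<Longrightarrow> v - w \<in> S"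
    and scale: "\<And>c v. v \<in> S \<Longrightarrow> c *s v \<in> S" and w: "w \<in> S" "w \<noteq> 0"
  obtains c v where "v \<in> S" "v \<noteq> 0" "M *v v = c *s v"
proof -
  have ind: "\<exists>c v. v \<in> S \<and> v \<noteq> 0 \<and> M *v v = c *s v"
    if "p \<noteq> 0" "poly_act M p w = 0" "w \<in> S" "w \<noteq> 0" for p w
    using that
  proof (induction "degree p" arbitrary: p w)
    case 0
    then obtain a where a: "p = [:a:]" using degree_0_id[of p] by metis
    then have "a *s w = 0" using "0.prems"(2) by (simp add: poly_act_pCons)
    then show ?case using "0.prems" a by auto
  next
    case (Suc n)
    have "\<not> constant (poly p)" using Suc(2) by (simp add: constant_degree)
    then obtain c where "poly p c = 0" using fundamental_theorem_of_algebra by blast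
    then obtain q where q: "p = [:- c, 1:] * q" by (auto simp: poly_eq_0_iff_dvd)
    define w' where "w' = M *v w - c *s w"
    show ?case
    proof (cases "w' = 0")
      case True
      then show ?thesis using Suc.prems by (auto simp: w'_def)
    next
      case False
      have q0: "q \<noteq> 0" using Suc.prems(1) q by auto
      have "degree p = degree [:- c, 1:] + degree q"
        unfolding q by (rule degree_mult_eq) (use q0 in auto)
      then have "n = degree q" using Suc(2) by simp
      moreover have "poly_act M q w' = 0"
        using Suc.prems(2) unfolding q w'_def
        by (metis mult.commute poly_act_mult poly_act_linear_factor)
      moreover have "w' \<in> S" using Suc.prems by (auto simp: w'_def intro: inv diff scale)
      ultimately show ?thesis using Suc(1) q0 False by blast
    qed
  qed
  obtain p where "p \<noteq> 0" "poly_act M p w = 0" by (rule annihilating_polynomial_exists)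
  then show ?thesis using ind w that by blast
qed

text \<open>By the alternative, applied to the transpose and without input, the failure of the Lyapunov
  inequality gives \<open>Z \<noteq> 0\<close> positive semidefinite with \<open>M Z + Z M' \<ge> 0\<close>. Then the range of \<open>Z\<close> is
  invariant under \<open>M\<close> and contains (after complexification) an eigenvector \<open>Z (a + i b)\<close>; pairing
  with \<open>a\<close> and \<open>b\<close> shows that its eigenvalue has nonnegative real part.\<close>

lemma lyapunov_stable_if_stable_matrix:
  fixes M :: "real^'n^'n"
  assumes stable: "stable_matrix M"
  shows "lyapunov_stable M"
proof -
  have no_dual: "Z = 0" if Z: "pos_semidef Z" "\<And>x. 0 \<le> (transpose M *v x) \<bullet> (Z *v x)" for Z
  proof (rule ccontr)
    assume "Z \<noteq> 0"
    then obtain z where z: "Z *v z \<noteq> 0" by (auto simp: matrix_eq)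
    have sym: "transpose Z = Z" and psd: "\<And>x. 0 \<le> x \<bullet> (Z *v x)"
      using Z(1) by (auto simp: pos_semidef_def)
    have kernel_inv: "Z *v (transpose M *v x) = 0" if "Z *v x = 0" for x
    proof -
      have "2 * (y \<bullet> (Z *v (transpose M *v x))) = 0" for y
      proof (rule linear_coefficient_zero)
        fix s :: real
        have "0 \<le> (transpose M *v (x + s *\<^sub>R y)) \<bullet> (Z *v (x + s *\<^sub>R y))" by (rule Z(2))
        also have "\<dots> = s * (y \<bullet> (Z *v (transpose M *v x))) + s\<^sup>2 * ((transpose M *v y) \<bullet> (Z *v y))"
          using that inner_matrix_sym[OF sym, of y "transpose M *v x"]
          by (simp add: algebra_simps inner_simps matrix_vector_right_distrib
              matrix_vector_mult_scaleR power2_eq_square inner_commute)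
        finally have a: "0 \<le> \<dots>" .
        show "0 \<le> s * (2 * (y \<bullet> (Z *v (transpose M *v x)))) + s\<^sup>2 * (2 * ((transpose M *v y) \<bullet> (Z *v y)))"
          using a by (simp add: algebra_simps)
      qed
      then show ?thesis by (metis inner_eq_zero_iff mult_eq_0_iff zero_neq_numeral)
    qed
    \<comment> \<open>The range of \<open>Z\<close> is the orthogonal complement of its kernel, which the transpose of \<open>M\<close> preserves;
      \<open>r\<close> is the component of \<open>v\<close> in the kernel.\<close>
    have range_inv: "\<exists>y. M *v (Z *v x) = Z *v y" for x
    proof -
      define v where "v = M *v (Z *v x)"
      define r where "r = v - Z *v (pinv Z *v v)"
      have "Z *v r = 0"
        using pinv_symmetric(1,4)[OF sym] unfolding r_def
        by (simp add: matrix_vector_mult_diff_distrib matrix_vector_mul_assoc) (metis matrix_mul_assoc)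
      then have "r \<bullet> v = 0"
        using kernel_inv[of r] unfolding v_def
        by (metis inner_matrix_adjoint inner_matrix_sym[OF sym] inner_zero_left)
      moreover have "r \<bullet> (Z *v (pinv Z *v v)) = 0"
        using \<open>Z *v r = 0\<close> by (simp add: inner_matrix_sym[OF sym])
      ultimately have "r \<bullet> r = 0" by (simp add: r_def inner_diff_right)
      then have "v = Z *v (pinv Z *v v)" by (simp add: r_def)
      then show ?thesis by (auto simp: v_def)
    qed
    define S where "S = {cvec (Z *v a) (Z *v b) | a b. True}"
    have SI: "cvec a b \<in> S" if ab: "a = Z *v a'" "b = Z *v b'" for a b a' b'
      using ab by (auto simp: S_def)
    have "\<exists>c v. v \<in> S \<and> v \<noteq> 0 \<and> map_matrix complex_of_real M *v v = c *s v"
    proof (rule eigenvector_in_invariant_set[of S "map_matrix complex_of_real M" "cvec (Z *v z) (Z *v 0)"])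
      show "map_matrix complex_of_real M *v v \<in> S" if vS: "v \<in> S" for v
      proof -
        obtain a b where v: "v = cvec (Z *v a) (Z *v b)" using vS by (auto simp: S_def)
        obtain a' b' where "M *v (Z *v a) = Z *v a'" "M *v (Z *v b) = Z *v b'" using range_inv by metis
        then show ?thesis unfolding v cvec_matrix by (rule SI)
      qed
      show "v - w \<in> S" if "v \<in> S" "w \<in> S" for v w
        using that by (force simp: S_def cvec_diff matrix_vector_mult_diff_distrib[symmetric])
      show "c *s v \<in> S" if "v \<in> S" for c v
        using that by (force simp: S_def cvec_scale matrix_vector_mult_diff_distrib[symmetric]
            matrix_vector_right_distrib[symmetric] matrix_vector_mult_scaleR[symmetric])
      show "cvec (Z *v z) (Z *v 0) \<in> S" unfolding S_def by blast
      show "cvec (Z *v z) (Z *v 0) \<noteq> 0" using z by (simp add: cvec_eq_0_iff)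
    qed blast
    then obtain c a b where v: "cvec (Z *v a) (Z *v b) \<noteq> 0"
      "map_matrix complex_of_real M *v cvec (Z *v a) (Z *v b) = c *s cvec (Z *v a) (Z *v b)"
      by (auto simp: S_def)
    have "Re c < 0" using stable v by (auto simp: stable_matrix_def)
    have eq: "M *v (Z *v a) = Re c *\<^sub>R (Z *v a) - Im c *\<^sub>R (Z *v b)"
      "M *v (Z *v b) = Im c *\<^sub>R (Z *v a) + Re c *\<^sub>R (Z *v b)"
      using v(2) by (simp_all add: cvec_matrix cvec_scale cvec_eq_iff)
    have "0 \<le> a \<bullet> (M *v (Z *v a)) + b \<bullet> (M *v (Z *v b))"
      using Z(2)[of a] Z(2)[of b] by (simp add: inner_matrix_adjoint[of _ M])
    also have "\<dots> = Re c * (a \<bullet> (Z *v a) + b \<bullet> (Z *v b))"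
      using inner_matrix_sym[OF sym, of a b]
      by (simp add: eq inner_simps algebra_simps inner_commute)
    finally have "a \<bullet> (Z *v a) + b \<bullet> (Z *v b) \<le> 0"
      using \<open>Re c < 0\<close> by (simp add: zero_le_mult_iff)
    then have "a \<bullet> (Z *v a) = 0" "b \<bullet> (Z *v b) = 0" using psd[of a] psd[of b] by linarith+
    then have "Z *v a = 0" "Z *v b = 0" using psd_kernel[OF Z(1)] by auto
    then show False using v(1) by (simp add: cvec_eq_0_iff)
  qed
  obtain W where W: "transpose W = W" "\<And>x. x \<noteq> 0 \<Longrightarrow> 0 < x \<bullet> (W *v x)"
    "\<And>x. x \<noteq> 0 \<Longrightarrow> x \<bullet> ((transpose M ** W) *v x) < 0"
  proof (rule lmi_alternative[of "transpose M" "0 :: real^'n^'n"])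
    fix Z assume "pos_semidef Z" "\<And>x. 0 \<le> (transpose M *v x) \<bullet> (Z *v x)"
    then show "Z = 0" by (rule no_dual)
  next
    fix W Y assume "transpose W = W" "\<And>x. x \<noteq> 0 \<Longrightarrow> 0 < x \<bullet> (W *v x)"
      "\<And>x. x \<noteq> 0 \<Longrightarrow> x \<bullet> ((transpose M ** W + 0 ** Y) *v x) < 0"
    then show thesis
      by (intro that) (auto simp: matrix_vector_mult_add_rdistrib simp flip: matrix_vector_mul_assoc)
  qed
  have "x \<bullet> (W *v (M *v x)) < 0" if "x \<noteq> 0" for x
    using W(3)[OF that]
    by (metis matrix_vector_mul_assoc inner_commute inner_matrix_adjoint inner_matrix_sym[OF W(1)] transpose_transpose)
  then show ?thesis unfolding lyapunov_stable_def using W by blast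
qed

section \<open>Trajectories and their energy\<close>

lemma has_integral_singleton_iff: "(f has_integral i) {a..a::real} \<longleftrightarrow> i = 0"
  using has_integral_refl(2)[of f a] has_integral_unique[of f i "{a}" 0]
  by (metis atLeastAtMost_singleton)

lemma state_at_0:
  assumes "is_state A B x0 u x"
  shows "x 0 = x0"
proof -
  have "((\<lambda>s. A *v x s + B *v u s) has_integral (x 0 - x0)) {0..0}"
    using assms unfolding is_state_def by blast
  then show ?thesis by (simp only: has_integral_singleton_iff right_minus_eq)
qed

lemma continuous_on_state:
  assumes "is_state A B x0 u x"
  shows "continuous_on {0..} x"
proof -
  let ?f = "\<lambda>s. A *v x s + B *v u s"
  have int: "(?f has_integral (x t - x0)) {0..t}" if "t \<ge> 0" for t
    using assms that by (auto simp: is_state_def)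
  have cont: "continuous_on {0..T} x" if "T \<ge> 0" for T
  proof -
    have "continuous_on {0..T} (\<lambda>t. x0 + integral {0..t} ?f)"
      using int[OF that] by (intro continuous_intros indefinite_integral_continuous_1) blast
    moreover have "x0 + integral {0..t} ?f = x t" if "t \<in> {0..T}" for t
      using int[of t] that by (simp add: integral_unique)
    ultimately show ?thesis by (metis (no_types, lifting) continuous_on_cong)
  qed
  show ?thesis
    unfolding continuous_on_eq_continuous_within
  proof
    fix t :: real assume t: "t \<in> {0..}"
    have "continuous (at t within {0..t+1}) x"
      using cont[of "t+1"] t by (simp add: continuous_on_eq_continuous_within)
    moreover have "at t within {0..t+1} = at t within {0..}"
      by (rule at_within_nhd[of t "{..<t+1}"]) auto
    ultimately show "continuous (at t within {0..}) x" by simp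
  qed
qed

lemma absolutely_integrable_state_velocity:
  assumes "is_state A B x0 u x" "0 \<le> t"
  shows "(\<lambda>s. A *v x s + B *v u s) absolutely_integrable_on {0..t}"
proof -
  have c: "continuous_on {0..t} x"
    by (rule continuous_on_subset[OF continuous_on_state[OF assms(1)]]) auto
  have "(\<lambda>s. A *v x s) absolutely_integrable_on {0..t}"
    by (intro absolutely_integrable_continuous_real linear_continuous_on_compose[OF c]) auto
  moreover have "(\<lambda>s. B *v u s) absolutely_integrable_on {0..t}"
    using absolutely_integrable_linear[of "{0..t}" u "(*v) B"] assms
    by (auto simp: is_state_def o_def)
  ultimately show ?thesis by (rule set_integral_add(1))
qed

text \<open>The product rule for a quadratic form along an absolutely continuous curve, where the chain rule
  for derivatives is not available. The defect
  \<open>q b - q a - \<integral>\<^sub>a\<^sup>b 2 x \<bullet> X f\<close> is additive over adjacent intervals and, by continuity of \<open>x\<close>, at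
  most \<open>e \<integral>\<^sub>a\<^sup>b norm f\<close> on short intervals. A bisection argument extends this bound to the whole
  interval, for every \<open>e > 0\<close>.\<close>

lemma quadratic_form_of_indefinite_integral:
  fixes f x :: "real \<Rightarrow> real^'n" and X :: "real^'n^'n"
  assumes f: "f absolutely_integrable_on {0..T}" and T: "0 \<le> T"
    and x: "\<And>t. 0 \<le> t \<Longrightarrow> t \<le> T \<Longrightarrow> (f has_integral (x t - x0)) {0..t}"
    and sym: "transpose X = X"
  shows "((\<lambda>s. 2 * (x s \<bullet> (X *v f s))) has_integral (x T \<bullet> (X *v x T) - x0 \<bullet> (X *v x0))) {0..T}"
proof -
  have fi: "f integrable_on {a..b}" if "0 \<le> a" "b \<le> T" for a b
    using f that by (auto simp: absolutely_integrable_on_def intro: integrable_subinterval_real)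
  have nfi: "(\<lambda>s. norm (f s)) integrable_on {a..b}" if "0 \<le> a" "b \<le> T" for a b
    using f that by (auto simp: absolutely_integrable_on_def intro: integrable_subinterval_real)
  have cont: "continuous_on {0..T} x"
  proof -
    have "continuous_on {0..T} (\<lambda>t. x0 + integral {0..t} f)"
      using fi T by (intro continuous_intros indefinite_integral_continuous_1) auto
    moreover have "x0 + integral {0..t} f = x t" if "t \<in> {0..T}" for t
      using x[of t] that by (simp add: integral_unique)
    ultimately show ?thesis by (metis (no_types, lifting) continuous_on_cong)
  qed
  have x0: "x 0 = x0"
    using x[OF order_refl T] by (simp only: has_integral_singleton_iff right_minus_eq)
  have bil: "bilinear (\<lambda>a b. 2 * (a \<bullet> (X *v b)))"
    by (auto simp: bilinear_def linear_iff inner_simps matrix_vector_right_distrib matrix_vector_mult_scaleR)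
  have abs: "(\<lambda>s. 2 * (x s \<bullet> (X *v f s))) absolutely_integrable_on {0..T}"
  proof (rule absolutely_integrable_bounded_measurable_product[OF bil _ _ _ f])
    show "x \<in> borel_measurable (lebesgue_on {0..T})"
      using cont by (intro continuous_imp_measurable_on_sets_lebesgue) auto
    show "bounded (x ` {0..T})"
      by (intro compact_imp_bounded compact_continuous_image cont) auto
  qed auto
  define G where "G = (\<lambda>s. 2 * (x s \<bullet> (X *v f s)))"
  have Gi: "G integrable_on {a..b}" if "0 \<le> a" "b \<le> T" for a b
    using abs that by (auto simp: G_def absolutely_integrable_on_def intro: integrable_subinterval_real)
  define q where "q t = x t \<bullet> (X *v x t)" for t
  obtain C where C: "C > 0" "\<And>v. norm (X *v v) \<le> C * norm v" using matrix_norm_bound[of X] by blast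
  have close: "\<bar>q T - q 0 - integral {0..T} G\<bar> \<le> e * integral {0..T} (\<lambda>s. norm (f s))" if e: "e > 0" for e
  proof -
    define P where "P a b \<longleftrightarrow> (0 \<le> a \<longrightarrow> b \<le> T \<longrightarrow>
      \<bar>q b - q a - integral {a..b} G\<bar> \<le> e * integral {a..b} (\<lambda>s. norm (f s)))" for a b
    have "P 0 T"
    proof (rule Bolzano[OF T])
      fix a b c assume P: "P a b" "P b c" and ab: "a \<le> b" "b \<le> c"
      show "P a c" unfolding P_def
      proof (intro impI)
        assume 0: "0 \<le> a" "c \<le> T"
        have "integral {a..c} G = integral {a..b} G + integral {b..c} G"
          by (rule Henstock_Kurzweil_Integration.integral_combine[symmetric]) (use ab Gi 0 in auto)
        moreover have "integral {a..c} (\<lambda>s. norm (f s)) = integral {a..b} (\<lambda>s. norm (f s)) + integral {b..c} (\<lambda>s. norm (f s))"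
          by (rule Henstock_Kurzweil_Integration.integral_combine[symmetric]) (use ab nfi 0 in auto)
        ultimately show "\<bar>q c - q a - integral {a..c} G\<bar> \<le> e * integral {a..c} (\<lambda>s. norm (f s))"
          using P 0 ab by (simp add: P_def distrib_left)
      qed
    next
      fix c assume c: "0 \<le> c" "c \<le> T"
      \<comment> \<open>Each of \<open>x a\<close>, \<open>x b\<close> differs from \<open>x s\<close> by at most \<open>2 * \<eta>\<close>, and \<open>norm (X *v v) \<le> C * norm v\<close>.\<close>
      define \<eta> where "\<eta> = e / (4 * C)"
      have "\<eta> > 0" using e C by (simp add: \<eta>_def)
      then obtain d where d: "d > 0" "\<And>s. s \<in> {0..T} \<Longrightarrow> dist s c < d \<Longrightarrow> dist (x s) (x c) < \<eta>"
        using cont c unfolding continuous_on_iff by (metis atLeastAtMost_iff)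
      show "\<exists>d>0. \<forall>a b. a \<le> c \<and> c \<le> b \<and> b - a < d \<longrightarrow> P a b"
      proof (intro exI[of _ d] conjI d(1) allI impI)
        fix a b assume ab: "a \<le> c \<and> c \<le> b \<and> b - a < d"
        show "P a b" unfolding P_def
        proof (intro impI)
          assume 0: "0 \<le> a" "b \<le> T"
          have near: "norm (x s - x c) \<le> \<eta>" if "s \<in> {a..b}" for s
          proof -
            have "\<bar>s - c\<bar> < d" using ab that by auto
            then show ?thesis using d(2)[of s] 0 that by (auto simp: dist_norm)
          qed
          define w where "w = X *v (x b + x a)"
          have f_ab: "(f has_integral (x b - x a)) {a..b}"
          proof -
            have "integral {0..a} f + integral {a..b} f = integral {0..b} f"
              by (rule Henstock_Kurzweil_Integration.integral_combine) (use ab 0 fi in auto)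
            then have "integral {a..b} f = x b - x a"
              using x[of a] x[of b] ab 0 c by (simp add: integral_unique algebra_simps)
            then show ?thesis using fi[OF 0] by (metis has_integral_integral)
          qed
          have "((\<lambda>s. f s \<bullet> w) has_integral ((x b - x a) \<bullet> w)) {a..b}"
            using has_integral_linear[OF f_ab bounded_linear_inner_left[of w]] by (simp add: o_def)
          then have "((\<lambda>s. f s \<bullet> w - G s) has_integral ((x b - x a) \<bullet> w - integral {a..b} G)) {a..b}"
            by (intro has_integral_diff) (use Gi[OF 0] in auto)
          moreover have "(x b - x a) \<bullet> w = q b - q a"
            using inner_matrix_sym[OF sym, of "x a" "x b"]
            by (simp add: w_def q_def inner_simps matrix_vector_right_distrib inner_commute)
          ultimately have "((\<lambda>s. f s \<bullet> w - G s) has_integral (q b - q a - integral {a..b} G)) {a..b}"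
            by simp
          then have eq: "integral {a..b} (\<lambda>s. f s \<bullet> w - G s) = q b - q a - integral {a..b} G"
            and di: "(\<lambda>s. f s \<bullet> w - G s) integrable_on {a..b}"
            by auto
          have "norm (integral {a..b} (\<lambda>s. f s \<bullet> w - G s)) \<le> integral {a..b} (\<lambda>s. e * norm (f s))"
          proof (rule integral_norm_bound_integral[OF di])
            show "(\<lambda>s. e * norm (f s)) integrable_on {a..b}"
              using integrable_cmul[OF nfi[OF 0], of e] by simp
            fix s assume s: "s \<in> {a..b}"
            have "f s \<bullet> w - G s = f s \<bullet> (X *v (x b - x s)) + f s \<bullet> (X *v (x a - x s))"
              using inner_matrix_sym[OF sym, of "x s" "f s"]
              by (simp add: w_def G_def inner_simps matrix_vector_right_distrib
                  matrix_vector_mult_diff_distrib matrix_vector_mult_scaleR inner_commute)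
            also have "\<dots> = f s \<bullet> (X *v ((x b - x s) + (x a - x s)))"
              by (simp only: matrix_vector_right_distrib inner_add_right)
            also have "\<bar>\<dots>\<bar> \<le> norm (f s) * norm (X *v ((x b - x s) + (x a - x s)))"
              by (rule Cauchy_Schwarz_ineq2)
            also have "\<dots> \<le> norm (f s) * (C * (4 * \<eta>))"
            proof (rule mult_left_mono)
              have "norm ((x b - x s) + (x a - x s)) \<le> (\<eta> + \<eta>) + (\<eta> + \<eta>)"
                using norm_triangle_ineq4[of "x b - x c" "x s - x c"] norm_triangle_ineq4[of "x a - x c" "x s - x c"]
                  norm_triangle_ineq[of "x b - x s" "x a - x s"] near[of a] near[of b] near[OF s] ab
                by simp
              then have "C * norm ((x b - x s) + (x a - x s)) \<le> C * (4 * \<eta>)"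
                using C(1) by (intro mult_left_mono) auto
              then show "norm (X *v ((x b - x s) + (x a - x s))) \<le> C * (4 * \<eta>)"
                using C(2) order_trans by blast
            qed auto
            also have "\<dots> = e * norm (f s)" using C(1) by (simp add: \<eta>_def)
            finally show "norm (f s \<bullet> w - G s) \<le> e * norm (f s)" by simp
          qed
          then show "\<bar>q b - q a - integral {a..b} G\<bar> \<le> e * integral {a..b} (\<lambda>s. norm (f s))"
            by (simp add: eq)
        qed
      qed
    qed
    then show ?thesis using T by (simp add: P_def)
  qed
  have "\<bar>q T - q 0 - integral {0..T} G\<bar> \<le> 0"
  proof -
    define N where "N = integral {0..T} (\<lambda>s. norm (f s))"
    have "0 \<le> - \<bar>q T - q 0 - integral {0..T} G\<bar>"
      by (rule nonneg_of_perturbation[where b = N]) (use close in \<open>auto simp: N_def\<close>)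
    then show ?thesis by simp
  qed
  then have "integral {0..T} G = q T - q 0" by simp
  then show "((\<lambda>s. 2 * (x s \<bullet> (X *v f s))) has_integral (x T \<bullet> (X *v x T) - x0 \<bullet> (X *v x0))) {0..T}"
    using Gi[of 0 T] by (simp add: G_def q_def x0 has_integral_iff)
qed

lemma state_energy_identity:
  assumes "is_state A B x0 u x" "transpose X = X" "0 \<le> t"
  shows "((\<lambda>s. 2 * (x s \<bullet> (X *v (A *v x s + B *v u s)))) has_integral
           (x t \<bullet> (X *v x t) - x0 \<bullet> (X *v x0))) {0..t}"
  by (rule quadratic_form_of_indefinite_integral[OF absolutely_integrable_state_velocity[OF assms(1,3)]])
    (use assms in \<open>auto simp: is_state_def\<close>)

text \<open>Under the hypotheses the energy \<open>x \<bullet> (Z *v x)\<close> cannot decrease along any trajectory, whatever the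
  control; on trajectories tending to \<open>0\<close> it must therefore vanish from the start.\<close>

lemma stabilizable_no_dual:
  fixes A :: "real^'n^'n" and B :: "real^'m^'n"
  assumes stab: "stabilizable A B" and Z: "pos_semidef Z" "\<And>x. 0 \<le> (A *v x) \<bullet> (Z *v x)"
    "\<And>v x. (B *v v) \<bullet> (Z *v x) = 0"
  shows "Z = 0"
proof (rule symmetric_form_zero)
  show sym: "transpose Z = Z" using Z(1) by (simp add: pos_semidef_def)
  fix x0
  obtain u x where x: "is_state A B x0 u x" "(x \<longlongrightarrow> 0) at_top"
    using stab[unfolded stabilizable_def, rule_format, of x0] by (elim exE conjE) (rule that)
  have "x0 \<bullet> (Z *v x0) \<le> x t \<bullet> (Z *v x t)" if "t \<ge> 0" for t
  proof -
    have "0 \<le> 2 * (x s \<bullet> (Z *v (A *v x s + B *v u s)))" for s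
      using Z(2)[of "x s"] Z(3)[of "u s" "x s"]
        inner_matrix_sym[OF sym, of "x s" "A *v x s + B *v u s"]
      by (simp add: inner_add_right inner_commute)
    then have "0 \<le> x t \<bullet> (Z *v x t) - x0 \<bullet> (Z *v x0)"
      using has_integral_nonneg[OF state_energy_identity[OF x(1) sym that]] by simp
    then show ?thesis by simp
  qed
  then have "\<forall>\<^sub>F t in at_top. x0 \<bullet> (Z *v x0) \<le> x t \<bullet> (Z *v x t)"
    unfolding eventually_at_top_linorder by blast
  moreover have "((\<lambda>t. x t \<bullet> (Z *v x t)) \<longlongrightarrow> 0 \<bullet> (Z *v 0)) at_top"
    by (intro tendsto_inner x(2) bounded_linear.tendsto[OF matrix_vector_mul_bounded_linear])
  ultimately have "x0 \<bullet> (Z *v x0) \<le> 0"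
    using tendsto_lowerbound[of "\<lambda>t. x t \<bullet> (Z *v x t)" 0 at_top] by simp
  then show "x0 \<bullet> (Z *v x0) = 0" using Z(1) by (simp add: pos_semidef_def antisym)
qed

text \<open>Open-loop stabilizability excludes the dual certificate of the alternative, which leaves a
  stabilizing linear feedback.\<close>

lemma stabilizable_imp_stabilizing_feedback:
  assumes "stabilizable A B"
  shows "\<exists>K. stable_matrix (A + B ** K)"
proof -
  have "\<exists>K. lyapunov_stable (A + B ** K)"
    by (rule lyapunov_stabilizing_feedback) (rule stabilizable_no_dual[OF assms])
  then show ?thesis using stable_matrix_if_lyapunov_stable by blast
qed

lemma terminal_energy_tendsto_0:
  assumes "admissible A B x0 u x"
  shows "((\<lambda>t. x t \<bullet> (X *v x t)) \<longlongrightarrow> 0) at_top"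
proof -
  have x: "(x \<longlongrightarrow> 0) at_top" using assms by (simp add: admissible_def)
  have "((\<lambda>t. x t \<bullet> (X *v x t)) \<longlongrightarrow> 0 \<bullet> (X *v 0)) at_top"
    by (intro tendsto_inner x bounded_linear.tendsto[OF matrix_vector_mul_bounded_linear])
  then show ?thesis by simp
qed

section \<open>Trajectories of linear feedback\<close>

text \<open>The matrix exponential, applied to \<open>x0\<close> and written as a power series in each component.\<close>

lemma linear_ode_solution_exists:
  fixes M :: "real^'n^'n"
  obtains x where "x 0 = x0" "\<And>t. (x has_vector_derivative M *v x t) (at t)"
proof -
  define c where "c i k = ((((*v) M) ^^ k) x0) $ i / fact k" for i :: 'n and k
  obtain L where L: "L > 0" "\<And>v. norm (M *v v) \<le> L * norm v" using matrix_norm_bound[of M] by blast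
  have pow: "norm ((((*v) M) ^^ k) x0) \<le> L ^ k * norm x0" for k
  proof (induction k)
    case (Suc k)
    have "norm (M *v (((*v) M) ^^ k) x0) \<le> L * norm ((((*v) M) ^^ k) x0)" by (rule L(2))
    also have "\<dots> \<le> L * (L ^ k * norm x0)" using Suc L(1) by (intro mult_left_mono) auto
    finally show ?case by (simp add: mult_ac)
  qed simp
  have summ: "summable (\<lambda>k. c i k * t ^ k)" for i t
  proof (rule summable_comparison_test')
    show "summable (\<lambda>k. norm x0 * (inverse (fact k) * (L * \<bar>t\<bar>) ^ k))"
      by (intro summable_mult summable_exp)
    fix k :: nat
    have "\<bar>(((*v) M) ^^ k) x0 $ i\<bar> \<le> L ^ k * norm x0"
      using pow[of k] component_le_norm_cart order_trans by blast
    then have "\<bar>(((*v) M) ^^ k) x0 $ i\<bar> * (\<bar>t\<bar> ^ k / fact k) \<le> L ^ k * norm x0 * (\<bar>t\<bar> ^ k / fact k)"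
      by (intro mult_right_mono) auto
    then show "norm (c i k * t ^ k) \<le> norm x0 * (inverse (fact k) * (L * \<bar>t\<bar>) ^ k)"
      by (simp add: c_def abs_mult power_abs power_mult_distrib field_simps)
  qed
  define x where "x t = (\<chi> i. \<Sum>k. c i k * t ^ k)" for t
  have comp: "((\<lambda>t. x t $ i) has_real_derivative (M *v x t) $ i) (at t)" for i t
  proof -
    have "((\<lambda>t. \<Sum>k. c i k * t ^ k) has_real_derivative (\<Sum>k. diffs (c i) k * t ^ k)) (at t)"
      by (rule termdiffs_strong_converges_everywhere) (rule summ)
    moreover have "(\<Sum>k. diffs (c i) k * t ^ k) = (M *v x t) $ i"
    proof -
      have "diffs (c i) k * t ^ k = (\<Sum>j\<in>UNIV. M $ i $ j * (c j k * t ^ k))" for k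
      proof -
        have "diffs (c i) k = (M *v ((((*v) M) ^^ k) x0)) $ i / fact k"
          by (simp add: diffs_def c_def field_simps del: of_nat_Suc)
        then show ?thesis
          by (simp add: matrix_vector_mult_def c_def sum_distrib_left sum_divide_distrib mult_ac)
      qed
      then have "(\<Sum>k. diffs (c i) k * t ^ k) = (\<Sum>k. \<Sum>j\<in>UNIV. M $ i $ j * (c j k * t ^ k))" by simp
      also have "\<dots> = (\<Sum>j\<in>UNIV. \<Sum>k. M $ i $ j * (c j k * t ^ k))"
        by (rule suminf_sum) (intro summable_mult summ)
      also have "\<dots> = (\<Sum>j\<in>UNIV. M $ i $ j * x t $ j)"
        by (intro sum.cong refl) (simp add: x_def suminf_mult summ)
      finally show ?thesis by (simp add: matrix_vector_mult_def)
    qed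
    ultimately show ?thesis by (simp add: x_def)
  qed
  have "x 0 $ i = x0 $ i" for i
    unfolding x_def vec_lambda_beta powser_zero by (simp add: c_def)
  then have "x 0 = x0" by (simp add: vec_eq_iff)
  moreover have "(x has_vector_derivative M *v x t) (at t)" for t
  proof -
    have "((\<lambda>t. \<Sum>i\<in>UNIV. x t $ i *\<^sub>R (axis i 1 :: real^'n)) has_vector_derivative
        (\<Sum>i\<in>UNIV. (M *v x t) $ i *\<^sub>R axis i 1)) (at t)"
      by (intro has_vector_derivative_sum)
        (use comp has_vector_derivative_scaleR[OF comp has_vector_derivative_const] in simp)
    moreover have expand: "(\<Sum>i\<in>UNIV. v $ i *\<^sub>R axis i 1) = v" for v :: "real^'n"
      using basis_expansion[of v] by (simp only: scalar_mult_eq_scaleR)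
    ultimately show ?thesis by (simp only: expand)
  qed
  ultimately show ?thesis using that by blast
qed

lemma feedback_state_exists:
  fixes A :: "real^'n^'n" and B :: "real^'m^'n" and F :: "real^'n^'m"
  obtains x where "is_state A B x0 (\<lambda>t. F *v x t) x" "continuous_on UNIV x"
proof -
  obtain x where x: "x 0 = x0" "\<And>t. (x has_vector_derivative (A + B ** F) *v x t) (at t)"
    using linear_ode_solution_exists[of x0 "A + B ** F"] by blast
  have cont: "continuous_on S x" for S
    using x(2) by (meson continuous_at_imp_continuous_on has_vector_derivative_continuous)
  have "(\<lambda>t. F *v x t) absolutely_integrable_on {0..t}" for t
    by (intro absolutely_integrable_continuous_real linear_continuous_on_compose[OF cont]) auto
  moreover have "((\<lambda>s. A *v x s + B *v (F *v x s)) has_integral (x t - x0)) {0..t}" if "t \<ge> 0" for t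
  proof -
    have "((\<lambda>s. (A + B ** F) *v x s) has_integral (x t - x 0)) {0..t}"
      by (rule fundamental_theorem_of_calculus[OF that])
        (use x(2) has_vector_derivative_at_within in blast)
    then show ?thesis by (simp add: x(1) matrix_vector_mult_add_rdistrib matrix_vector_mul_assoc)
  qed
  ultimately have "is_state A B x0 (\<lambda>t. F *v x t) x" by (simp add: is_state_def)
  then show ?thesis using cont that by blast
qed

text \<open>The Lyapunov function satisfies \<open>g' \<le> - a g\<close> for some \<open>a > 0\<close>, so that \<open>g t * exp (a t)\<close> is
  nonincreasing.\<close>

lemma exponential_decay:
  fixes A :: "real^'n^'n"
  assumes stable: "stable_matrix (A + B ** F)" and x: "is_state A B x0 (\<lambda>t. F *v x t) x"
  obtains C a where "C \<ge> 0" "a > 0" "\<And>t. t \<ge> 0 \<Longrightarrow> (norm (x t))\<^sup>2 \<le> C * exp (- a * t)"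
proof -
  define M where "M = A + B ** F"
  obtain Z where Z: "transpose Z = Z" "\<And>x. x \<noteq> 0 \<Longrightarrow> 0 < x \<bullet> (Z *v x)"
    "\<And>x. x \<noteq> 0 \<Longrightarrow> x \<bullet> (Z *v (M *v x)) < 0"
    using lyapunov_stable_if_stable_matrix[OF stable] by (auto simp: lyapunov_stable_def M_def)
  obtain d where d: "d > 0" "\<And>x. d * (norm x)\<^sup>2 \<le> x \<bullet> (- (Z ** M) *v x)"
    by (rule positive_form_lower_bound[of "- (Z ** M)"])
      (use Z(3) in \<open>auto simp: matrix_vector_mult_minus_left simp flip: matrix_vector_mul_assoc\<close>)
  obtain c where c: "c > 0" "\<And>x. c * (norm x)\<^sup>2 \<le> x \<bullet> (Z *v x)"
    by (rule positive_form_lower_bound[of Z]) (use Z(2) in auto)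
  obtain k where k: "k > 0" "\<And>x. \<bar>x \<bullet> (Z *v x)\<bar> \<le> k * (norm x)\<^sup>2"
    using quadratic_form_bound[of Z] by blast
  define a where "a = 2 * d / k"
  have a: "a > 0" using d k by (simp add: a_def)
  define g where "g t = x t \<bullet> (Z *v x t)" for t
  define h where "h t = 2 * (x t \<bullet> (Z *v (M *v x t)))" for t
  have hg: "h t + a * g t \<le> 0" for t
  proof -
    have "h t \<le> - 2 * d * (norm (x t))\<^sup>2"
      using d(2)[of "x t"] by (simp add: h_def matrix_vector_mult_minus_left flip: matrix_vector_mul_assoc)
    moreover have "a * g t \<le> a * (k * (norm (x t))\<^sup>2)"
      using a k(2)[of "x t"] by (intro mult_left_mono) (auto simp: g_def)
    moreover have "a * (k * (norm (x t))\<^sup>2) = 2 * d * (norm (x t))\<^sup>2" using k(1) by (simp add: a_def)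
    ultimately show ?thesis by simp
  qed
  have "g t * exp (a * t) \<le> g 0 * exp (a * 0)" if t: "t > 0" for t
  proof (rule DERIV_nonpos_imp_decreasing_open[of 0 t "\<lambda>t. g t * exp (a * t)"])
    have contx: "continuous_on {0..t} x"
      by (rule continuous_on_subset[OF continuous_on_state[OF x]]) auto
    have contN: "continuous_on {0..t} (\<lambda>s. N *v x s)" for N :: "real^'n^'n"
      by (rule linear_continuous_on_compose[OF contx]) auto
    have conth: "continuous_on {0..t} h"
      unfolding h_def matrix_vector_mul_assoc by (intro continuous_intros contx contN)
    show "continuous_on {0..t} (\<lambda>t. g t * exp (a * t))"
      unfolding g_def by (intro continuous_intros contx contN)
    have gI: "g 0 + integral {0..s} h = g s" if "s \<ge> 0" for s
    proof -
      have "(h has_integral (g s - g 0)) {0..s}"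
        using state_energy_identity[OF x Z(1) that] unfolding h_def[abs_def]
        by (simp add: g_def M_def state_at_0[OF x] matrix_vector_mult_add_rdistrib matrix_vector_mul_assoc)
      then show ?thesis by (simp add: integral_unique)
    qed
    show "\<exists>y. DERIV (\<lambda>t. g t * exp (a * t)) s :> y \<and> y \<le> 0" if s: "0 < s" "s < t" for s
    proof -
      have "((\<lambda>s. g 0 + integral {0..s} h) has_real_derivative 0 + h s) (at s within {0..t})"
        by (intro DERIV_add DERIV_const integral_has_real_derivative conth) (use s in auto)
      then have "((\<lambda>s. g 0 + integral {0..s} h) has_real_derivative h s) (at s)"
        using s at_within_Icc_at[of 0 s t] by simp
      then have "(g has_real_derivative h s) (at s)"
        by (rule has_field_derivative_transform_within_open[of _ _ _ "{0<..}"]) (use s gI in auto)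
      then have "DERIV (\<lambda>t. g t * exp (a * t)) s :> h s * exp (a * s) + exp (a * s) * (a * 1) * g s"
        by (auto intro!: derivative_eq_intros)
      moreover have "h s * exp (a * s) + exp (a * s) * (a * 1) * g s \<le> 0"
        using mult_right_mono[OF hg[of s], of "exp (a * s)"] by (simp add: algebra_simps)
      ultimately show ?thesis by blast
    qed
  qed (use t in auto)
  then have ge: "g t * exp (a * t) \<le> g 0" if "t \<ge> 0" for t using that by (cases "t = 0") auto
  show ?thesis
  proof
    show "0 \<le> g 0 / c" using c(1) c(2)[of "x 0"] by (metis divide_nonneg_pos g_def mult_nonneg_nonneg less_imp_le order_trans zero_le_power2)
    show "a > 0" by (rule a)
    fix t :: real assume "t \<ge> 0"
    have "c * (norm (x t))\<^sup>2 * exp (a * t) \<le> g t * exp (a * t)"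
      using c(2)[of "x t"] by (simp add: g_def)
    also have "\<dots> \<le> g 0" by (rule ge) fact
    finally show "(norm (x t))\<^sup>2 \<le> g 0 / c * exp (- a * t)"
      using c(1) by (simp add: field_simps exp_minus)
  qed
qed

lemma norm_squared_integrable_if_decaying:
  fixes x :: "real \<Rightarrow> real^'n"
  assumes cont: "continuous_on {0..} x" and a: "a > 0"
    and bound: "\<And>t. t \<ge> 0 \<Longrightarrow> (norm (x t))\<^sup>2 \<le> C * exp (- a * t)"
  shows "(\<lambda>t. (norm (F *v x t))\<^sup>2) absolutely_integrable_on {0..}" "(x \<longlongrightarrow> 0) at_top"
proof -
  obtain L where L: "L > 0" "\<And>v. norm (F *v v) \<le> L * norm v" using matrix_norm_bound[of F] by blast
  show "(\<lambda>t. (norm (F *v x t))\<^sup>2) absolutely_integrable_on {0..}"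
  proof (rule measurable_bounded_by_integrable_imp_absolutely_integrable)
    show "(\<lambda>t. (norm (F *v x t))\<^sup>2) \<in> borel_measurable (lebesgue_on {0..})"
      by (intro continuous_imp_measurable_on_sets_lebesgue continuous_intros
          linear_continuous_on_compose[OF cont]) auto
    show "(\<lambda>t. L\<^sup>2 * C * exp (- a * t)) integrable_on {0..}"
      using has_integral_exp_minus_to_infinity[OF a, of 0] by (intro integrable_on_mult_right) blast
    fix t :: real assume "t \<in> {0..}"
    have "(norm (F *v x t))\<^sup>2 \<le> (L * norm (x t))\<^sup>2" using L(2) by (intro power_mono) auto
    also have "\<dots> \<le> L\<^sup>2 * (C * exp (- a * t))"
      unfolding power_mult_distrib using bound \<open>t \<in> {0..}\<close> by (intro mult_left_mono) auto
    finally show "norm ((norm (F *v x t))\<^sup>2) \<le> L\<^sup>2 * C * exp (- a * t)" by simp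
  qed simp
  have "((\<lambda>t. (norm (x t))\<^sup>2) \<longlongrightarrow> 0) at_top"
  proof (rule tendsto_sandwich[OF _ _ tendsto_const])
    show "\<forall>\<^sub>F t in at_top. (norm (x t))\<^sup>2 \<le> C * exp (- a * t)"
      using bound unfolding eventually_at_top_linorder by blast
    have "((\<lambda>t. exp (- a * t)) \<longlongrightarrow> 0) at_top"
      using a by (intro filterlim_compose[OF exp_at_bot] filterlim_tendsto_neg_mult_at_bot[OF tendsto_const]
          filterlim_ident) auto
    from tendsto_mult_left[OF this, of C] show "((\<lambda>t. C * exp (- a * t)) \<longlongrightarrow> 0) at_top" by simp
  qed auto
  from tendsto_real_sqrt[OF this] have "((\<lambda>t. norm (x t)) \<longlongrightarrow> 0) at_top" by simp
  then show "(x \<longlongrightarrow> 0) at_top" by (rule tendsto_norm_zero_cancel)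
qed

lemma stable_feedback_admissible:
  assumes stable: "stable_matrix (A + B ** F)" and x: "is_state A B x0 (\<lambda>t. F *v x t) x"
  shows "admissible A B x0 (\<lambda>t. F *v x t) x" "(\<lambda>t. (norm (G *v x t))\<^sup>2) absolutely_integrable_on {0..}"
proof -
  obtain C a where Ca: "a > 0" "\<And>t. t \<ge> 0 \<Longrightarrow> (norm (x t))\<^sup>2 \<le> C * exp (- a * t)"
    using exponential_decay[OF stable x] by blast
  note * = norm_squared_integrable_if_decaying[OF continuous_on_state[OF x] Ca]
  show "admissible A B x0 (\<lambda>t. F *v x t) x" using * x by (simp add: admissible_def)
  show "(\<lambda>t. (norm (G *v x t))\<^sup>2) absolutely_integrable_on {0..}" by (rule *)
qed

section \<open>Integrals over the half line\<close>

text \<open>Monotone convergence for the truncations of \<open>l\<close> to \<open>{0..n}\<close>.\<close>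

lemma integrable_on_halfline:
  fixes l :: "real \<Rightarrow> real"
  assumes nonneg: "\<And>t. t \<ge> 0 \<Longrightarrow> 0 \<le> l t" and int: "\<And>t. t \<ge> 0 \<Longrightarrow> l integrable_on {0..t}"
    and bound: "\<And>t. t \<ge> 0 \<Longrightarrow> integral {0..t} l \<le> C"
  shows "l integrable_on {0..}" "(\<lambda>n. integral {0..real n} l) \<longlonglongrightarrow> integral {0..} l"
proof -
  define f where "f k t = (if t \<in> {0..real k} then l t else 0)" for k t
  have Int: "{0..real k} \<inter> {0..} = {0..real k}" for k by auto
  have ints: "integral {0..} (f k) = integral {0..real k} l" for k
    unfolding f_def Henstock_Kurzweil_Integration.integral_restrict_Int Int ..
  have "l integrable_on {0..} \<and> (\<lambda>k. integral {0..} (f k)) \<longlonglongrightarrow> integral {0..} l"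
  proof (rule monotone_convergence_increasing)
    show "f k integrable_on {0..}" for k
      unfolding f_def integrable_restrict_Int Int using int by simp
    show "f k t \<le> f (Suc k) t" if "t \<in> {0..}" for k t using that nonneg by (simp add: f_def)
    show "(\<lambda>k. f k t) \<longlonglongrightarrow> l t" if t: "t \<in> {0..}" for t
    proof (rule tendsto_eventually)
      have "f k t = l t" if "k \<ge> nat \<lceil>t\<rceil>" for k
        using that t by (auto simp: f_def nat_le_iff ceiling_le_iff)
      then show "\<forall>\<^sub>F k in sequentially. f k t = l t"
        unfolding eventually_sequentially by blast
    qed
    show "bounded (range (\<lambda>k. integral {0..} (f k)))"
    proof (rule boundedI[of _ C])
      fix y assume "y \<in> range (\<lambda>k. integral {0..} (f k))"
      then obtain k where k: "y = integral {0..real k} l" by (auto simp: ints)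
      have "0 \<le> y" unfolding k by (rule integral_nonneg) (use int nonneg in auto)
      then show "norm y \<le> C" using bound[of "real k"] by (simp add: k)
    qed
  qed
  then show "l integrable_on {0..}" "(\<lambda>n. integral {0..real n} l) \<longlonglongrightarrow> integral {0..} l"
    by (auto simp: ints)
qed

lemma has_integral_halfline_limit:
  fixes l :: "real \<Rightarrow> real"
  assumes nonneg: "\<And>t. t \<ge> 0 \<Longrightarrow> 0 \<le> l t" and int: "\<And>t. t \<ge> 0 \<Longrightarrow> l integrable_on {0..t}"
    and lim: "((\<lambda>t. integral {0..t} l) \<longlongrightarrow> c) at_top"
  shows "(l has_integral c) {0..}"
proof -
  have mono: "integral {0..s} l \<le> integral {0..t} l" if "0 \<le> s" "s \<le> t" for s t
    by (rule integral_subset_le) (use that int nonneg in auto)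
  have bound: "integral {0..s} l \<le> c" if s: "s \<ge> 0" for s
  proof (rule tendsto_lowerbound[OF lim])
    show "\<forall>\<^sub>F t in at_top. integral {0..s} l \<le> integral {0..t} l"
      using mono[OF s] unfolding eventually_at_top_linorder by blast
  qed simp
  note * = integrable_on_halfline[OF nonneg int bound]
  have "(\<lambda>n. integral {0..real n} l) \<longlonglongrightarrow> c"
    by (rule filterlim_compose[OF lim filterlim_real_sequentially])
  then have "integral {0..} l = c" using *(2) LIMSEQ_unique by blast
  then show ?thesis using *(1) by (simp add: has_integral_iff)
qed

lemma measurable_on_halfline:
  fixes f :: "real \<Rightarrow> 'a::euclidean_space"
  assumes "\<And>t. t \<ge> 0 \<Longrightarrow> f absolutely_integrable_on {0..t}"
  shows "f \<in> borel_measurable (lebesgue_on {0..})"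
proof (rule measurable_piecewise_restrict[where C = "range (\<lambda>n::nat. {0..real n})"])
  have Int: "{0..} \<inter> {0..real n} = {0..real n}" for n by auto
  fix \<Omega> assume "\<Omega> \<in> range (\<lambda>n::nat. {0..real n})"
  then obtain n :: nat where n: "\<Omega> = {0..real n}" by auto
  show "\<Omega> \<inter> space (lebesgue_on {0..}) \<in> sets (lebesgue_on {0..})"
    by (auto simp: n sets_restrict_space space_restrict_space intro!: image_eqI[of _ _ "{0..real n}"])
  have "restrict_space (lebesgue_on {0..}) \<Omega> = lebesgue_on {0..real n}"
    by (simp add: n restrict_restrict_space Int)
  then show "f \<in> borel_measurable (restrict_space (lebesgue_on {0..}) \<Omega>)"
    using absolutely_integrable_imp_borel_measurable[OF assms[of "real n"]] by simp
next
  show "space (lebesgue_on {0..}) \<subseteq> \<Union> (range (\<lambda>n::nat. {0..real n}))"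
    using real_arch_simple by (auto simp: space_restrict_space)
qed simp

lemma state_measurable:
  assumes "is_state A B x0 u x"
  shows "u \<in> borel_measurable (lebesgue_on {0..})" "x \<in> borel_measurable (lebesgue_on {0..})"
  using assms measurable_on_halfline[of u]
  by (auto simp: is_state_def intro: continuous_imp_measurable_on_sets_lebesgue[OF continuous_on_state[OF assms]])

lemma negligible_if_integral_zero:
  fixes f :: "real \<Rightarrow> real"
  assumes nonneg: "\<And>x. 0 \<le> f x" and zero: "(f has_integral 0) S"
  shows "negligible {x \<in> S. f x \<noteq> 0}"
proof -
  have "(\<lambda>x. indicator S x *\<^sub>R f x) \<in> lebesgue \<rightarrow>\<^sub>M borel"
    using zero by (rule has_integral_implies_lebesgue_measurable)
  then have m: "(\<lambda>x. ennreal (indicator S x *\<^sub>R f x)) \<in> borel_measurable lebesgue" by measurable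
  have "integral\<^sup>N lborel (\<lambda>x. ennreal (f x) * indicator S x) = 0"
    using nn_integral_has_integral_lebesgue'[OF nonneg zero] by simp
  moreover have "(\<lambda>x. ennreal (f x) * indicator S x) = (\<lambda>x. ennreal (indicator S x *\<^sub>R f x))"
    by (auto simp: indicator_def fun_eq_iff)
  ultimately have "integral\<^sup>N lebesgue (\<lambda>x. ennreal (indicator S x *\<^sub>R f x)) = 0"
    by (simp add: nn_integral_completion)
  then have "AE x in lebesgue. ennreal (indicator S x *\<^sub>R f x) = 0"
    by (simp only: nn_integral_0_iff_AE[OF m])
  then obtain N where N: "negligible N" "{x. \<not> ennreal (indicator S x *\<^sub>R f x) = 0} \<subseteq> N"
    unfolding eventually_ae_filter_negligible by blast
  have "{x \<in> S. f x \<noteq> 0} \<subseteq> N"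
  proof
    fix x assume "x \<in> {x \<in> S. f x \<noteq> 0}"
    then have "0 < indicator S x *\<^sub>R f x" using nonneg[of x] by (simp add: less_le)
    then have "ennreal (indicator S x *\<^sub>R f x) \<noteq> 0" by (simp only: ennreal_eq_0_iff not_le)
    then show "x \<in> N" using N(2) by blast
  qed
  then show ?thesis by (rule negligible_subset[OF N(1)])
qed

section \<open>Superposition and concatenation of trajectories\<close>

lemma is_state_combination:
  assumes st: "is_state A B x0 u x" "is_state A B y0 v y"
  shows "is_state A B (a *\<^sub>R x0 + b *\<^sub>R y0) (\<lambda>t. a *\<^sub>R u t + b *\<^sub>R v t) (\<lambda>t. a *\<^sub>R x t + b *\<^sub>R y t)"
  unfolding is_state_def
proof (intro conjI allI impI)
  fix t :: real assume t: "0 \<le> t"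
  show "(\<lambda>t. a *\<^sub>R u t + b *\<^sub>R v t) absolutely_integrable_on {0..t}"
    using st t by (intro set_integral_add(1) absolutely_integrable_scaleR_left) (auto simp: is_state_def)
  have "((\<lambda>s. a *\<^sub>R (A *v x s + B *v u s) + b *\<^sub>R (A *v y s + B *v v s)) has_integral
      (a *\<^sub>R (x t - x0) + b *\<^sub>R (y t - y0))) {0..t}"
    using st t by (intro has_integral_add has_integral_cmul) (auto simp: is_state_def)
  then show "((\<lambda>s. A *v (a *\<^sub>R x s + b *\<^sub>R y s) + B *v (a *\<^sub>R u s + b *\<^sub>R v s)) has_integral
      (a *\<^sub>R x t + b *\<^sub>R y t - (a *\<^sub>R x0 + b *\<^sub>R y0))) {0..t}"
    by (simp add: matrix_vector_right_distrib matrix_vector_mult_scaleR algebra_simps)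
qed

lemma norm_squared_combination_le:
  fixes u v :: "'a::real_inner"
  shows "(norm (a *\<^sub>R u + b *\<^sub>R v))\<^sup>2 \<le> 2 * a\<^sup>2 * (norm u)\<^sup>2 + 2 * b\<^sup>2 * (norm v)\<^sup>2"
proof -
  have "0 \<le> (norm (a *\<^sub>R u - b *\<^sub>R v))\<^sup>2" by simp
  then show ?thesis
    unfolding power2_norm_eq_inner
    by (simp add: inner_simps algebra_simps power2_eq_square inner_commute)
qed

lemma admissible_combination:
  assumes adm: "admissible A B x0 u x" "admissible A B y0 v y"
  shows "admissible A B (a *\<^sub>R x0 + b *\<^sub>R y0) (\<lambda>t. a *\<^sub>R u t + b *\<^sub>R v t) (\<lambda>t. a *\<^sub>R x t + b *\<^sub>R y t)"
  unfolding admissible_def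
proof (intro conjI)
  have st: "is_state A B x0 u x" "is_state A B y0 v y" using adm by (auto simp: admissible_def)
  show st': "is_state A B (a *\<^sub>R x0 + b *\<^sub>R y0) (\<lambda>t. a *\<^sub>R u t + b *\<^sub>R v t) (\<lambda>t. a *\<^sub>R x t + b *\<^sub>R y t)"
    by (rule is_state_combination[OF st])
  have bd: "(\<lambda>t. 2 * a\<^sup>2 * (norm (u t))\<^sup>2 + 2 * b\<^sup>2 * (norm (v t))\<^sup>2) integrable_on {0..}"
    using adm by (intro integrable_add integrable_on_mult_right) (auto simp: admissible_def absolutely_integrable_on_def)
  show "(\<lambda>t. (norm (a *\<^sub>R u t + b *\<^sub>R v t))\<^sup>2) absolutely_integrable_on {0..}"
  proof (rule measurable_bounded_by_integrable_imp_absolutely_integrable[OF _ _ bd])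
    show "(\<lambda>t. (norm (a *\<^sub>R u t + b *\<^sub>R v t))\<^sup>2) \<in> borel_measurable (lebesgue_on {0..})"
      by (intro borel_measurable_power measurable_compose[OF state_measurable(1)[OF st'] borel_measurable_norm])
  qed (use norm_squared_combination_le in auto)
  have "((\<lambda>t. a *\<^sub>R x t + b *\<^sub>R y t) \<longlongrightarrow> a *\<^sub>R 0 + b *\<^sub>R 0) at_top"
    using adm by (intro tendsto_add tendsto_scaleR tendsto_const) (auto simp: admissible_def)
  then show "((\<lambda>t. a *\<^sub>R x t + b *\<^sub>R y t) \<longlongrightarrow> 0) at_top" by simp
qed

text \<open>A control that differs from the feedback \<open>- L x\<close> almost everywhere by an element of the range of
  \<open>G\<close> is a control of the closed-loop system with input matrix \<open>B ** G\<close>; \<open>Y\<close> reads off the new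
  control.\<close>

lemma is_state_change_input:
  fixes A :: "real^'n^'n" and B :: "real^'m^'n" and L :: "real^'n^'m" and G :: "real^'k^'m" and Y :: "real^'m^'k"
  assumes st: "is_state A B x0 u x"
    and ae: "\<And>t. 0 \<le> t \<Longrightarrow> negligible {s \<in> {0..t}. G *v (Y *v (u s + L *v x s)) \<noteq> u s + L *v x s}"
  shows "is_state (A - B ** L) (B ** G) x0 (\<lambda>s. Y *v (u s + L *v x s)) x"
  unfolding is_state_def
proof (intro conjI allI impI)
  fix t :: real assume t: "0 \<le> t"
  have cont: "continuous_on {0..t} x"
    by (rule continuous_on_subset[OF continuous_on_state[OF st]]) auto
  have "(\<lambda>s. L *v x s) absolutely_integrable_on {0..t}"
    by (intro absolutely_integrable_continuous_real linear_continuous_on_compose[OF cont]) auto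
  then have "(\<lambda>s. u s + L *v x s) absolutely_integrable_on {0..t}"
    using st t by (intro set_integral_add(1)) (auto simp: is_state_def)
  then show "(\<lambda>s. Y *v (u s + L *v x s)) absolutely_integrable_on {0..t}"
    using absolutely_integrable_linear[of "{0..t}" "\<lambda>s. u s + L *v x s" "(*v) Y"] by (simp add: o_def)
  have "((\<lambda>s. A *v x s + B *v u s) has_integral (x t - x0)) {0..t}"
    using st t by (auto simp: is_state_def)
  then show "((\<lambda>s. (A - B ** L) *v x s + (B ** G) *v (Y *v (u s + L *v x s))) has_integral (x t - x0)) {0..t}"
  proof (rule has_integral_spike[OF ae[OF t], rotated])
    fix s assume "s \<in> {0..t} - {s \<in> {0..t}. G *v (Y *v (u s + L *v x s)) \<noteq> u s + L *v x s}"
    then have "G *v (Y *v (u s + L *v x s)) = u s + L *v x s" by blast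
    then have "(B ** G) *v (Y *v (u s + L *v x s)) = B *v (u s + L *v x s)"
      by (simp flip: matrix_vector_mul_assoc)
    then show "(A - B ** L) *v x s + (B ** G) *v (Y *v (u s + L *v x s)) = A *v x s + B *v u s"
      by (simp add: matrix_vector_mult_diff_rdistrib matrix_vector_right_distrib flip: matrix_vector_mul_assoc)
  qed
qed

text \<open>Follow \<open>f\<close> up to time \<open>h\<close> and restart with \<open>g\<close> afterwards.\<close>

definition glue :: "real \<Rightarrow> (real \<Rightarrow> 'a) \<Rightarrow> (real \<Rightarrow> 'a) \<Rightarrow> real \<Rightarrow> 'a" where
  "glue h f g t = (if t \<le> h then f t else g (t - h))"

lemma glue_map: "\<phi> (glue h u v t) = glue h (\<lambda>t. \<phi> (u t)) (\<lambda>t. \<phi> (v t)) t"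
  by (simp add: glue_def)

lemma has_integral_glue:
  fixes f g :: "real \<Rightarrow> 'a::banach"
  assumes f: "(f has_integral a) {0..h}" and g: "(g has_integral b) {0..t}" and "0 \<le> h" "0 \<le> t"
  shows "(glue h f g has_integral (a + b)) {0..h + t}"
proof (rule has_integral_combine[where c = h])
  show "(glue h f g has_integral a) {0..h}"
    by (rule has_integral_eq[OF _ f]) (simp add: glue_def)
  have "((\<lambda>s. g (s - h)) \<circ> (+) h) = g" by (simp add: fun_eq_iff)
  then have "((\<lambda>s. g (s - h)) has_integral b) {h..h + t}"
    using has_integral_shift_Icc_real[of "\<lambda>s. g (s - h)" h b 0 t] g by (simp add: add.commute)
  then show "(glue h f g has_integral b) {h..h + t}"
    by (rule has_integral_spike_finite[of "{h}", rotated 2]) (auto simp: glue_def)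
qed (use assms in auto)

lemma integral_halfline_glue_le:
  fixes f g :: "real \<Rightarrow> real"
  assumes f: "f integrable_on {0..h}" "\<And>t. 0 \<le> f t" and g: "(g has_integral c) {0..}" "\<And>t. 0 \<le> g t"
    and h: "0 \<le> h"
  shows "glue h f g integrable_on {0..}" "integral {0..} (glue h f g) \<le> integral {0..h} f + c"
proof -
  have nonneg: "0 \<le> glue h f g t" for t using f(2) g(2) by (simp add: glue_def)
  have gi: "g integrable_on {0..t}" for t using g(1) by (auto intro: integrable_on_subinterval)
  have gc: "integral {0..t} g \<le> c" for t
  proof -
    have "integral {0..t} g \<le> integral {0..} g"
      by (rule integral_subset_le) (use g gi in auto)
    then show ?thesis using g(1) by (simp add: integral_unique)
  qed
  have I: "(glue h f g has_integral (integral {0..h} f + integral {0..t} g)) {0..h + t}" if "0 \<le> t" for t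
    by (rule has_integral_glue[OF integrable_integral[OF f(1)] integrable_integral[OF gi] h that])
  have int: "glue h f g integrable_on {0..t}" if "0 \<le> t" for t
    by (rule integrable_on_subinterval[of _ "{0..h + t}"]) (use I[OF that] h in auto)
  have bound: "integral {0..t} (glue h f g) \<le> integral {0..h} f + c" if t: "0 \<le> t" for t
  proof -
    have "integral {0..t} (glue h f g) \<le> integral {0..h + t} (glue h f g)"
      by (rule integral_subset_le) (use int[OF t] I[OF t] h nonneg in auto)
    also have "\<dots> = integral {0..h} f + integral {0..t} g" using I[OF t] by (rule integral_unique)
    finally show ?thesis using gc[of t] by simp
  qed
  note * = integrable_on_halfline[OF nonneg int bound]
  show "glue h f g integrable_on {0..}" by (rule *(1))
  show "integral {0..} (glue h f g) \<le> integral {0..h} f + c"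
    by (rule LIMSEQ_le_const2[OF *(2)]) (use bound in auto)
qed

lemma absolutely_integrable_glue:
  fixes f g :: "real \<Rightarrow> 'a::euclidean_space"
  assumes f: "f absolutely_integrable_on {0..h}" and g: "\<And>t. 0 \<le> t \<Longrightarrow> g absolutely_integrable_on {0..t}"
    and h: "0 \<le> h" and t: "0 \<le> t"
  shows "glue h f g absolutely_integrable_on {0..t}"
proof -
  \<comment> \<open>The longer interval \<open>{0..h + t}\<close> avoids a case distinction on whether \<open>t\<close> exceeds \<open>h\<close>.\<close>
  have "glue h f g integrable_on {0..h + t}"
    using has_integral_glue[OF integrable_integral integrable_integral h t, of f g] f g[OF t]
    by (auto simp: absolutely_integrable_on_def)
  moreover have "(\<lambda>s. norm (glue h f g s)) integrable_on {0..h + t}"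
    unfolding glue_map[of norm]
    using has_integral_glue[OF integrable_integral integrable_integral h t, of "\<lambda>s. norm (f s)" "\<lambda>s. norm (g s)"] f g[OF t]
    by (auto simp: absolutely_integrable_on_def)
  ultimately have "glue h f g absolutely_integrable_on {0..h + t}"
    by (simp add: absolutely_integrable_on_def)
  then show ?thesis by (rule absolutely_integrable_on_subinterval) (use h in auto)
qed

lemma is_state_glue:
  assumes x: "is_state A B x0 u x" and y: "is_state A B (x h) v y" and h: "0 \<le> h"
  shows "is_state A B x0 (glue h u v) (glue h x y)"
  unfolding is_state_def
proof (intro conjI allI impI)
  fix t :: real assume t: "0 \<le> t"
  show "glue h u v absolutely_integrable_on {0..t}"
    by (rule absolutely_integrable_glue) (use x y h t in \<open>auto simp: is_state_def\<close>)
  have eq: "(\<lambda>s. A *v glue h x y s + B *v glue h u v s) =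
      glue h (\<lambda>s. A *v x s + B *v u s) (\<lambda>s. A *v y s + B *v v s)"
    by (auto simp: glue_def fun_eq_iff)
  show "((\<lambda>s. A *v glue h x y s + B *v glue h u v s) has_integral (glue h x y t - x0)) {0..t}"
  proof (cases "t \<le> h")
    case True
    have "((\<lambda>s. A *v x s + B *v u s) has_integral (x t - x0)) {0..t}"
      using x t by (auto simp: is_state_def)
    then have "((\<lambda>s. A *v glue h x y s + B *v glue h u v s) has_integral (x t - x0)) {0..t}"
      by (rule has_integral_eq[rotated]) (use True in \<open>auto simp: glue_def\<close>)
    then show ?thesis using True by (simp add: glue_def)
  next
    case False
    have "((\<lambda>s. A *v glue h x y s + B *v glue h u v s) has_integral
        ((x h - x0) + (y (t - h) - x h))) {0..h + (t - h)}"
      unfolding eq by (rule has_integral_glue) (use x y h False in \<open>auto simp: is_state_def\<close>)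
    then show ?thesis using False by (simp add: glue_def)
  qed
qed

lemma admissible_glue:
  assumes x: "is_state A B x0 u x" "(\<lambda>t. (norm (u t))\<^sup>2) integrable_on {0..h}"
    and y: "admissible A B (x h) v y" and h: "0 \<le> h"
  shows "admissible A B x0 (glue h u v) (glue h x y)"
  unfolding admissible_def
proof (intro conjI)
  show "is_state A B x0 (glue h u v) (glue h x y)"
    by (rule is_state_glue) (use x y h in \<open>auto simp: admissible_def\<close>)
  have "((\<lambda>t. (norm (v t))\<^sup>2) has_integral integral {0..} (\<lambda>t. (norm (v t))\<^sup>2)) {0..}"
    using y by (intro integrable_integral) (auto simp: admissible_def absolutely_integrable_on_def)
  from integral_halfline_glue_le(1)[OF x(2) _ this _ h]
  have "glue h (\<lambda>t. (norm (u t))\<^sup>2) (\<lambda>t. (norm (v t))\<^sup>2) integrable_on {0..}" by simp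
  then have "(\<lambda>t. (norm (glue h u v t))\<^sup>2) integrable_on {0..}"
    unfolding glue_map[of "\<lambda>z. (norm z)\<^sup>2"] .
  then show "(\<lambda>t. (norm (glue h u v t))\<^sup>2) absolutely_integrable_on {0..}"
    by (rule nonnegative_absolutely_integrable_1) simp
  have "((\<lambda>t. y (- h + t)) \<longlongrightarrow> 0) at_top"
    by (rule filterlim_compose[OF _ filterlim_tendsto_add_at_top[OF tendsto_const filterlim_ident]])
      (use y in \<open>simp add: admissible_def\<close>)
  then show "(glue h x y \<longlongrightarrow> 0) at_top"
  proof (rule Lim_transform_eventually)
    show "\<forall>\<^sub>F t in at_top. y (- h + t) = glue h x y t"
      using eventually_gt_at_top[of h] by eventually_elim (simp add: glue_def)
  qed
qed

section \<open>The cost functional\<close>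

text \<open>The running cost as a bilinear form in the two pairs \<open>(u, x)\<close> and \<open>(v, y)\<close>; the cost of \<open>(u, x)\<close> is
  the integral of its diagonal values.\<close>

definition lq_form ::
  "real^'n^'n \<Rightarrow> real^'m^'m \<Rightarrow> (real \<Rightarrow> real^'m) \<Rightarrow> (real \<Rightarrow> real^'n) \<Rightarrow>
     (real \<Rightarrow> real^'m) \<Rightarrow> (real \<Rightarrow> real^'n) \<Rightarrow> real \<Rightarrow> real" where
  "lq_form Q R u x v y t = x t \<bullet> (Q *v y t) + u t \<bullet> (R *v v t)"

definition finite_cost ::
  "real^'n^'n \<Rightarrow> real^'m^'n \<Rightarrow> real^'n^'n \<Rightarrow> real^'m^'m \<Rightarrow> real^'n \<Rightarrow>
     (real \<Rightarrow> real^'m) \<Rightarrow> (real \<Rightarrow> real^'n) \<Rightarrow> bool" where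
  "finite_cost A B Q R x0 u x \<longleftrightarrow> admissible A B x0 u x \<and> lq_form Q R u x u x integrable_on {0..}"

locale lq_problem =
  fixes A :: "real^'n^'n" and B :: "real^'m^'n" and Q :: "real^'n^'n" and R :: "real^'m^'m"
  assumes psd_Q: "pos_semidef Q" and psd_R: "pos_semidef R"
begin

lemma sym_Q: "transpose Q = Q" and sym_R: "transpose R = R"
  using psd_Q psd_R by (auto simp: pos_semidef_def)

abbreviation "form \<equiv> lq_form Q R"

lemma form_nonneg: "0 \<le> form u x u x t"
  using psd_Q psd_R by (simp add: lq_form_def pos_semidef_def)

lemma form_sym: "form u x v y t = form v y u x t"
  using inner_matrix_sym[OF sym_Q, of "x t" "y t"] inner_matrix_sym[OF sym_R, of "u t" "v t"]
  by (simp add: lq_form_def inner_commute)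

lemma form_combination:
  "form (\<lambda>t. a *\<^sub>R u t + b *\<^sub>R v t) (\<lambda>t. a *\<^sub>R x t + b *\<^sub>R y t)
        (\<lambda>t. a *\<^sub>R u t + b *\<^sub>R v t) (\<lambda>t. a *\<^sub>R x t + b *\<^sub>R y t) t =
   a\<^sup>2 * form u x u x t + 2 * a * b * form u x v y t + b\<^sup>2 * form v y v y t"
  using inner_matrix_sym[OF sym_Q, of "x t" "y t"] inner_matrix_sym[OF sym_R, of "u t" "v t"]
  by (simp add: lq_form_def inner_simps matrix_vector_right_distrib matrix_vector_mult_scaleR
      algebra_simps power2_eq_square inner_commute)

text \<open>The parallelogram inequality for the positive semidefinite running cost.\<close>

lemma form_combination_le:
  "form (\<lambda>t. a *\<^sub>R u t + b *\<^sub>R v t) (\<lambda>t. a *\<^sub>R x t + b *\<^sub>R y t)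
        (\<lambda>t. a *\<^sub>R u t + b *\<^sub>R v t) (\<lambda>t. a *\<^sub>R x t + b *\<^sub>R y t) t
   \<le> 2 * a\<^sup>2 * form u x u x t + 2 * b\<^sup>2 * form v y v y t"
proof -
  have "0 \<le> form (\<lambda>t. a *\<^sub>R u t + (- b) *\<^sub>R v t) (\<lambda>t. a *\<^sub>R x t + (- b) *\<^sub>R y t)
        (\<lambda>t. a *\<^sub>R u t + (- b) *\<^sub>R v t) (\<lambda>t. a *\<^sub>R x t + (- b) *\<^sub>R y t) t"
    by (rule form_nonneg)
  then show ?thesis
    unfolding form_combination[of a u b v] form_combination[of a u "- b" v] by simp
qed

lemma form_measurable:
  assumes "is_state A B x0 u x" "is_state A B y0 v y"
  shows "form u x v y \<in> borel_measurable (lebesgue_on {0..})"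
proof -
  have mult: "(\<lambda>t. N *v f t) \<in> borel_measurable (lebesgue_on {0..})"
    if "f \<in> borel_measurable (lebesgue_on {0..})" for f :: "real \<Rightarrow> real^'k" and N :: "real^'k^'k"
    using that by (intro borel_measurable_continuous_on[OF _ that] linear_continuous_on) auto
  show ?thesis
    unfolding lq_form_def[abs_def]
    using state_measurable[OF assms(1)] state_measurable[OF assms(2)]
    by (intro borel_measurable_add borel_measurable_inner mult)
qed

text \<open>The state is continuous and the control is square integrable.\<close>

lemma form_integrable_on_interval:
  assumes adm: "admissible A B x0 u x" and t: "0 \<le> t"
  shows "form u x u x integrable_on {0..t}"
proof -
  have st: "is_state A B x0 u x" and L2: "(\<lambda>t. (norm (u t))\<^sup>2) absolutely_integrable_on {0..}"
    using adm by (auto simp: admissible_def)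
  obtain C where C: "\<And>v. \<bar>v \<bullet> (R *v v)\<bar> \<le> C * (norm v)\<^sup>2" using quadratic_form_bound[of R] by blast
  have cont: "continuous_on {0..t} x" by (rule continuous_on_subset[OF continuous_on_state[OF st]]) auto
  have intx: "(\<lambda>s. x s \<bullet> (Q *v x s)) integrable_on {0..t}"
    by (intro integrable_continuous_real continuous_on_inner cont linear_continuous_on_compose[OF cont]) auto
  have "(\<lambda>t. (norm (u t))\<^sup>2) integrable_on {0..t}"
    using L2 by (auto intro: integrable_on_subinterval simp: absolutely_integrable_on_def)
  then have bd: "(\<lambda>s. x s \<bullet> (Q *v x s) + C * (norm (u s))\<^sup>2) integrable_on {0..t}"
    by (intro integrable_add intx integrable_on_mult_right)
  have "form u x u x \<in> borel_measurable (lebesgue_on {0..t})"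
    by (rule measurable_restrict_mono[OF form_measurable[OF st st]]) auto
  then have "form u x u x absolutely_integrable_on {0..t}"
  proof (rule measurable_bounded_by_integrable_imp_absolutely_integrable[OF _ _ bd])
    fix s assume "s \<in> {0..t}"
    show "norm (form u x u x s) \<le> x s \<bullet> (Q *v x s) + C * (norm (u s))\<^sup>2"
      using C[of "u s"] form_nonneg[of u x s] by (simp add: lq_form_def)
  qed simp
  then show ?thesis by (simp add: absolutely_integrable_on_def)
qed

lemma lq_cost_eq_integral:
  assumes "(form u x u x has_integral c) {0..}"
  shows "lq_cost Q R u x = ennreal c"
  using nn_integral_has_integral_lebesgue'[OF form_nonneg assms]
  by (simp add: lq_cost_def lq_form_def nn_integral_completion)

lemma lq_cost_eq_limit:
  assumes "admissible A B x0 u x" "((\<lambda>t. integral {0..t} (form u x u x)) \<longlongrightarrow> c) at_top"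
  shows "(form u x u x has_integral c) {0..}" "lq_cost Q R u x = ennreal c"
  using has_integral_halfline_limit[OF form_nonneg form_integrable_on_interval[OF assms(1)] assms(2)]
    lq_cost_eq_integral by auto

lemma lq_cost_finite:
  assumes adm: "admissible A B x0 u x" and fin: "lq_cost Q R u x \<noteq> \<infinity>"
  obtains c where "(form u x u x has_integral c) {0..}" "lq_cost Q R u x = ennreal c" "0 \<le> c"
    "\<And>t. 0 \<le> t \<Longrightarrow> integral {0..t} (form u x u x) \<le> c"
proof -
  obtain c where c: "lq_cost Q R u x = ennreal c" "0 \<le> c"
    using fin by (cases "lq_cost Q R u x") auto
  have bound: "integral {0..t} (form u x u x) \<le> c" if t: "0 \<le> t" for t
  proof -
    have "ennreal (integral {0..t} (form u x u x)) =
        (\<integral>\<^sup>+s. ennreal (form u x u x s) * indicator {0..t} s \<partial>lborel)"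
      using nn_integral_has_integral_lebesgue'[OF form_nonneg integrable_integral[OF form_integrable_on_interval[OF adm t]]]
      by simp
    also have "\<dots> = (\<integral>\<^sup>+s. ennreal (form u x u x s) * indicator {0..t} s \<partial>lebesgue)"
      by (simp add: nn_integral_completion)
    also have "\<dots> \<le> lq_cost Q R u x"
      unfolding lq_cost_def lq_form_def
      by (intro nn_integral_mono) (auto simp: indicator_def)
    finally show ?thesis using c by simp
  qed
  have int: "form u x u x integrable_on {0..}"
    by (rule integrable_on_halfline(1)[OF form_nonneg form_integrable_on_interval[OF adm] bound])
  then have "lq_cost Q R u x = ennreal (integral {0..} (form u x u x))"
    by (intro lq_cost_eq_integral) blast
  moreover have "0 \<le> integral {0..} (form u x u x)" by (rule integral_nonneg[OF int form_nonneg])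
  ultimately have "integral {0..} (form u x u x) = c" using c by simp
  then have "(form u x u x has_integral c) {0..}" using int by (simp add: has_integral_iff)
  then show ?thesis using that c bound by blast
qed

section \<open>Completing the square\<close>

text \<open>The Riccati operator; the algebraic Riccati equation says that it vanishes at \<open>X\<close>.\<close>

definition riccati_residual :: "real^'n^'n \<Rightarrow> real^'n^'n" where
  "riccati_residual X = transpose A ** X + X ** A + Q - X ** B ** pinv R ** transpose B ** X"

definition feedback_gain :: "real^'n^'n \<Rightarrow> real^'n^'m" where
  "feedback_gain X = pinv R ** transpose B ** X"

text \<open>As \<open>R ** pinv R\<close> is the orthogonal projection onto the range of \<open>R\<close>, this says that the range of
  \<open>transpose B ** X\<close> is contained in the range of \<open>R\<close>.\<close>

definition regular :: "real^'n^'n \<Rightarrow> bool" where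
  "regular X \<longleftrightarrow> R ** pinv R ** transpose B ** X = transpose B ** X"

abbreviation defect :: "real^'n^'n \<Rightarrow> real^'n \<Rightarrow> real^'m \<Rightarrow> real" where
  "defect X x u \<equiv> (u + feedback_gain X *v x) \<bullet> (R *v (u + feedback_gain X *v x))"

lemma transpose_riccati_residual:
  assumes "transpose X = X"
  shows "transpose (riccati_residual X) = riccati_residual X"
  using assms pinv_symmetric(3)[OF sym_R]
  by (simp add: riccati_residual_def transpose_add transpose_diff matrix_transpose_mul sym_Q
      matrix_mul_assoc add.commute)

text \<open>Regularity is what allows the cross term \<open>x' X B u\<close> to be absorbed into a square in the
  \<open>R\<close>-seminorm even though \<open>R\<close> is singular.\<close>

lemma completing_the_square:
  assumes sym: "transpose X = X" and reg: "regular X"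
  shows "x \<bullet> (Q *v x) + u \<bullet> (R *v u) + 2 * (x \<bullet> (X *v (A *v x + B *v u))) =
    x \<bullet> (riccati_residual X *v x) + defect X x u"
proof -
  define g where "g = feedback_gain X *v x"
  have Rg: "R *v g = transpose B *v (X *v x)"
    using reg by (simp add: g_def feedback_gain_def regular_def matrix_vector_mul_assoc matrix_mul_assoc)
  have 1: "x \<bullet> (X *v (B *v u)) = u \<bullet> (R *v g)"
    unfolding Rg by (metis inner_commute inner_matrix_adjoint inner_matrix_sym[OF sym] transpose_transpose)
  have 2: "x \<bullet> (X ** B ** pinv R ** transpose B ** X *v x) = g \<bullet> (R *v g)"
  proof -
    have "x \<bullet> (X ** B ** pinv R ** transpose B ** X *v x) = x \<bullet> (X *v (B *v g))"
      by (simp add: g_def feedback_gain_def matrix_vector_mul_assoc matrix_mul_assoc)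
    also have "\<dots> = g \<bullet> (R *v g)"
      unfolding Rg by (metis inner_commute inner_matrix_adjoint inner_matrix_sym[OF sym] transpose_transpose)
    finally show ?thesis .
  qed
  have 3: "x \<bullet> (transpose A *v (X *v x)) = x \<bullet> (X *v (A *v x))"
    by (metis inner_commute inner_matrix_adjoint inner_matrix_sym[OF sym] transpose_transpose)
  have "x \<bullet> (riccati_residual X *v x) =
      x \<bullet> (transpose A *v (X *v x)) + x \<bullet> (X *v (A *v x)) + x \<bullet> (Q *v x) - g \<bullet> (R *v g)"
    unfolding riccati_residual_def matrix_vector_mult_diff_rdistrib matrix_vector_mult_add_rdistrib
      inner_diff_right inner_add_right 2 by (simp add: matrix_vector_mul_assoc)
  moreover have "defect X x u = u \<bullet> (R *v u) + 2 * (u \<bullet> (R *v g)) + g \<bullet> (R *v g)"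
    using inner_matrix_sym[OF sym_R, of g u]
    by (simp add: g_def[symmetric] matrix_vector_right_distrib inner_simps inner_commute)
  ultimately show ?thesis
    using 1 3 by (simp add: matrix_vector_right_distrib inner_add_right)
qed

text \<open>The integral of the completed square: by the energy identity the added term integrates to the
  change of \<open>x \<bullet> (X *v x)\<close> along the trajectory.\<close>

lemma cost_on_interval:
  assumes adm: "admissible A B x0 u x" and sym: "transpose X = X" and reg: "regular X" and t: "0 \<le> t"
  shows "((\<lambda>s. x s \<bullet> (riccati_residual X *v x s) + defect X (x s) (u s)) has_integral
    (integral {0..t} (form u x u x) + x t \<bullet> (X *v x t) - x0 \<bullet> (X *v x0))) {0..t}"
proof -
  have st: "is_state A B x0 u x" using adm by (simp add: admissible_def)
  have "((\<lambda>s. form u x u x s + 2 * (x s \<bullet> (X *v (A *v x s + B *v u s)))) has_integral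
      (integral {0..t} (form u x u x) + (x t \<bullet> (X *v x t) - x0 \<bullet> (X *v x0)))) {0..t}"
    by (intro has_integral_add integrable_integral form_integrable_on_interval[OF adm t]
        state_energy_identity[OF st sym t])
  then show ?thesis
    unfolding lq_form_def completing_the_square[OF sym reg] by (simp add: add_diff_eq)
qed

lemma cost_lower_bound:
  assumes adm: "admissible A B x0 u x" and sym: "transpose X = X" and reg: "regular X"
    and riccati: "riccati_residual X = 0"
  shows "ennreal (x0 \<bullet> (X *v x0)) \<le> lq_cost Q R u x"
proof (cases "lq_cost Q R u x = \<infinity>")
  case False
  then obtain c where c: "lq_cost Q R u x = ennreal c"
    "\<And>t. 0 \<le> t \<Longrightarrow> integral {0..t} (form u x u x) \<le> c" "0 \<le> c"
    using lq_cost_finite[OF adm] by metis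
  have le: "x0 \<bullet> (X *v x0) - x t \<bullet> (X *v x t) \<le> c" if "0 \<le> t" for t
  proof -
    have "0 \<le> integral {0..t} (form u x u x) + x t \<bullet> (X *v x t) - x0 \<bullet> (X *v x0)"
      by (rule has_integral_nonneg[OF cost_on_interval[OF adm sym reg that]])
        (use psd_R in \<open>simp add: riccati pos_semidef_def\<close>)
    then show ?thesis using c(2)[OF that] by simp
  qed
  have "((\<lambda>t. x0 \<bullet> (X *v x0) - x t \<bullet> (X *v x t)) \<longlongrightarrow> x0 \<bullet> (X *v x0) - 0) at_top"
    by (intro tendsto_diff tendsto_const terminal_energy_tendsto_0[OF adm])
  moreover have "\<forall>\<^sub>F t in at_top. x0 \<bullet> (X *v x0) - x t \<bullet> (X *v x t) \<le> c"
    using le unfolding eventually_at_top_linorder by blast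
  ultimately have "x0 \<bullet> (X *v x0) - 0 \<le> c" by (rule tendsto_upperbound) simp
  then show ?thesis by (simp add: c(1) ennreal_leI)
qed simp

lemma cost_attained:
  assumes adm: "admissible A B x0 u x" and sym: "transpose X = X" and reg: "regular X"
    and riccati: "riccati_residual X = 0" and law: "\<And>t. R *v (u t + feedback_gain X *v x t) = 0"
  shows "lq_cost Q R u x = ennreal (x0 \<bullet> (X *v x0))"
proof (rule lq_cost_eq_limit(2)[OF adm])
  have eq: "integral {0..t} (form u x u x) = x0 \<bullet> (X *v x0) - x t \<bullet> (X *v x t)" if "0 \<le> t" for t
    using cost_on_interval[OF adm sym reg that] unfolding riccati law by simp
  have "((\<lambda>t. x0 \<bullet> (X *v x0) - x t \<bullet> (X *v x t)) \<longlongrightarrow> x0 \<bullet> (X *v x0) - 0) at_top"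
    by (intro tendsto_diff tendsto_const terminal_energy_tendsto_0[OF adm])
  then have "((\<lambda>t. x0 \<bullet> (X *v x0) - x t \<bullet> (X *v x t)) \<longlongrightarrow> x0 \<bullet> (X *v x0)) at_top" by simp
  then show "((\<lambda>t. integral {0..t} (form u x u x)) \<longlongrightarrow> x0 \<bullet> (X *v x0)) at_top"
    by (rule Lim_transform_eventually)
      (use eq in \<open>auto simp: eventually_at_top_linorder intro!: exI[of _ 0]\<close>)
qed

text \<open>By the completed square no admissible control costs less than \<open>x0 \<bullet> (X *v x0)\<close>; the feedback
  satisfies \<open>R (u + feedback_gain X x) = 0\<close> along its trajectories and so attains this bound.\<close>

lemma stabilizing_solution_optimal:
  assumes sym: "transpose X = X" and reg: "regular X" and riccati: "riccati_residual X = 0"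
    and F: "R ** (F + feedback_gain X) = 0" and stable: "stable_matrix (A + B ** F)"
    and x: "is_state A B x0 (\<lambda>t. F *v x t) x"
  shows "lq_optimal A B Q R x0 (\<lambda>t. F *v x t) x"
    and "lq_value A B Q R x0 = ennreal (x0 \<bullet> (X *v x0))"
proof -
  have adm: "admissible A B x0 (\<lambda>t. F *v x t) x" by (rule stable_feedback_admissible(1)[OF stable x])
  have "R *v (F *v v + feedback_gain X *v v) = 0" for v
    using F by (simp flip: matrix_vector_mult_add_rdistrib add: matrix_vector_mul_assoc)
  then have cost: "lq_cost Q R (\<lambda>t. F *v x t) x = ennreal (x0 \<bullet> (X *v x0))"
    by (rule cost_attained[OF adm sym reg riccati])
  show "lq_optimal A B Q R x0 (\<lambda>t. F *v x t) x"
    unfolding lq_optimal_def cost using adm cost_lower_bound[OF _ sym reg riccati] by blast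
  show "lq_value A B Q R x0 = ennreal (x0 \<bullet> (X *v x0))"
    unfolding lq_value_def
  proof (rule antisym)
    show "(INF (u, x)\<in>{(u, x). admissible A B x0 u x}. lq_cost Q R u x) \<le> ennreal (x0 \<bullet> (X *v x0))"
      by (rule INF_lower2[of "(\<lambda>t. F *v x t, x)"]) (use adm cost in auto)
    show "ennreal (x0 \<bullet> (X *v x0)) \<le> (INF (u, x)\<in>{(u, x). admissible A B x0 u x}. lq_cost Q R u x)"
      by (rule INF_greatest) (use cost_lower_bound[OF _ sym reg riccati] in auto)
  qed
qed

section \<open>The value function is a quadratic form\<close>

text \<open>A stabilizing feedback makes state and control decay exponentially.\<close>

lemma finite_cost_exists:
  assumes "stabilizable A B"
  obtains u x where "finite_cost A B Q R x0 u x"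
proof -
  obtain K where K: "stable_matrix (A + B ** K)"
    using stabilizable_imp_stabilizing_feedback[OF assms] by blast
  obtain x where x: "is_state A B x0 (\<lambda>t. K *v x t) x" using feedback_state_exists by blast
  note adm = stable_feedback_admissible[OF K x]
  define u where "u = (\<lambda>t. K *v x t)"
  obtain C where C: "\<And>v. \<bar>v \<bullet> (R *v v)\<bar> \<le> C * (norm v)\<^sup>2" using quadratic_form_bound[of R] by blast
  obtain D where D: "\<And>v. \<bar>v \<bullet> (Q *v v)\<bar> \<le> D * (norm v)\<^sup>2" using quadratic_form_bound[of Q] by blast
  have "(\<lambda>t. (norm (u t))\<^sup>2) integrable_on {0..}" "(\<lambda>t. (norm (x t))\<^sup>2) integrable_on {0..}"
    using adm(2)[of K] adm(2)[of "mat 1"] by (auto simp: absolutely_integrable_on_def u_def)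
  then have bd: "(\<lambda>t. D * (norm (x t))\<^sup>2 + C * (norm (u t))\<^sup>2) integrable_on {0..}"
    by (intro integrable_add integrable_on_mult_right)
  have st: "is_state A B x0 u x" using x by (simp add: u_def)
  have "form u x u x absolutely_integrable_on {0..}"
  proof (rule measurable_bounded_by_integrable_imp_absolutely_integrable[OF form_measurable[OF st st] _ bd])
    fix t
    show "norm (form u x u x t) \<le> D * (norm (x t))\<^sup>2 + C * (norm (u t))\<^sup>2"
      using C[of "u t"] D[of "x t"] form_nonneg[of u x t] by (simp add: lq_form_def)
  qed simp
  then have "finite_cost A B Q R x0 u x"
    using adm(1) by (simp add: finite_cost_def absolutely_integrable_on_def u_def)
  then show ?thesis using that by blast
qed

lemma finite_cost_combination:
  assumes fin: "finite_cost A B Q R x0 u x" "finite_cost A B Q R y0 v y"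
  shows "finite_cost A B Q R (a *\<^sub>R x0 + b *\<^sub>R y0) (\<lambda>t. a *\<^sub>R u t + b *\<^sub>R v t) (\<lambda>t. a *\<^sub>R x t + b *\<^sub>R y t)"
proof -
  have adm: "admissible A B (a *\<^sub>R x0 + b *\<^sub>R y0) (\<lambda>t. a *\<^sub>R u t + b *\<^sub>R v t) (\<lambda>t. a *\<^sub>R x t + b *\<^sub>R y t)"
    using fin admissible_combination by (auto simp: finite_cost_def)
  then have st: "is_state A B (a *\<^sub>R x0 + b *\<^sub>R y0) (\<lambda>t. a *\<^sub>R u t + b *\<^sub>R v t) (\<lambda>t. a *\<^sub>R x t + b *\<^sub>R y t)"
    by (simp add: admissible_def)
  have bd: "(\<lambda>t. 2 * a\<^sup>2 * form u x u x t + 2 * b\<^sup>2 * form v y v y t) integrable_on {0..}"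
    using fin by (intro integrable_add integrable_on_mult_right) (auto simp: finite_cost_def)
  have "form (\<lambda>t. a *\<^sub>R u t + b *\<^sub>R v t) (\<lambda>t. a *\<^sub>R x t + b *\<^sub>R y t)
        (\<lambda>t. a *\<^sub>R u t + b *\<^sub>R v t) (\<lambda>t. a *\<^sub>R x t + b *\<^sub>R y t) absolutely_integrable_on {0..}"
  proof (rule measurable_bounded_by_integrable_imp_absolutely_integrable[OF form_measurable[OF st st] _ bd])
    fix t show "norm (form (\<lambda>t. a *\<^sub>R u t + b *\<^sub>R v t) (\<lambda>t. a *\<^sub>R x t + b *\<^sub>R y t)
        (\<lambda>t. a *\<^sub>R u t + b *\<^sub>R v t) (\<lambda>t. a *\<^sub>R x t + b *\<^sub>R y t) t)
      \<le> 2 * a\<^sup>2 * form u x u x t + 2 * b\<^sup>2 * form v y v y t"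
      unfolding real_norm_def abs_of_nonneg[OF form_nonneg] by (rule form_combination_le)
  qed simp
  then show ?thesis using adm by (simp add: finite_cost_def absolutely_integrable_on_def)
qed

text \<open>By polarization, the mixed form is a combination of three diagonal ones.\<close>

lemma form_integrable:
  assumes fin: "finite_cost A B Q R x0 u x" "finite_cost A B Q R y0 v y"
  shows "form u x v y integrable_on {0..}"
proof -
  have "(\<lambda>t. 1\<^sup>2 * form u x u x t + 2 * 1 * 1 * form u x v y t + 1\<^sup>2 * form v y v y t) integrable_on {0..}"
    using finite_cost_combination[OF fin, of 1 1] unfolding finite_cost_def form_combination[abs_def] by blast
  moreover have "form u x u x integrable_on {0..}" "form v y v y integrable_on {0..}"
    using fin by (auto simp: finite_cost_def)
  ultimately have "(\<lambda>t. (1/2) * ((1\<^sup>2 * form u x u x t + 2 * 1 * 1 * form u x v y t + 1\<^sup>2 * form v y v y t)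
      - form u x u x t - form v y v y t)) integrable_on {0..}"
    by (intro integrable_on_mult_right integrable_diff)
  then show ?thesis by simp
qed

lemma form_combination_has_integral:
  assumes fin: "finite_cost A B Q R x0 u x" "finite_cost A B Q R y0 v y"
  shows "(form (\<lambda>t. a *\<^sub>R u t + b *\<^sub>R v t) (\<lambda>t. a *\<^sub>R x t + b *\<^sub>R y t)
        (\<lambda>t. a *\<^sub>R u t + b *\<^sub>R v t) (\<lambda>t. a *\<^sub>R x t + b *\<^sub>R y t) has_integral
     (a\<^sup>2 * integral {0..} (form u x u x) + 2 * a * b * integral {0..} (form u x v y)
       + b\<^sup>2 * integral {0..} (form v y v y))) {0..}"
  unfolding form_combination[abs_def]
  by (intro has_integral_add has_integral_mult_right integrable_integral form_integrable[OF fin])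
    (use fin in \<open>auto simp: finite_cost_def\<close>)

lemma optimal_finite_cost:
  assumes stab: "stabilizable A B" and opt: "lq_optimal A B Q R x0 u x"
  shows "finite_cost A B Q R x0 u x"
proof -
  obtain v y where vy: "finite_cost A B Q R x0 v y" using finite_cost_exists[OF stab] by blast
  then have "lq_cost Q R v y = ennreal (integral {0..} (form v y v y))"
    by (intro lq_cost_eq_integral) (auto simp: finite_cost_def)
  moreover have "lq_cost Q R u x \<le> lq_cost Q R v y"
    using opt vy by (auto simp: lq_optimal_def finite_cost_def)
  ultimately have "lq_cost Q R u x \<noteq> \<infinity>" by (auto simp: top_unique)
  moreover have adm: "admissible A B x0 u x" using opt by (simp add: lq_optimal_def)
  ultimately have "\<exists>c. (form u x u x has_integral c) {0..}" using lq_cost_finite by metis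
  then show ?thesis using adm by (auto simp: finite_cost_def)
qed

text \<open>The first variation of the cost: along the line through an optimal trajectory in the direction of
  a trajectory from \<open>0\<close>, the quadratic polynomial of costs has its minimum at the optimum.\<close>

lemma optimal_orthogonal:
  assumes opt: "lq_optimal A B Q R x0 u x" and fin: "finite_cost A B Q R x0 u x"
    and w: "finite_cost A B Q R 0 v y"
  shows "integral {0..} (form u x v y) = 0"
proof -
  let ?J = "integral {0..} (form u x u x)"
  have "2 * integral {0..} (form u x v y) = 0"
  proof (rule linear_coefficient_zero)
    fix s :: real
    let ?u = "\<lambda>t. 1 *\<^sub>R u t + s *\<^sub>R v t" and ?x = "\<lambda>t. 1 *\<^sub>R x t + s *\<^sub>R y t"
    let ?S = "1\<^sup>2 * ?J + 2 * 1 * s * integral {0..} (form u x v y) + s\<^sup>2 * integral {0..} (form v y v y)"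
    have I: "(form ?u ?x ?u ?x has_integral ?S) {0..}" by (rule form_combination_has_integral[OF fin w])
    have "admissible A B (1 *\<^sub>R x0 + s *\<^sub>R 0) ?u ?x"
      using finite_cost_combination[OF fin w] by (simp only: finite_cost_def)
    then have "lq_cost Q R u x \<le> lq_cost Q R ?u ?x"
      using opt unfolding lq_optimal_def scaleR_one scaleR_zero_right add_0_right by blast
    moreover have "lq_cost Q R ?u ?x = ennreal ?S" by (rule lq_cost_eq_integral[OF I])
    moreover have "lq_cost Q R u x = ennreal ?J"
      by (rule lq_cost_eq_integral) (use fin in \<open>auto simp: finite_cost_def\<close>)
    moreover have "0 \<le> ?S" by (rule has_integral_nonneg[OF I form_nonneg])
    ultimately have "?J \<le> ?S" by (simp add: ennreal_le_iff)
    then show "0 \<le> s * (2 * integral {0..} (form u x v y)) + s\<^sup>2 * integral {0..} (form v y v y)"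
      by simp
  qed
  then show ?thesis by simp
qed

lemma finite_cost_sum:
  fixes c :: "'k \<Rightarrow> real"
  assumes "finite S" and fin: "\<And>i. finite_cost A B Q R (z i) (U i) (Y i)"
  shows "finite_cost A B Q R (\<Sum>i\<in>S. c i *\<^sub>R z i) (\<lambda>t. \<Sum>i\<in>S. c i *\<^sub>R U i t) (\<lambda>t. \<Sum>i\<in>S. c i *\<^sub>R Y i t)"
  using \<open>finite S\<close>
proof (induction S)
  case empty
  then show ?case using finite_cost_combination[OF fin fin, of 0 undefined 0 undefined] by simp
next
  case (insert j S)
  then show ?case using finite_cost_combination[OF fin[of j] insert.IH, of "c j" 1] by simp
qed

lemma form_sum_left:
  "form (\<lambda>t. \<Sum>i\<in>S. c i *\<^sub>R U i t) (\<lambda>t. \<Sum>i\<in>S. c i *\<^sub>R Y i t) v y t = (\<Sum>i\<in>S. c i * form (U i) (Y i) v y t)"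
  by (simp add: lq_form_def inner_sum_left sum.distrib distrib_left)

lemma form_sum_right:
  "form v y (\<lambda>t. \<Sum>i\<in>S. c i *\<^sub>R U i t) (\<lambda>t. \<Sum>i\<in>S. c i *\<^sub>R Y i t) t = (\<Sum>i\<in>S. c i * form v y (U i) (Y i) t)"
  unfolding form_sym[of v] form_sum_left by simp

text \<open>Orthogonality to all trajectories from \<open>0\<close> characterizes optimality and is a linear condition.
  Hence linear combinations of optimal trajectories that start in the unit vectors are optimal, and
  the value of \<open>c\<close> is the quadratic form of the Gram matrix \<open>X\<close> of these trajectories at \<open>c\<close>.\<close>

lemma value_matrix:
  assumes stab: "stabilizable A B" and ex: "\<And>x0. \<exists>u x. lq_optimal A B Q R x0 u x"
  obtains X where "pos_semidef X"
    "\<And>x0 u x. lq_optimal A B Q R x0 u x \<Longrightarrow> (form u x u x has_integral (x0 \<bullet> (X *v x0))) {0..}"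
proof -
  have "\<forall>i::'n. \<exists>p. lq_optimal A B Q R (axis i 1) (fst p) (snd p)" using ex by simp
  then obtain p where p: "\<And>i::'n. lq_optimal A B Q R (axis i 1) (fst (p i)) (snd (p i))"
    using choice[of "\<lambda>i p. lq_optimal A B Q R (axis i 1) (fst p) (snd p)"] by blast
  define U where "U i = fst (p i)" for i
  define Y where "Y i = snd (p i)" for i
  have opt: "lq_optimal A B Q R (axis i 1) (U i) (Y i)" for i using p by (simp add: U_def Y_def)
  have fin: "finite_cost A B Q R (axis i 1) (U i) (Y i)" for i by (rule optimal_finite_cost[OF stab opt])
  define X :: "real^'n^'n" where "X = (\<chi> i j. integral {0..} (form (U i) (Y i) (U j) (Y j)))"
  define Uc where "Uc c t = (\<Sum>i\<in>UNIV. c $ i *\<^sub>R U i t)" for c :: "real^'n" and t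
  define Yc where "Yc c t = (\<Sum>i\<in>UNIV. c $ i *\<^sub>R Y i t)" for c :: "real^'n" and t
  have finc: "finite_cost A B Q R c (Uc c) (Yc c)" for c
  proof -
    have e: "(\<Sum>i\<in>UNIV. c $ i *\<^sub>R axis i 1) = c"
      using basis_expansion[of c] by (simp only: scalar_mult_eq_scaleR)
    then show ?thesis
      using finite_cost_sum[where S = UNIV and c = "\<lambda>i. c $ i" and U = U and Y = Y, OF finite fin]
      unfolding Uc_def[abs_def] Yc_def[abs_def] e by blast
  qed
  have orth: "integral {0..} (form (Uc c) (Yc c) v y) = 0" if w: "finite_cost A B Q R 0 v y" for c v y
  proof -
    have "(form (Uc c) (Yc c) v y has_integral (\<Sum>i\<in>UNIV. c $ i * 0)) {0..}"
      unfolding Uc_def[abs_def] Yc_def[abs_def] form_sum_left[abs_def]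
    proof (intro has_integral_sum has_integral_mult_right)
      fix i show "(form (U i) (Y i) v y has_integral 0) {0..}"
        using form_integrable[OF fin w] optimal_orthogonal[OF opt fin w] by (simp add: has_integral_iff)
    qed simp
    then show ?thesis by (simp add: integral_unique)
  qed
  have Jc: "(form (Uc c) (Yc c) (Uc c) (Yc c) has_integral (c \<bullet> (X *v c))) {0..}" for c
  proof -
    have "(form (Uc c) (Yc c) (Uc c) (Yc c) has_integral
        (\<Sum>i\<in>UNIV. c $ i * (\<Sum>j\<in>UNIV. c $ j * X $ i $ j))) {0..}"
      unfolding Uc_def[abs_def] Yc_def[abs_def] form_sum_left[abs_def] form_sum_right
      by (intro has_integral_sum has_integral_mult_right)
        (use form_integrable[OF fin fin] in \<open>auto simp: X_def has_integral_iff\<close>)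
    then show ?thesis by (simp add: inner_vec_def matrix_vector_mult_def mult.commute)
  qed
  have "pos_semidef X"
    unfolding pos_semidef_def
  proof (intro conjI allI)
    have "form (U i) (Y i) (U j) (Y j) = form (U j) (Y j) (U i) (Y i)" for i j
      by (rule ext) (rule form_sym)
    then have "X $ j $ i = X $ i $ j" for i j unfolding X_def vec_lambda_beta by metis
    then show "transpose X = X" by (simp add: transpose_def vec_eq_iff)
    show "0 \<le> c \<bullet> (X *v c)" for c by (rule has_integral_nonneg[OF Jc form_nonneg])
  qed
  moreover have "(form u x u x has_integral (c \<bullet> (X *v c))) {0..}" if o: "lq_optimal A B Q R c u x" for c u x
  proof -
    have f: "finite_cost A B Q R c u x" by (rule optimal_finite_cost[OF stab o])
    define v where "v t = 1 *\<^sub>R u t + (- 1) *\<^sub>R Uc c t" for t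
    define y where "y t = 1 *\<^sub>R x t + (- 1) *\<^sub>R Yc c t" for t
    have w: "finite_cost A B Q R 0 v y"
      using finite_cost_combination[OF f finc, of 1 "- 1" c] unfolding v_def[abs_def] y_def[abs_def] by simp
    \<comment> \<open>Split an optimal trajectory into the combination and a remainder that starts in \<open>0\<close>.\<close>
    have ux: "u = (\<lambda>t. 1 *\<^sub>R Uc c t + 1 *\<^sub>R v t)" "x = (\<lambda>t. 1 *\<^sub>R Yc c t + 1 *\<^sub>R y t)"
      by (auto simp: v_def y_def)
    have "integral {0..} (form u x u x) = integral {0..} (form (Uc c) (Yc c) (Uc c) (Yc c)) +
        integral {0..} (form v y v y)"
      using form_combination_has_integral[OF finc[of c] w, of 1 1] unfolding ux[symmetric]
      by (simp add: orth[OF w] integral_unique)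
    moreover have "0 \<le> integral {0..} (form v y v y)"
      by (rule integral_nonneg) (use w form_nonneg in \<open>auto simp: finite_cost_def\<close>)
    moreover have "integral {0..} (form (Uc c) (Yc c) (Uc c) (Yc c)) = c \<bullet> (X *v c)"
      using Jc by (rule integral_unique)
    moreover have "integral {0..} (form u x u x) \<le> c \<bullet> (X *v c)"
    proof -
      have "lq_cost Q R u x \<le> lq_cost Q R (Uc c) (Yc c)"
        using o finc by (auto simp: lq_optimal_def finite_cost_def)
      also have "\<dots> = ennreal (c \<bullet> (X *v c))" by (rule lq_cost_eq_integral[OF Jc])
      also have "lq_cost Q R u x = ennreal (integral {0..} (form u x u x))"
        by (rule lq_cost_eq_integral) (use f in \<open>auto simp: finite_cost_def\<close>)
      finally show ?thesis
        using \<open>pos_semidef X\<close> by (simp add: ennreal_le_iff pos_semidef_def)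
    qed
    ultimately have "integral {0..} (form u x u x) = c \<bullet> (X *v c)" by linarith
    then show ?thesis using f by (simp add: finite_cost_def has_integral_iff)
  qed
  ultimately show ?thesis using that by blast
qed

section \<open>Dynamic programming and necessity\<close>

text \<open>Compare with the control that follows \<open>u\<close> up to time \<open>h\<close> and continues optimally from the state
  reached.\<close>

lemma dynamic_programming:
  assumes lower: "\<And>v y. admissible A B x0 v y \<Longrightarrow> ennreal (x0 \<bullet> (X *v x0)) \<le> lq_cost Q R v y"
    and tail: "admissible A B (x h) v y" "(form v y v y has_integral (x h \<bullet> (X *v x h))) {0..}"
    and x: "is_state A B x0 u x" "(\<lambda>t. (norm (u t))\<^sup>2) integrable_on {0..h}"
      "form u x u x integrable_on {0..h}"
    and h: "0 \<le> h"
  shows "x0 \<bullet> (X *v x0) \<le> integral {0..h} (form u x u x) + x h \<bullet> (X *v x h)"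
proof -
  let ?u = "glue h u v" and ?x = "glue h x y"
  have adm: "admissible A B x0 ?u ?x" by (rule admissible_glue[OF x(1,2) tail(1) h])
  have eq: "form ?u ?x ?u ?x = glue h (form u x u x) (form v y v y)"
    by (auto simp: glue_def lq_form_def fun_eq_iff)
  note le = integral_halfline_glue_le[OF x(3) form_nonneg tail(2) form_nonneg h, folded eq]
  have "ennreal (x0 \<bullet> (X *v x0)) \<le> lq_cost Q R ?u ?x" by (rule lower[OF adm])
  also have "\<dots> = ennreal (integral {0..} (form ?u ?x ?u ?x))"
    by (rule lq_cost_eq_integral[OF integrable_integral[OF le(1)]])
  finally have "x0 \<bullet> (X *v x0) \<le> integral {0..} (form ?u ?x ?u ?x)"
    using integral_nonneg[OF le(1) form_nonneg] by (simp add: ennreal_le_iff)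
  with le(2) show ?thesis by simp
qed

text \<open>The infinitesimal form of dynamic programming. The given control value \<open>u0\<close> is realized at time \<open>0\<close>
  by a rank-one feedback, whose trajectories are continuously differentiable; by dynamic programming
  the integral of the right-hand side along such a trajectory over \<open>{0..h}\<close> is nonnegative for
  every \<open>h\<close>.\<close>

lemma dissipation_inequality:
  assumes lower: "\<And>x0 v y. admissible A B x0 v y \<Longrightarrow> ennreal (x0 \<bullet> (X *v x0)) \<le> lq_cost Q R v y"
    and attained: "\<And>x0. \<exists>v y. admissible A B x0 v y \<and> (form v y v y has_integral (x0 \<bullet> (X *v x0))) {0..}"
    and psd: "pos_semidef X"
  shows "0 \<le> x0 \<bullet> (Q *v x0) + u0 \<bullet> (R *v u0) + 2 * (x0 \<bullet> (X *v (A *v x0 + B *v u0)))"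
proof (cases "x0 = 0")
  case True
  then show ?thesis using psd_R by (simp add: pos_semidef_def)
next
  case False
  have sym: "transpose X = X" using psd by (simp add: pos_semidef_def)
  define F where "F = outer ((1 / (x0 \<bullet> x0)) *\<^sub>R u0) x0"
  have F: "F *v x0 = u0" using False by (simp add: F_def outer_vector)
  obtain x where x: "is_state A B x0 (\<lambda>t. F *v x t) x" "continuous_on UNIV x"
    using feedback_state_exists by blast
  define u where "u = (\<lambda>t. F *v x t)"
  have contx: "continuous_on S x" for S using x(2) continuous_on_subset by blast
  have contN: "continuous_on S (\<lambda>t. N *v x t)" for S and N :: "real^'n^'k"
    by (rule linear_continuous_on_compose[OF contx]) auto
  have contu: "continuous_on S u" for S unfolding u_def by (rule contN)
  have contR: "continuous_on S (\<lambda>t. N *v u t)" for S and N :: "real^'m^'k"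
    by (rule linear_continuous_on_compose[OF contu]) auto
  define k where "k t = form u x u x t + 2 * (x t \<bullet> (X *v (A *v x t + B *v u t)))" for t
  have contf: "continuous_on S (form u x u x)" for S
    unfolding lq_form_def[abs_def] by (intro continuous_on_add continuous_on_inner contx contu contN contR)
  have contk: "continuous_on S k" for S
    unfolding k_def[abs_def] matrix_vector_right_distrib matrix_vector_mul_assoc
    by (intro continuous_intros contf contx contN contR)
  have kint: "0 \<le> integral {0..h} k" if h: "0 \<le> h" for h
  proof -
    have fi: "form u x u x integrable_on {0..h}" by (intro integrable_continuous_real contf)
    have st: "is_state A B x0 u x" using x(1) by (simp add: u_def)
    have "(k has_integral (integral {0..h} (form u x u x) + (x h \<bullet> (X *v x h) - x0 \<bullet> (X *v x0)))) {0..h}"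
      unfolding k_def[abs_def]
      by (intro has_integral_add integrable_integral fi state_energy_identity[OF st sym h])
    moreover have "x0 \<bullet> (X *v x0) \<le> integral {0..h} (form u x u x) + x h \<bullet> (X *v x h)"
    proof -
      obtain v y where vy: "admissible A B (x h) v y" "(form v y v y has_integral (x h \<bullet> (X *v x h))) {0..}"
        using attained by blast
      show ?thesis
      proof (rule dynamic_programming[OF _ vy st _ fi h])
        show "ennreal (x0 \<bullet> (X *v x0)) \<le> lq_cost Q R v y" if "admissible A B x0 v y" for v y
          using that by (rule lower)
        show "(\<lambda>t. (norm (u t))\<^sup>2) integrable_on {0..h}"
          by (intro integrable_continuous_real continuous_intros contu)
      qed
    qed
    ultimately show ?thesis by (simp add: integral_unique)
  qed
  have "0 \<le> k 0"
  proof (rule ccontr)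
    assume neg: "\<not> 0 \<le> k 0"
    have "((\<lambda>h. integral {0..h} k) has_real_derivative k 0) (at 0 within {0..1})"
      by (rule integral_has_real_derivative[OF contk]) simp
    then obtain d where d: "d > 0" "\<And>h. 0 < h \<Longrightarrow> 0 + h \<in> {0..1} \<Longrightarrow> h < d \<Longrightarrow>
        integral {0..0 + h} k < integral {0..0} k"
      using has_real_derivative_neg_dec_right[of "\<lambda>h. integral {0..h} k" "k 0" 0 "{0..1}"] neg by force
    define h where "h = min (d / 2) 1"
    have "integral {0..h} k < 0" using d(2)[of h] d(1) by (simp add: h_def)
    moreover have "0 \<le> h" using d(1) by (simp add: h_def)
    ultimately show False using kint[of h] by simp
  qed
  then show ?thesis using F by (simp add: k_def lq_form_def u_def state_at_0[OF x(1)])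
qed

text \<open>The range of the symmetric matrix \<open>R\<close> is the orthogonal complement of its kernel.\<close>

lemma regular_if_range_condition:
  assumes sym: "transpose X = X" and orth: "\<And>w x. R *v w = 0 \<Longrightarrow> x \<bullet> (X *v (B *v w)) = 0"
  shows "regular X"
proof -
  let ?N = "mat 1 - R ** pinv R"
  have RN: "R ** ?N = 0"
    using pinv_symmetric(1,4)[OF sym_R] by (simp add: matrix_mult_diff_right matrix_mul_assoc)
  have tN: "transpose ?N = ?N"
    using pinv_symmetric(3,4)[OF sym_R] sym_R
    by (simp only: transpose_diff matrix_transpose_mul transpose_mat)
  have "w \<bullet> (?N *v (transpose B *v (X *v x))) = 0" for w x
  proof -
    have "R *v (?N *v w) = 0" by (simp only: matrix_vector_mul_assoc RN matrix_vector_mult_0)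
    then have "x \<bullet> (X *v (B *v (?N *v w))) = 0" by (rule orth)
    then show ?thesis
      by (metis inner_commute inner_matrix_adjoint inner_matrix_sym[OF sym] inner_matrix_sym[OF tN] transpose_transpose)
  qed
  then have "?N *v (transpose B *v (X *v x)) = 0" for x by (metis inner_eq_zero_iff)
  then have "?N ** (transpose B ** X) = 0" by (simp add: matrix_eq flip: matrix_vector_mul_assoc)
  then show ?thesis by (simp add: regular_def matrix_mult_diff_left matrix_mul_assoc)
qed

text \<open>For \<open>w\<close> in the kernel of \<open>R\<close> the inequality is affine in the multiple of \<open>w\<close> used as control.\<close>

lemma regular_if_dissipative:
  assumes sym: "transpose X = X"
    and diss: "\<And>x u. 0 \<le> x \<bullet> (Q *v x) + u \<bullet> (R *v u) + 2 * (x \<bullet> (X *v (A *v x + B *v u)))"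
  shows "regular X"
proof (rule regular_if_range_condition[OF sym])
  fix w x assume w: "R *v w = 0"
  have "2 * (x \<bullet> (X *v (B *v w))) = 0"
  proof (rule linear_lower_bounded_zero)
    fix s :: real
    show "0 \<le> (x \<bullet> (Q *v x) + 2 * (x \<bullet> (X *v (A *v x)))) + s * (2 * (x \<bullet> (X *v (B *v w))))"
      using diss[of x "s *\<^sub>R w"]
      by (simp add: w matrix_vector_mult_scaleR matrix_vector_right_distrib inner_add_right)
  qed
  then show "x \<bullet> (X *v (B *v w)) = 0" by simp
qed

text \<open>Choose the control that makes the completed square vanish.\<close>

lemma residual_nonneg_if_dissipative:
  assumes sym: "transpose X = X"
    and diss: "\<And>x u. 0 \<le> x \<bullet> (Q *v x) + u \<bullet> (R *v u) + 2 * (x \<bullet> (X *v (A *v x + B *v u)))"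
  shows "0 \<le> x \<bullet> (riccati_residual X *v x)"
  using diss[of x "- (feedback_gain X *v x)"]
  unfolding completing_the_square[OF sym regular_if_dissipative[OF sym diss]] by simp

text \<open>In the completed square the two integrands are nonnegative, while an optimal trajectory has cost
  exactly \<open>x0 \<bullet> (X *v x0)\<close>. So the integral of their sum over \<open>{0..s}\<close> is at most \<open>x s \<bullet> (X *v x s)\<close>,
  which tends to \<open>0\<close>, and both integrals vanish.\<close>

lemma optimal_synthesis:
  assumes psd: "pos_semidef X" and reg: "regular X"
    and residual: "\<And>x. 0 \<le> x \<bullet> (riccati_residual X *v x)"
    and adm: "admissible A B x0 u x" and cost: "(form u x u x has_integral (x0 \<bullet> (X *v x0))) {0..}"
  shows "x0 \<bullet> (riccati_residual X *v x0) = 0"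
    and "0 \<le> t \<Longrightarrow> ((\<lambda>s. defect X (x s) (u s)) has_integral 0) {0..t}"
proof -
  have sym: "transpose X = X" using psd by (simp add: pos_semidef_def)
  have st: "is_state A B x0 u x" using adm by (simp add: admissible_def)
  let ?M = "riccati_residual X"
  define r where "r s = x s \<bullet> (?M *v x s)" for s
  define e where "e s = defect X (x s) (u s)" for s
  have contx: "continuous_on {0..t} x" for t
    by (rule continuous_on_subset[OF continuous_on_state[OF st]]) auto
  have contr: "continuous_on {0..t} r" for t
    unfolding r_def[abs_def]
    by (intro continuous_on_inner contx linear_continuous_on_compose[OF contx]) auto
  have r0: "0 \<le> r s" for s using residual by (simp add: r_def)
  have e0: "0 \<le> e s" for s using psd_R by (simp add: e_def pos_semidef_def)
  have ri: "r integrable_on {0..t}" for t by (intro integrable_continuous_real contr)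
  have sum: "((\<lambda>s. r s + e s) has_integral
      (integral {0..t} (form u x u x) + x t \<bullet> (X *v x t) - x0 \<bullet> (X *v x0))) {0..t}" if "0 \<le> t" for t
    unfolding r_def e_def by (rule cost_on_interval[OF adm sym reg that])
  have si: "(\<lambda>s. r s + e s) integrable_on {0..t}" if "0 \<le> t" for t using sum[OF that] by blast
  have bound: "integral {0..t} (\<lambda>s. r s + e s) \<le> x t \<bullet> (X *v x t)" if "0 \<le> t" for t
  proof -
    have "integral {0..t} (form u x u x) \<le> integral {0..} (form u x u x)"
      by (rule integral_subset_le) (use cost form_nonneg form_integrable_on_interval[OF adm that] in auto)
    also have "\<dots> = x0 \<bullet> (X *v x0)" using cost by (rule integral_unique)
    finally show ?thesis using integral_unique[OF sum[OF that]] by simp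
  qed
  have zero: "integral {0..t} (\<lambda>s. r s + e s) = 0" if t: "0 \<le> t" for t
  \<comment> \<open>The integral is monotone in \<open>t\<close> and bounded by an energy that tends to \<open>0\<close>.\<close>
  proof (rule antisym)
    show "0 \<le> integral {0..t} (\<lambda>s. r s + e s)"
      by (rule integral_nonneg[OF si[OF t]]) (use r0 e0 in simp)
    have "integral {0..t} (\<lambda>s. r s + e s) \<le> x s \<bullet> (X *v x s)" if s: "t \<le> s" for s
    proof -
      have "integral {0..t} (\<lambda>s. r s + e s) \<le> integral {0..s} (\<lambda>s. r s + e s)"
        by (rule integral_subset_le) (use s t si r0 e0 in auto)
      also have "\<dots> \<le> x s \<bullet> (X *v x s)" by (rule bound) (use s t in simp)
      finally show ?thesis .
    qed
    then have "\<forall>\<^sub>F s in at_top. integral {0..t} (\<lambda>s. r s + e s) \<le> x s \<bullet> (X *v x s)"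
      unfolding eventually_at_top_linorder by blast
    then show "integral {0..t} (\<lambda>s. r s + e s) \<le> 0"
      by (rule tendsto_lowerbound[OF terminal_energy_tendsto_0[OF adm]]) simp
  qed
  have ez: "integral {0..t} r = 0 \<and> (e has_integral 0) {0..t}" if t: "0 \<le> t" for t
  proof -
    have ei: "e integrable_on {0..t}"
      using integrable_diff[OF si[OF t] ri[of t]] by simp
    have "integral {0..t} r + integral {0..t} e = 0"
      using zero[OF t] Henstock_Kurzweil_Integration.integral_add[OF ri ei] by simp
    moreover have "0 \<le> integral {0..t} r" "0 \<le> integral {0..t} e"
      by (auto intro!: integral_nonneg ri ei r0 e0)
    ultimately show ?thesis using ei by (simp add: has_integral_iff)
  qed
  show "((\<lambda>s. defect X (x s) (u s)) has_integral 0) {0..t}" if "0 \<le> t"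
    using ez[OF that] by (simp add: e_def[abs_def])
  have "\<forall>s\<in>{0..1}. r s = 0"
    using ez[of 1] integral_eq_0_iff[OF contr, of 1] r0 by simp
  then have "r 0 = 0" by simp
  then show "x0 \<bullet> (?M *v x0) = 0" by (simp add: r_def state_at_0[OF st])
qed

text \<open>The value matrix is the required solution of the Riccati equation, and the optimal trajectories
  supply the stabilizing open-loop controls.\<close>

lemma optimality_necessary:
  assumes ex: "\<And>x0. \<exists>u x. lq_optimal A B Q R x0 u x"
  obtains X where "pos_semidef X" "regular X" "riccati_residual X = 0"
    "\<And>x0. \<exists>u x. is_state A B x0 u x \<and> (x \<longlongrightarrow> 0) at_top \<and>
       (\<forall>t\<ge>0. ((\<lambda>s. defect X (x s) (u s)) has_integral 0) {0..t})"
proof -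
  have stab: "stabilizable A B"
    unfolding stabilizable_def using ex unfolding lq_optimal_def admissible_def by blast
  obtain X where X: "pos_semidef X"
    "\<And>x0 u x. lq_optimal A B Q R x0 u x \<Longrightarrow> (form u x u x has_integral (x0 \<bullet> (X *v x0))) {0..}"
    by (rule value_matrix[OF stab ex]) blast
  have sym: "transpose X = X" using X(1) by (simp add: pos_semidef_def)
  have attained: "\<exists>v y. admissible A B x0 v y \<and> (form v y v y has_integral (x0 \<bullet> (X *v x0))) {0..}" for x0
    using ex[of x0] X(2) unfolding lq_optimal_def by blast
  have lower: "ennreal (x0 \<bullet> (X *v x0)) \<le> lq_cost Q R v y" if vy: "admissible A B x0 v y" for x0 v y
  proof -
    obtain u x where o: "lq_optimal A B Q R x0 u x" using ex by blast
    then have "lq_cost Q R u x = ennreal (x0 \<bullet> (X *v x0))" using lq_cost_eq_integral X(2) by blast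
    then show ?thesis using o vy by (auto simp: lq_optimal_def)
  qed
  note diss = dissipation_inequality[OF lower attained X(1)]
  have reg: "regular X" by (rule regular_if_dissipative[OF sym diss])
  have res: "0 \<le> x \<bullet> (riccati_residual X *v x)" for x
    by (rule residual_nonneg_if_dissipative[OF sym diss])
  have zero: "riccati_residual X = 0"
  proof (rule symmetric_form_zero[OF transpose_riccati_residual[OF sym]])
    fix x0 obtain u x where "admissible A B x0 u x" "(form u x u x has_integral (x0 \<bullet> (X *v x0))) {0..}"
      using attained by blast
    then show "x0 \<bullet> (riccati_residual X *v x0) = 0" by (rule optimal_synthesis(1)[OF X(1) reg res])
  qed
  have "\<exists>u x. is_state A B x0 u x \<and> (x \<longlongrightarrow> 0) at_top \<and>
       (\<forall>t\<ge>0. ((\<lambda>s. defect X (x s) (u s)) has_integral 0) {0..t})" for x0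
  proof -
    obtain u x where ux: "admissible A B x0 u x" "(form u x u x has_integral (x0 \<bullet> (X *v x0))) {0..}"
      using attained by blast
    then show ?thesis using optimal_synthesis(2)[OF X(1) reg res ux] by (auto simp: admissible_def)
  qed
  then show ?thesis using that X(1) reg zero by blast
qed

end

section \<open>The kernel of the control weight\<close>

lemma inj_last_index:
  assumes "CARD('k) \<le> CARD('m)"
  shows "inj (last_index :: 'k::{finite,linorder} \<Rightarrow> 'm::{finite,linorder})"
proof (rule injI)
  fix i j :: 'k
  let ?xs = "sorted_list_of_set (UNIV :: 'm set)" and ?n = "\<lambda>j::'k. CARD('m) - CARD('k) + card {i. i < j}"
  assume "(last_index i :: 'm) = last_index j"
  moreover have "?n j < length ?xs" for j :: 'k
  proof -
    have "card {i. i < j} < CARD('k)" by (rule psubset_card_mono) auto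
    then show ?thesis using assms by simp
  qed
  ultimately have "?n i = ?n j"
    unfolding last_index_def by (simp only: nth_eq_iff_index_eq[OF distinct_sorted_list_of_set])
  then have c: "card {k. k < i} = card {k. k < j}" by simp
  have "card {k. k < i} < card {k. k < j}" if "i < j" for i j :: 'k
    by (rule psubset_card_mono) (use that in auto)
  then show "i = j" using c by (metis less_irrefl neqE)
qed

lemma last_cols_mult: "last_cols (C ** D) = C ** last_cols D"
  by (simp add: last_cols_def matrix_matrix_mult_def vec_eq_iff)

lemma last_cols_mult_zero_above:
  fixes S :: "real^('m::{finite,linorder})^'n" and Y :: "real^'p^('k::{finite,linorder})"
  assumes "CARD('k) \<le> CARD('m)" and Z: "is_zero_above Z Y"
  shows "S ** Z = last_cols S ** Y"
proof -
  have "(\<Sum>i\<in>UNIV. S $ a $ i * Z $ i $ b) = (\<Sum>j\<in>UNIV. S $ a $ last_index j * Y $ j $ b)" for a b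
  proof -
    have "(\<Sum>i\<in>UNIV. S $ a $ i * Z $ i $ b) =
        (\<Sum>i\<in>range (last_index :: 'k \<Rightarrow> 'm). S $ a $ i * Z $ i $ b)"
      using Z by (intro sum.mono_neutral_right) (auto simp: is_zero_above_def)
    also have "\<dots> = (\<Sum>j\<in>UNIV. S $ a $ last_index j * Z $ (last_index (j::'k)) $ b)"
      by (simp add: sum.reindex[OF inj_last_index[OF assms(1)]])
    finally show ?thesis using Z by (simp add: is_zero_above_def)
  qed
  then show ?thesis by (simp add: last_cols_def matrix_matrix_mult_def vec_eq_iff)
qed

text \<open>The columns of \<open>G0\<close> span the kernel of \<open>R\<close>: the projection onto the kernel factors as
  \<open>G0 ** Y\<close>, and \<open>Y\<close> is surjective because its rows are independent. As the projection fixes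
  \<open>G0\<close>, the column selections in \<^const>\<open>lq_B0\<close> and \<^const>\<open>lq_C0\<close> reduce to products with \<open>G0\<close>.\<close>

lemma kernel_parametrization:
  fixes R T0 :: "real^('m::{finite,linorder})^('m::{finite,linorder})"
    and Y :: "real^('m::{finite,linorder})^('k::{finite,linorder})"
    and B :: "real^('m::{finite,linorder})^'n" and P :: "real^'n^'n"
    and G0 :: "real^('k::{finite,linorder})^('m::{finite,linorder})"
  assumes G0: "G0 = lq_G0 T0" and sym: "transpose R = R" and card: "CARD('k) \<le> CARD('m)" and T0: "invertible T0"
    and Y: "is_zero_above (T0 ** (mat 1 - pinv R ** R)) Y" "rank Y = CARD('k)"
  shows "mat 1 - pinv R ** R = G0 ** Y" "R ** G0 = 0" "lq_B0 B R T0 = B ** G0"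
    "lq_C0 B R T0 P = transpose (P ** B ** G0)"
proof -
  let ?N = "mat 1 - pinv R ** R"
  have inv: "matrix_inv T0 ** T0 = mat 1" by (rule matrix_inv_mult_left[OF T0])
  have "?N = matrix_inv T0 ** (T0 ** ?N)" by (simp add: matrix_mul_assoc inv)
  also have "\<dots> = G0 ** Y"
    unfolding G0 lq_G0_def by (rule last_cols_mult_zero_above[OF card Y(1)])
  finally show N: "?N = G0 ** Y" .
  have RN: "R ** ?N = 0"
    using pinv_symmetric(1)[OF sym] by (simp add: matrix_mult_diff_right matrix_mul_assoc)
  have "surj ((*v) Y)" using Y(2) full_rank_surjective[of Y] by simp
  then have surj: "\<exists>v. w = Y *v v" for w by (rule surjD)
  have "R *v (G0 *v w) = 0" for w
  proof -
    obtain v where w: "w = Y *v v" using surj by blast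
    have "R *v (G0 *v w) = (R ** ?N) *v v" unfolding w N by (simp add: matrix_vector_mul_assoc matrix_mul_assoc)
    then show ?thesis by (simp add: RN)
  qed
  then show RG: "R ** G0 = 0" by (simp add: matrix_eq flip: matrix_vector_mul_assoc)
  have NG: "?N ** G0 = G0" using RG by (simp add: matrix_mult_diff_left flip: matrix_mul_assoc)
  have last: "last_cols (matrix_inv T0) = G0" by (simp add: G0 lq_G0_def)
  show "lq_B0 B R T0 = B ** G0"
    unfolding lq_B0_def last_cols_mult last using NG by (simp flip: matrix_mul_assoc)
  show "lq_C0 B R T0 P = transpose (P ** B ** G0)"
    unfolding lq_C0_def last_cols_mult last using NG by (simp flip: matrix_mul_assoc)
qed

section \<open>Solvability of the irregular problem\<close>

theorem theorem6:
  fixes A Q H :: "real^'n^'n"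
    and B :: "real^('m::{finite,linorder})^'n"
    and R T0 :: "real^('m::{finite,linorder})^('m::{finite,linorder})"
    and Upsilon :: "real^('m::{finite,linorder})^('k::{finite,linorder})"
    and G0 :: "real^('k::{finite,linorder})^('m::{finite,linorder})"
    and B0 :: "real^('k::{finite,linorder})^'n"
    and Pt :: "real \<Rightarrow> real^'n^'n"
    and t0 T :: real
  assumes "pos_semidef Q" and "pos_semidef R" and "pos_semidef H"
    and "rank R < CARD('m)" and "CARD('k) = CARD('m) - rank R"
    and "invertible T0"
    and "is_zero_above (T0 ** (mat 1 - pinv R ** R)) Upsilon"
    and "rank Upsilon = CARD('k)"
    and "G0 = lq_G0 T0" and "B0 = lq_B0 B R T0"
    and "t0 < T"
    and "riccati_ode_solution A B Q R H t0 T Pt"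
    and "irregular B R t0 T Pt"
  shows "((\<forall>x0. \<exists>u x. lq_optimal A B Q R x0 u x) \<longleftrightarrow>
            (\<exists>P P1. solvability_conditions A B Q R T0 B0 P P1)) \<and>
         (\<forall>P P1. solvability_conditions A B Q R T0 B0 P P1 \<longrightarrow>
            (\<exists>K. stable_matrix (lq_A0 A B R P + lq_D0 B R ** P1 + B0 ** K)) \<and>
            (\<forall>K F. stable_matrix (lq_A0 A B R P + lq_D0 B R ** P1 + B0 ** K) \<and>
                   F = - (pinv R ** transpose B ** (P + P1)) + G0 ** K \<longrightarrow>
               (\<forall>x0. (\<exists>x. is_state A B x0 (\<lambda>t. F *v x t) x) \<and>
                      (\<forall>x. is_state A B x0 (\<lambda>t. F *v x t) x \<longrightarrow>
                             lq_optimal A B Q R x0 (\<lambda>t. F *v x t) x))) \<and>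
            (\<forall>x0. lq_value A B Q R x0 = ennreal (x0 \<bullet> ((P + P1) *v x0))))"
    (is "(?solvable \<longleftrightarrow> ?conditions) \<and> ?synthesis")
proof -
  interpret lq_problem A B Q R using assms by unfold_locales
  have card: "CARD('k) \<le> CARD('m)" using assms by simp
  note ker = kernel_parametrization[OF assms(9) sym_R card assms(6-8)]
  have N: "mat 1 - pinv R ** R = G0 ** Upsilon" and RG: "R ** G0 = 0" by (rule ker)+
  have B0: "B0 = B ** G0" using assms(10) ker(3) by simp
  have ker_R: "G0 *v (Upsilon *v w) = w" if "R *v w = 0" for w
  proof -
    have "G0 *v (Upsilon *v w) = (mat 1 - pinv R ** R) *v w" by (simp add: N matrix_vector_mul_assoc)
    then show ?thesis using that by (simp add: matrix_vector_mult_diff_rdistrib flip: matrix_vector_mul_assoc)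
  qed
  have closed_loop: "lq_A0 A B R P + lq_D0 B R ** P1 = A - B ** feedback_gain (P + P1)" for P P1
    unfolding lq_A0_def lq_D0_def feedback_gain_def
    by (simp add: matrix_eq matrix_vector_mult_add_rdistrib matrix_vector_mult_diff_rdistrib
        matrix_vector_right_distrib matrix_vector_mult_minus_left flip: matrix_vector_mul_assoc)
  have feedback: "A + B ** (- feedback_gain X + G0 ** K) = A - B ** feedback_gain X + B0 ** K" for X K
    unfolding B0
    by (simp add: matrix_eq matrix_vector_mult_add_rdistrib matrix_vector_mult_diff_rdistrib
        matrix_vector_right_distrib matrix_vector_mult_diff_distrib matrix_vector_mult_minus_left matrix_vector_mult_minus_right
        flip: matrix_vector_mul_assoc)
  \<comment> \<open>The two quadratic equations add up to the Riccati equation for the sum.\<close>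
  have residual: "riccati_residual (P + P1) = 0"
    if "0 = transpose A ** P + P ** A + Q - P ** B ** pinv R ** transpose B ** P"
      and "0 = P1 ** lq_A0 A B R P + transpose (lq_A0 A B R P) ** P1 + P1 ** lq_D0 B R ** P1"
      and "transpose P = P" for P P1
  proof -
    define S where "S = B ** pinv R ** transpose B"
    have tS: "transpose S = S"
      using pinv_symmetric(3)[OF sym_R] by (simp add: S_def matrix_transpose_mul matrix_mul_assoc)
    have tA0: "transpose (lq_A0 A B R P) = transpose A - P ** S"
      using tS that(3) by (simp add: lq_A0_def S_def[symmetric] matrix_transpose_mul transpose_diff)
    have e1: "transpose A ** P + P ** A + Q - P ** S ** P = 0"
      using that(1) by (simp add: S_def matrix_mul_assoc)
    have e2: "P1 ** (A - S ** P) + (transpose A - P ** S) ** P1 + P1 ** (- S) ** P1 = 0"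
      using that(2) unfolding tA0 by (simp add: lq_A0_def lq_D0_def S_def)
    have "riccati_residual (P + P1) = transpose A ** (P + P1) + (P + P1) ** A + Q - (P + P1) ** S ** (P + P1)"
      by (simp add: riccati_residual_def S_def matrix_mul_assoc)
    also have "\<dots> = (transpose A ** P + P ** A + Q - P ** S ** P) +
        (P1 ** (A - S ** P) + (transpose A - P ** S) ** P1 + P1 ** (- S) ** P1)"
      by (simp add: matrix_eq matrix_vector_mult_add_rdistrib matrix_vector_mult_diff_rdistrib
        matrix_vector_right_distrib matrix_vector_mult_diff_distrib matrix_vector_mult_minus_left
        matrix_vector_mult_minus_right flip: matrix_vector_mul_assoc)
    finally show ?thesis using e1 e2 by simp
  qed
  \<comment> \<open>\<open>C0 + B0' P1\<close> equals \<open>G0\<^sup>T B\<^sup>T (P + P1)\<close>, whose vanishing means that the range of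
    \<open>B\<^sup>T (P + P1)\<close> is orthogonal to the kernel of \<open>R\<close>.\<close>
  have regular_iff: "lq_C0 B R T0 P + transpose B0 ** P1 = 0 \<longleftrightarrow> regular (P + P1)"
    if sym: "transpose P = P" "transpose P1 = P1" for P P1
  proof -
    have symX: "transpose (P + P1) = P + P1" using sym by (simp add: transpose_add)
    have eq: "lq_C0 B R T0 P + transpose B0 ** P1 = transpose G0 ** transpose B ** (P + P1)"
      unfolding ker(4) B0 using sym(1) by (simp add: matrix_transpose_mul matrix_add_ldistrib matrix_mul_assoc)
    show ?thesis
    proof
      assume "lq_C0 B R T0 P + transpose B0 ** P1 = 0"
      then have 0: "transpose G0 *v (transpose B *v ((P + P1) *v x)) = 0" for x
        unfolding eq by (metis matrix_vector_mul_assoc matrix_vector_mult_0)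
      show "regular (P + P1)"
      proof (rule regular_if_range_condition[OF symX])
        fix w x assume "R *v w = 0"
        then have w: "w = G0 *v (Upsilon *v w)" using ker_R by simp
        have "x \<bullet> ((P + P1) *v (B *v (G0 *v z))) = (transpose G0 *v (transpose B *v ((P + P1) *v x))) \<bullet> z" for z
          by (metis inner_matrix_adjoint inner_matrix_sym[OF symX])
        then show "x \<bullet> ((P + P1) *v (B *v w)) = 0" by (metis 0 inner_zero_left w)
      qed
    next
      assume "regular (P + P1)"
      then have "transpose G0 ** transpose B ** (P + P1) =
          transpose G0 ** R ** (pinv R ** transpose B ** (P + P1))"
        by (simp add: regular_def flip: matrix_mul_assoc)
      also have "transpose G0 ** R = 0"
        using arg_cong[OF RG, of transpose] by (simp add: matrix_transpose_mul sym_R)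
      finally show "lq_C0 B R T0 P + transpose B0 ** P1 = 0" unfolding eq by simp
    qed
  qed
  have synth: "(\<exists>K. stable_matrix (lq_A0 A B R P + lq_D0 B R ** P1 + B0 ** K)) \<and>
      (\<forall>K F. stable_matrix (lq_A0 A B R P + lq_D0 B R ** P1 + B0 ** K) \<and>
         F = - (pinv R ** transpose B ** (P + P1)) + G0 ** K \<longrightarrow>
         (\<forall>x0. (\<exists>x. is_state A B x0 (\<lambda>t. F *v x t) x) \<and>
            (\<forall>x. is_state A B x0 (\<lambda>t. F *v x t) x \<longrightarrow> lq_optimal A B Q R x0 (\<lambda>t. F *v x t) x))) \<and>
      (\<forall>x0. lq_value A B Q R x0 = ennreal (x0 \<bullet> ((P + P1) *v x0)))"
    if c: "solvability_conditions A B Q R T0 B0 P P1" for P P1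
  proof -
    have sym: "transpose P = P" "transpose P1 = P1"
      and ric: "0 = transpose A ** P + P ** A + Q - P ** B ** pinv R ** transpose B ** P"
        "0 = P1 ** lq_A0 A B R P + transpose (lq_A0 A B R P) ** P1 + P1 ** lq_D0 B R ** P1"
      and cond2: "lq_C0 B R T0 P + transpose B0 ** P1 = 0"
      and stab: "stabilizable (lq_A0 A B R P + lq_D0 B R ** P1) B0"
      using c unfolding solvability_conditions_def by blast+
    define X where "X = P + P1"
    have symX: "transpose X = X" using sym by (simp add: X_def transpose_add)
    have reg: "regular X" using regular_iff[OF sym] cond2 by (simp add: X_def)
    have res: "riccati_residual X = 0" unfolding X_def by (rule residual[OF ric sym(1)])
    define F where "F K = - feedback_gain X + G0 ** K" for K
    have RF: "R ** (F K + feedback_gain X) = 0" for K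
      using RG by (simp add: F_def matrix_mul_assoc)
    have AF: "A + B ** F K = lq_A0 A B R P + lq_D0 B R ** P1 + B0 ** K" for K
      unfolding F_def feedback closed_loop X_def ..
    have F_eq: "- (pinv R ** transpose B ** (P + P1)) + G0 ** K = F K" for K
      by (simp add: F_def feedback_gain_def X_def)
    note opt = stabilizing_solution_optimal[OF symX reg res RF, unfolded AF]
    obtain K where K: "stable_matrix (lq_A0 A B R P + lq_D0 B R ** P1 + B0 ** K)"
      using stabilizable_imp_stabilizing_feedback[OF stab] by blast
    have ex: "\<exists>x. is_state A B x0 (\<lambda>t. F *v x t) x" for F x0 using feedback_state_exists by blast
    have "lq_value A B Q R x0 = ennreal (x0 \<bullet> ((P + P1) *v x0))" for x0
      using ex[of x0 "F K"] opt(2)[OF K] unfolding X_def by blast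
    then show ?thesis unfolding F_eq using K ex opt(1) F_eq by blast
  qed
  \<comment> \<open>The pair \<open>P = X\<close>, \<open>P1 = 0\<close> built from the value matrix satisfies the conditions.\<close>
  have "?conditions" if solvable: "?solvable"
  proof -
    have ex: "\<exists>u x. lq_optimal A B Q R x0 u x" for x0 using solvable by blast
    obtain X where X: "pos_semidef X" "regular X" "riccati_residual X = 0"
      and traj: "\<And>x0. \<exists>u x. is_state A B x0 u x \<and> (x \<longlongrightarrow> 0) at_top \<and>
       (\<forall>t\<ge>0. ((\<lambda>s. defect X (x s) (u s)) has_integral 0) {0..t})"
      by (rule optimality_necessary[OF ex]) (rule that)
    have sym: "transpose X = X" using X(1) by (simp add: pos_semidef_def)
    have "stabilizable (lq_A0 A B R X + lq_D0 B R ** 0) B0"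
      unfolding closed_loop stabilizable_def
    proof
      fix x0
      obtain u x where ux: "is_state A B x0 u x" "(x \<longlongrightarrow> 0) at_top"
        and z: "\<And>t. 0 \<le> t \<Longrightarrow> ((\<lambda>s. defect X (x s) (u s)) has_integral 0) {0..t}"
        using traj by blast
      have "negligible {s \<in> {0..t}. G0 *v (Upsilon *v (u s + feedback_gain X *v x s)) \<noteq> u s + feedback_gain X *v x s}"
        if t: "0 \<le> t" for t
      proof (rule negligible_subset[OF negligible_if_integral_zero[OF _ z[OF t]]])
        show "0 \<le> defect X (x s) (u s)" for s using psd_R by (simp add: pos_semidef_def)
        show "{s \<in> {0..t}. G0 *v (Upsilon *v (u s + feedback_gain X *v x s)) \<noteq> u s + feedback_gain X *v x s}
            \<subseteq> {s \<in> {0..t}. defect X (x s) (u s) \<noteq> 0}"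
          using psd_kernel[OF psd_R] ker_R by blast
      qed
      from is_state_change_input[OF ux(1) this]
      show "\<exists>u x. is_state (A - B ** feedback_gain (X + 0)) B0 x0 u x \<and> (x \<longlongrightarrow> 0) at_top"
        using ux(2) unfolding B0 by auto
    qed
    moreover have "lq_C0 B R T0 X + transpose B0 ** 0 = 0"
      using regular_iff[OF sym, of 0] X(2) by simp
    ultimately have "solvability_conditions A B Q R T0 B0 X 0"
      using X(1,3) sym unfolding solvability_conditions_def riccati_residual_def by simp
    then show ?thesis by blast
  qed
  moreover have "?solvable" if "?conditions"
  proof
    fix x0
    obtain P P1 where c: "solvability_conditions A B Q R T0 B0 P P1" using \<open>?conditions\<close> by blast
    obtain K where "stable_matrix (lq_A0 A B R P + lq_D0 B R ** P1 + B0 ** K)"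
      using synth[OF c] by blast
    then have "\<exists>x. lq_optimal A B Q R x0 (\<lambda>t. (- (pinv R ** transpose B ** (P + P1)) + G0 ** K) *v x t) x"
      using synth[OF c] by blast
    then show "\<exists>u x. lq_optimal A B Q R x0 u x" by blast
  qed
  ultimately show ?thesis using synth by blast
qed

end
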